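(* Let $X=(M,J)$ be an almost complex manifold of real dimension $2n$, with $M$ real parallelizable, and let $\{v_1,w_1,\dots,v_n,w_n\}$ be a global frame of $TM$ with $Jv_i=w_i$, $Jw_i=-v_i$ for $i=1,\dots,n$. Let $\varphi^i=v^i+\sqrt{-1}\,w^i$, where $\{v^1,w^1,\dots,v^n,w^n\}$ is the dual coframe, and let $\psi=\varphi^1\wedge\dots\wedge\varphi^n$, a smooth section of the canonical bundle $\omega_X$. If $\bar\partial\psi=0$, then the Kodaira dimension of $X$ is $\mathrm{kod}(X)=0$.
   Context: $J$ is a smooth endomorphism of $TM$ with $J^2=-\mathrm{id}$; $J$ need not be integrable. $\omega_X=\bigwedge^{n,0}X$ is the bundle of $(n,0)$-forms. On forms, $\bar\partial$ is the component of $d$ mapping $(p,q)$-forms to $(p,q+1)$-forms. Identifying $\bigwedge^{n,1}X$ with $\bigwedge^{0,1}X\otimes\omega_X$ (via $\eta\wedge s\leftrightarrow\eta\otimes s$), $\bar\partial$ acts on sections of $\omega_X$, and it is extended by the Leibniz rule to an operator $\bar\partial:\Gamma(X,\omega_X^{\otimes m})\to\Gamma(X,\bigwedge^{0,1}X\otimes\omega_X^{\otimes m})$. Set $H^0(X,\omega_X^{\otimes m})=\{s\in\Gamma(X,\omega_X^{\otimes m}) : \bar\partial s=0\}$. The Kodaira dimension is $\mathrm{kod}(X)=-\infty$ if $H^0(X,\omega_X^{\otimes m})=0$ for all $m\ge1$, and otherwise $\mathrm{kod}(X)=\limsup_{m\to+\infty}\frac{\log\dim H^0(X,\omega_X^{\otimes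 m})}{\log m}$.
   Formalization: The formal theorem additionally assumes that M is compact; without this the claim fails (for X = C with ψ = dz, H^0 is infinite-dimensional for every m, so kod(X) is not 0). Connectedness is not assumed. *)

theory Defs
  imports "HOL-Analysis.Analysis" "HOL-Library.Function_Algebras"
begin

section \<open>Vector spaces of functions\<close>

definition rscale :: "real \<Rightarrow> ('x \<Rightarrow> 'e::real_vector) \<Rightarrow> 'x \<Rightarrow> 'e" where
  "rscale r f = (\<lambda>x. r *\<^sub>R f x)"

definition cscale :: "complex \<Rightarrow> ('x \<Rightarrow> complex) \<Rightarrow> 'x \<Rightarrow> complex" where
  "cscale r f = (\<lambda>x. r * f x)"

definition cscale_sect :: "complex \<Rightarrow> ('p \<Rightarrow> 'x \<Rightarrow> complex) \<Rightarrow> 'p \<Rightarrow> 'x \<Rightarrow> complex" where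
  "cscale_sect r s = (\<lambda>p. cscale r (s p))"

interpretation rfun: vector_space rscale
  by unfold_locales (auto simp: rscale_def fun_eq_iff algebra_simps)

interpretation cfun: vector_space cscale
  by unfold_locales (auto simp: cscale_def fun_eq_iff algebra_simps)

interpretation csect: vector_space cscale_sect
  by unfold_locales (auto simp: cscale_sect_def cscale_def fun_eq_iff algebra_simps)


section \<open>Smooth manifolds\<close>

text \<open>\<open>C\<^sup>k\<close> maps, meant to be used for open sets \<open>S\<close>.\<close>

primrec Ck_on :: "nat \<Rightarrow> 'e::real_normed_vector set \<Rightarrow> ('e \<Rightarrow> 'f::real_normed_vector) \<Rightarrow> bool" where
  "Ck_on 0 S f \<longleftrightarrow> continuous_on S f"
| "Ck_on (Suc k) S f \<longleftrightarrow> (\<forall>x\<in>S. f differentiable (at x)) \<and>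
     (\<forall>e. Ck_on k S (\<lambda>x. frechet_derivative f (at x) e))"

definition smooth_on :: "'e::real_normed_vector set \<Rightarrow> ('e \<Rightarrow> 'f::real_normed_vector) \<Rightarrow> bool" where
  "smooth_on S f \<longleftrightarrow> (\<forall>k. Ck_on k S f)"

text \<open>The underlying space of the manifold is a whole type \<open>'a\<close>; a chart is a domain together with
  a coordinate map, whose values outside the domain are irrelevant.\<close>

type_synonym ('a, 'e) chart = "'a set \<times> ('a \<Rightarrow> 'e)"

definition chart_inv :: "('a, 'e) chart \<Rightarrow> 'e \<Rightarrow> 'a" where
  "chart_inv c = inv_into (fst c) (snd c)"

definition is_chart :: "('a::topological_space, 'e::euclidean_space) chart \<Rightarrow> bool" where
  "is_chart c \<longleftrightarrow> open (fst c) \<and> open (snd c ` fst c) \<and>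
     homeomorphism (fst c) (snd c ` fst c) (snd c) (chart_inv c)"

definition smooth_atlas ::
    "('a::{t2_space,second_countable_topology}, 'e::euclidean_space) chart set \<Rightarrow> bool" where
  "smooth_atlas A \<longleftrightarrow> (\<forall>c\<in>A. is_chart c) \<and> (\<Union>c\<in>A. fst c) = UNIV \<and>
     (\<forall>c\<in>A. \<forall>c'\<in>A. smooth_on (snd c ` (fst c \<inter> fst c')) (snd c' \<circ> chart_inv c))"

definition charts_at :: "('a, 'e) chart set \<Rightarrow> 'a \<Rightarrow> ('a, 'e) chart set" where
  "charts_at A p = {c \<in> A. p \<in> fst c}"


section \<open>Tangent vectors and vector fields\<close>

text \<open>A tangent vector at \<open>p\<close> is a class of pairs (chart around \<open>p\<close>, vector) under the change of
  coordinates, i.e. a family of component vectors indexed by the charts around \<open>p\<close>. The value at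
  all other charts is fixed to be 0.\<close>

type_synonym ('a, 'e) tvec = "('a, 'e) chart \<Rightarrow> 'e"

definition tangent_space ::
    "('a, 'e::euclidean_space) chart set \<Rightarrow> 'a \<Rightarrow> ('a, 'e) tvec set" where
  "tangent_space A p = {\<xi>. (\<forall>c. c \<notin> charts_at A p \<longrightarrow> \<xi> c = 0) \<and>
     (\<forall>c\<in>charts_at A p. \<forall>c'\<in>charts_at A p.
        \<xi> c' = frechet_derivative (snd c' \<circ> chart_inv c) (at (snd c p)) (\<xi> c))}"

text \<open>The tangent vector at \<open>p\<close> with components \<open>e\<close> in the chart \<open>c\<close>.\<close>

definition chart_vec ::
    "('a, 'e::euclidean_space) chart set \<Rightarrow> ('a, 'e) chart \<Rightarrow> 'a \<Rightarrow> 'e \<Rightarrow> ('a, 'e) tvec" where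
  "chart_vec A c p e = (\<lambda>c'. if c' \<in> charts_at A p
     then frechet_derivative (snd c' \<circ> chart_inv c) (at (snd c p)) e else 0)"

definition smooth_vector_field ::
    "('a, 'e::euclidean_space) chart set \<Rightarrow> ('a \<Rightarrow> ('a, 'e) tvec) \<Rightarrow> bool" where
  "smooth_vector_field A X \<longleftrightarrow> (\<forall>p. X p \<in> tangent_space A p) \<and>
     (\<forall>c\<in>A. smooth_on (snd c ` fst c) (\<lambda>x. X (chart_inv c x) c))"

definition almost_complex_structure ::
    "('a, 'e::euclidean_space) chart set \<Rightarrow> ('a \<Rightarrow> ('a, 'e) tvec \<Rightarrow> ('a, 'e) tvec) \<Rightarrow> bool" where
  "almost_complex_structure A J \<longleftrightarrow>
     (\<forall>p. \<forall>\<xi>\<in>tangent_space A p. J p \<xi> \<in> tangent_space A p \<and> J p (J p \<xi>) = - \<xi>) \<and>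
     (\<forall>p. \<forall>\<xi>\<in>tangent_space A p. \<forall>\<eta>\<in>tangent_space A p. \<forall>a b.
        J p (rscale a \<xi> + rscale b \<eta>) = rscale a (J p \<xi>) + rscale b (J p \<eta>)) \<and>
     (\<forall>c\<in>A. \<forall>e. smooth_on (snd c ` fst c)
        (\<lambda>x. J (chart_inv c x) (chart_vec A c (chart_inv c x) e) c))"

definition global_frame ::
    "('a, 'e::euclidean_space) chart set \<Rightarrow> nat \<Rightarrow> (nat \<Rightarrow> 'a \<Rightarrow> ('a, 'e) tvec) \<Rightarrow>
     (nat \<Rightarrow> 'a \<Rightarrow> ('a, 'e) tvec) \<Rightarrow> bool" where
  "global_frame A n v w \<longleftrightarrow>
     (\<forall>i\<in>{1..n}. smooth_vector_field A (v i) \<and> smooth_vector_field A (w i)) \<and>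
     (\<forall>p. let vs = map (\<lambda>i. v i p) [1..<Suc n] @ map (\<lambda>i. w i p) [1..<Suc n] in
        distinct vs \<and> rfun.independent (set vs) \<and> rfun.span (set vs) = tangent_space A p)"

definition real_covector ::
    "('a, 'e::euclidean_space) chart set \<Rightarrow> 'a \<Rightarrow> (('a, 'e) tvec \<Rightarrow> real) \<Rightarrow> bool" where
  "real_covector A p f \<longleftrightarrow> (\<forall>\<xi>\<in>tangent_space A p. \<forall>\<eta>\<in>tangent_space A p. \<forall>a b.
     f (rscale a \<xi> + rscale b \<eta>) = a * f \<xi> + b * f \<eta>)"

definition dual_coframe ::
    "('a, 'e::euclidean_space) chart set \<Rightarrow> nat \<Rightarrow>
     (nat \<Rightarrow> 'a \<Rightarrow> ('a, 'e) tvec) \<Rightarrow> (nat \<Rightarrow> 'a \<Rightarrow> ('a, 'e) tvec) \<Rightarrow>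
     (nat \<Rightarrow> 'a \<Rightarrow> ('a, 'e) tvec \<Rightarrow> real) \<Rightarrow> (nat \<Rightarrow> 'a \<Rightarrow> ('a, 'e) tvec \<Rightarrow> real) \<Rightarrow> bool" where
  "dual_coframe A n v w v' w' \<longleftrightarrow> (\<forall>p. \<forall>i\<in>{1..n}.
     real_covector A p (v' i p) \<and> real_covector A p (w' i p) \<and>
     (\<forall>j\<in>{1..n}. v' i p (v j p) = (if i = j then 1 else 0) \<and> v' i p (w j p) = 0 \<and>
                 w' i p (w j p) = (if i = j then 1 else 0) \<and> w' i p (v j p) = 0))"


section \<open>Complex covariant tensors and the exterior derivative\<close>

text \<open>A complex covariant \<open>k\<close>-tensor at \<open>p\<close> is a function of lists of tangent vectors that vanishes
  on every list which does not consist of exactly \<open>k\<close> elements of the tangent space at \<open>p\<close>.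
  Forms, and sections of tensor products of bundles of forms, are fields of such tensors.\<close>

type_synonym ('a, 'e) ctensor = "('a, 'e) tvec list \<Rightarrow> complex"

text \<open>Tensor products; \<open>k\<close> is the degree of the first factor, resp. of all factors.\<close>

definition tprod :: "nat \<Rightarrow> ('t list \<Rightarrow> complex) \<Rightarrow> ('t list \<Rightarrow> complex) \<Rightarrow> 't list \<Rightarrow> complex" where
  "tprod k \<alpha> \<beta> = (\<lambda>xs. \<alpha> (take k xs) * \<beta> (drop k xs))"

primrec tprods :: "nat \<Rightarrow> ('t list \<Rightarrow> complex) list \<Rightarrow> 't list \<Rightarrow> complex" where
  "tprods k [] = (\<lambda>xs. if xs = [] then 1 else 0)"
| "tprods k (\<alpha> # \<alpha>s) = tprod k \<alpha> (tprods k \<alpha>s)"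

text \<open>The linear map \<open>\<eta> \<otimes> \<beta> \<mapsto> \<eta> \<and> \<beta>\<close> for a 1-form \<open>\<eta>\<close> and a form \<open>\<beta>\<close>, where
  \<open>(\<eta> \<and> \<beta>)(\<xi>\<^sub>0,\<dots>,\<xi>\<^sub>k) = \<Sum>\<^sub>i (-1)\<^sup>i \<eta>(\<xi>\<^sub>i) \<beta>(\<dots>,\<xi>\<^sub>i omitted,\<dots>)\<close>. Iterating it gives the normalisation
  \<open>(\<theta>\<^sub>1 \<and> \<dots> \<and> \<theta>\<^sub>k)(\<xi>\<^sub>1,\<dots>,\<xi>\<^sub>k) = det (\<theta>\<^sub>i(\<xi>\<^sub>j))\<close>.\<close>

definition wedge_map :: "('t list \<Rightarrow> complex) \<Rightarrow> 't list \<Rightarrow> complex" where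
  "wedge_map \<tau> = (\<lambda>xs. \<Sum>i<length xs. (-1) ^ i * \<tau> (xs ! i # take i xs @ drop (Suc i) xs))"

primrec wedges :: "('t list \<Rightarrow> complex) list \<Rightarrow> 't list \<Rightarrow> complex" where
  "wedges [] = (\<lambda>xs. if xs = [] then 1 else 0)"
| "wedges (\<theta> # \<theta>s) = wedge_map (tprod 1 \<theta> (wedges \<theta>s))"

definition smooth_tensor ::
    "('a, 'e::euclidean_space) chart set \<Rightarrow> ('a \<Rightarrow> ('a, 'e) ctensor) \<Rightarrow> bool" where
  "smooth_tensor A \<alpha> \<longleftrightarrow> (\<forall>c\<in>A. \<forall>es. smooth_on (snd c ` fst c)
     (\<lambda>x. \<alpha> (chart_inv c x) (map (chart_vec A c (chart_inv c x)) es)))"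

text \<open>Derivative of the coefficients of \<open>\<alpha>\<close> in the chart \<open>c\<close>; the first argument is the direction
  of differentiation.\<close>

definition chart_deriv ::
    "('a, 'e::euclidean_space) chart set \<Rightarrow> ('a, 'e) chart \<Rightarrow> ('a \<Rightarrow> ('a, 'e) ctensor) \<Rightarrow>
     'a \<Rightarrow> ('a, 'e) ctensor" where
  "chart_deriv A c \<alpha> p = (\<lambda>xs. case xs of [] \<Rightarrow> 0 | \<xi> # ys \<Rightarrow>
     frechet_derivative
       (\<lambda>x. \<alpha> (chart_inv c x) (map (chart_vec A c (chart_inv c x)) (map (\<lambda>\<eta>. \<eta> c) ys)))
       (at (snd c p)) (\<xi> c))"

text \<open>The coordinate formula for \<open>d\<close>. For smooth forms the result does not depend on the chart.\<close>

definition ext_deriv ::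
    "('a, 'e::euclidean_space) chart set \<Rightarrow> ('a \<Rightarrow> ('a, 'e) ctensor) \<Rightarrow> 'a \<Rightarrow> ('a, 'e) ctensor" where
  "ext_deriv A \<alpha> p = (\<lambda>xs. if set xs \<subseteq> tangent_space A p
     then wedge_map (chart_deriv A (SOME c. c \<in> charts_at A p) \<alpha> p) xs else 0)"


section \<open>Types of forms and the operator \<open>\<partial>\<close>-bar\<close>

definition cotangent_C ::
    "('a, 'e::euclidean_space) chart set \<Rightarrow> 'a \<Rightarrow> ('a, 'e) ctensor set" where
  "cotangent_C A p = {\<theta>. (\<forall>xs. \<theta> xs \<noteq> 0 \<longrightarrow> (\<exists>\<xi>\<in>tangent_space A p. xs = [\<xi>])) \<and>
     (\<forall>\<xi>\<in>tangent_space A p. \<forall>\<eta>\<in>tangent_space A p. \<forall>a b.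
        \<theta> [rscale a \<xi> + rscale b \<eta>] = of_real a * \<theta> [\<xi>] + of_real b * \<theta> [\<eta>])}"

definition Lambda10 ::
    "('a, 'e::euclidean_space) chart set \<Rightarrow> ('a \<Rightarrow> ('a, 'e) tvec \<Rightarrow> ('a, 'e) tvec) \<Rightarrow> 'a \<Rightarrow>
     ('a, 'e) ctensor set" where
  "Lambda10 A J p = {\<theta> \<in> cotangent_C A p. \<forall>\<xi>\<in>tangent_space A p. \<theta> [J p \<xi>] = \<i> * \<theta> [\<xi>]}"

definition Lambda01 ::
    "('a, 'e::euclidean_space) chart set \<Rightarrow> ('a \<Rightarrow> ('a, 'e) tvec \<Rightarrow> ('a, 'e) tvec) \<Rightarrow> 'a \<Rightarrow>
     ('a, 'e) ctensor set" where
  "Lambda01 A J p = {\<theta> \<in> cotangent_C A p. \<forall>\<xi>\<in>tangent_space A p. \<theta> [J p \<xi>] = - \<i> * \<theta> [\<xi>]}"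

definition Lambda ::
    "('a, 'e::euclidean_space) chart set \<Rightarrow> ('a \<Rightarrow> ('a, 'e) tvec \<Rightarrow> ('a, 'e) tvec) \<Rightarrow>
     nat \<Rightarrow> nat \<Rightarrow> 'a \<Rightarrow> ('a, 'e) ctensor set" where
  "Lambda A J a b p = cfun.span {wedges (\<theta>s @ \<eta>s) | \<theta>s \<eta>s.
     length \<theta>s = a \<and> set \<theta>s \<subseteq> Lambda10 A J p \<and> length \<eta>s = b \<and> set \<eta>s \<subseteq> Lambda01 A J p}"

text \<open>The component in \<open>Lambda A J a b p\<close> of a complex \<open>(a+b)\<close>-form \<open>\<beta>\<close> at \<open>p\<close>, with respect to the
  direct sum decomposition into types.\<close>

definition type_component ::
    "('a, 'e::euclidean_space) chart set \<Rightarrow> ('a \<Rightarrow> ('a, 'e) tvec \<Rightarrow> ('a, 'e) tvec) \<Rightarrow>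
     nat \<Rightarrow> nat \<Rightarrow> 'a \<Rightarrow> ('a, 'e) ctensor \<Rightarrow> ('a, 'e) ctensor" where
  "type_component A J a b p \<beta> = (THE \<gamma>. \<exists>g.
     (\<forall>i\<le>a + b. g i \<in> Lambda A J i (a + b - i) p) \<and> \<beta> = (\<Sum>i\<le>a + b. g i) \<and> \<gamma> = g a)"

definition dbar_form ::
    "('a, 'e::euclidean_space) chart set \<Rightarrow> ('a \<Rightarrow> ('a, 'e) tvec \<Rightarrow> ('a, 'e) tvec) \<Rightarrow>
     nat \<Rightarrow> nat \<Rightarrow> ('a \<Rightarrow> ('a, 'e) ctensor) \<Rightarrow> 'a \<Rightarrow> ('a, 'e) ctensor" where
  "dbar_form A J a b \<alpha> p = type_component A J a (Suc b) p (ext_deriv A \<alpha> p)"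


section \<open>Pluricanonical sections and Kodaira dimension\<close>

text \<open>The parameter \<open>n\<close> is half the real dimension throughout.\<close>

definition canonical_sections ::
    "('a, 'e::euclidean_space) chart set \<Rightarrow> ('a \<Rightarrow> ('a, 'e) tvec \<Rightarrow> ('a, 'e) tvec) \<Rightarrow> nat \<Rightarrow>
     ('a \<Rightarrow> ('a, 'e) ctensor) set" where
  "canonical_sections A J n = {s. (\<forall>p. s p \<in> Lambda A J n 0 p) \<and> smooth_tensor A s}"

definition pluricanonical_fibre ::
    "('a, 'e::euclidean_space) chart set \<Rightarrow> ('a \<Rightarrow> ('a, 'e) tvec \<Rightarrow> ('a, 'e) tvec) \<Rightarrow>
     nat \<Rightarrow> nat \<Rightarrow> 'a \<Rightarrow> ('a, 'e) ctensor set" where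
  "pluricanonical_fibre A J n m p =
     cfun.span {tprods n \<alpha>s | \<alpha>s. length \<alpha>s = m \<and> set \<alpha>s \<subseteq> Lambda A J n 0 p}"

definition pluricanonical_sections ::
    "('a, 'e::euclidean_space) chart set \<Rightarrow> ('a \<Rightarrow> ('a, 'e) tvec \<Rightarrow> ('a, 'e) tvec) \<Rightarrow>
     nat \<Rightarrow> nat \<Rightarrow> ('a \<Rightarrow> ('a, 'e) ctensor) set" where
  "pluricanonical_sections A J n m =
     {s. (\<forall>p. s p \<in> pluricanonical_fibre A J n m p) \<and> smooth_tensor A s}"

text \<open>\<open>\<partial>\<close>-bar on sections of the canonical bundle, with values in \<open>\<Lambda>\<^sup>0\<^sup>,\<^sup>1 \<otimes> \<Lambda>\<^sup>n\<^sup>,\<^sup>0\<close> through the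
  isomorphism \<open>\<eta> \<otimes> s \<mapsto> \<eta> \<and> s\<close> onto \<open>\<Lambda>\<^sup>n\<^sup>,\<^sup>1\<close>.\<close>

definition dbar_canonical ::
    "('a, 'e::euclidean_space) chart set \<Rightarrow> ('a \<Rightarrow> ('a, 'e) tvec \<Rightarrow> ('a, 'e) tvec) \<Rightarrow> nat \<Rightarrow>
     ('a \<Rightarrow> ('a, 'e) ctensor) \<Rightarrow> 'a \<Rightarrow> ('a, 'e) ctensor" where
  "dbar_canonical A J n s p =
     inv_into (cfun.span {tprod 1 \<eta> \<sigma> | \<eta> \<sigma>. \<eta> \<in> Lambda01 A J p \<and> \<sigma> \<in> Lambda A J n 0 p})
       wedge_map (dbar_form A J n 0 s p)"

text \<open>\<open>\<Sum>\<^sub>i s\<^sub>1 \<otimes> \<dots> \<otimes> \<partial>\<close>-bar\<open> s\<^sub>i \<otimes> \<dots> \<otimes> s\<^sub>m\<close>, the \<open>(0,1)\<close>-argument being moved to the front.\<close>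

definition dbar_leibniz ::
    "('a, 'e::euclidean_space) chart set \<Rightarrow> ('a \<Rightarrow> ('a, 'e) tvec \<Rightarrow> ('a, 'e) tvec) \<Rightarrow> nat \<Rightarrow>
     ('a \<Rightarrow> ('a, 'e) ctensor) list \<Rightarrow> 'a \<Rightarrow> ('a, 'e) ctensor" where
  "dbar_leibniz A J n ss p = (\<lambda>xs. case xs of [] \<Rightarrow> 0 | \<xi> # ys \<Rightarrow>
     \<Sum>i<length ss. tprods n
       ((map (\<lambda>s. s p) ss)[i := (\<lambda>zs. dbar_canonical A J n (ss ! i) p (\<xi> # zs))]) ys)"

text \<open>\<open>\<partial>\<close>-bar on sections of the \<open>m\<close>-th power of the canonical bundle, for \<open>m \<ge> 1\<close>. Since the
  canonical bundle is a line bundle, every section of its power coincides near each point with a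
  tensor product of global sections of the bundle itself; the Leibniz rule determines the value.\<close>

definition dbar_pluri ::
    "('a::topological_space, 'e::euclidean_space) chart set \<Rightarrow>
     ('a \<Rightarrow> ('a, 'e) tvec \<Rightarrow> ('a, 'e) tvec) \<Rightarrow> nat \<Rightarrow> nat \<Rightarrow>
     ('a \<Rightarrow> ('a, 'e) ctensor) \<Rightarrow> 'a \<Rightarrow> ('a, 'e) ctensor" where
  "dbar_pluri A J n m s p = (THE t. \<exists>U ss. open U \<and> p \<in> U \<and>
     length ss = m \<and> set ss \<subseteq> canonical_sections A J n \<and>
     (\<forall>q\<in>U. s q = tprods n (map (\<lambda>\<sigma>. \<sigma> q) ss)) \<and> t = dbar_leibniz A J n ss p)"

definition H0 ::
    "('a::topological_space, 'e::euclidean_space) chart set \<Rightarrow>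
     ('a \<Rightarrow> ('a, 'e) tvec \<Rightarrow> ('a, 'e) tvec) \<Rightarrow> nat \<Rightarrow> nat \<Rightarrow> ('a \<Rightarrow> ('a, 'e) ctensor) set" where
  "H0 A J n m = {s \<in> pluricanonical_sections A J n m. \<forall>p. dbar_pluri A J n m s p = 0}"

text \<open>Logarithm of the complex dimension, with \<open>log 0 = -\<infinity>\<close> and \<open>log \<infinity> = \<infinity>\<close>; the library function
  \<open>dim\<close> is not meaningful for infinite-dimensional spaces.\<close>

definition log_dim :: "('p \<Rightarrow> 'x \<Rightarrow> complex) set \<Rightarrow> ereal" where
  "log_dim V = (if \<exists>B. finite B \<and> V \<subseteq> csect.span B
     then if csect.dim V = 0 then -\<infinity> else ereal (ln (real (csect.dim V)))
     else \<infinity>)"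

definition kodaira_dim ::
    "('a::topological_space, 'e::euclidean_space) chart set \<Rightarrow>
     ('a \<Rightarrow> ('a, 'e) tvec \<Rightarrow> ('a, 'e) tvec) \<Rightarrow> nat \<Rightarrow> ereal" where
  "kodaira_dim A J n = (if \<forall>m\<ge>1. H0 A J n m = {0} then -\<infinity>
     else limsup (\<lambda>m. log_dim (H0 A J n m) / ereal (ln (real m))))"

text \<open>The complex 1-form \<open>f + \<i> g\<close> built from real 1-forms \<open>f\<close> and \<open>g\<close>.\<close>

definition complex_one_form ::
    "('a, 'e::euclidean_space) chart set \<Rightarrow> ('a \<Rightarrow> ('a, 'e) tvec \<Rightarrow> real) \<Rightarrow>
     ('a \<Rightarrow> ('a, 'e) tvec \<Rightarrow> real) \<Rightarrow> 'a \<Rightarrow> ('a, 'e) ctensor" where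
  "complex_one_form A f g p = (\<lambda>xs. case xs of [\<xi>] \<Rightarrow>
     if \<xi> \<in> tangent_space A p then of_real (f p \<xi>) + \<i> * of_real (g p \<xi>) else 0 | _ \<Rightarrow> 0)"

end

theory Submission
  imports Defs
begin

text \<open>
  As \<open>\<psi>\<close> vanishes nowhere and is \<open>\<partial>\<close>-bar closed, the sections of the \<open>m\<close>-th power of the canonical bundle
  are the products \<open>f \<psi>\<^sup>m\<close>, and such a product is annihilated by \<open>\<partial>\<close>-bar iff \<open>f\<close> is pseudoholomorphic,
  i.e. \<open>df(J\<xi>) = \<i> df(\<xi>)\<close>. For \<open>V = v\<^sub>i\<close> and \<open>W = J V = w\<^sub>i\<close> this gives \<open>V V f + W W f = - (J [V, W]) f\<close>,
  a second order equation without term of order zero for the real functions \<open>Re f\<close> and \<open>Im f\<close>.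
  Hopf's strong maximum principle makes them constant on each connected component. A compact
  manifold has finitely many components, \<open>K\<close> say, hence
  \<open>1 \<le> dim H\<^sup>0 \<le> K\<close> for every \<open>m \<ge> 1\<close>, and \<open>log dim H\<^sup>0 / log m\<close> tends to 0.
\<close>

text \<open>J need not be integrable, so there are no holomorphic coordinates and no local theory of
  holomorphic functions to appeal to; the maximum principle stands in for it. The operator on
  pluricanonical sections is built from definite descriptions and an inverse map, and much of the
  work is to show that these have the intended value: types of forms are separated by the
  eigenvalues of the derivation induced by J; every form decomposes into types, by contracting with
  a frame and wedging back with the coframe; wedging with \<psi> is injective on (0,1)-forms; and
  the Leibniz sum depends on the factors of a section only through their product. Existence of the
  type decomposition matters as much as uniqueness: without it the hypothesis \<partial>-bar \<psi>
  = 0 would concern an unspecified value of \<open>type_component\<close> and say nothing about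
  d\<psi>. The coframe is given by duality alone, so its smoothness, and with it that of \<psi>, has
  to be derived from the smoothness of the frame.\<close>

abbreviation FD :: "('e::real_normed_vector \<Rightarrow> 'f::real_normed_vector) \<Rightarrow> 'e \<Rightarrow> 'e \<Rightarrow> 'f" where
  "FD f x \<equiv> frechet_derivative f (at x)"

abbreviation omit :: "nat \<Rightarrow> 't list \<Rightarrow> 't list" where
  "omit i xs \<equiv> take i xs @ drop (Suc i) xs"

section \<open>Calculus of \<open>C\<^sup>k\<close> maps\<close>

text \<open>The derivatives in \<open>Ck_on\<close> are taken at points of the full space, not
  within S; openness of S is what makes them depend only on the values in S.\<close>

lemma Ck_on_cong:
  assumes "open S" "Ck_on k S f" "\<And>x. x \<in> S \<Longrightarrow> f x = g x"
  shows "Ck_on k S g"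
  using assms(2,3)
proof (induction k arbitrary: f g)
  case 0
  then show ?case
    using continuous_on_cong by (metis Ck_on.simps(1))
next
  case (Suc k)
  have D: "(g has_derivative FD f x) (at x)" if "x \<in> S" for x
    using Suc.prems that \<open>open S\<close> frechet_derivative_works[of f "at x"]
      has_derivative_transform_within_open[of f _ x UNIV S g] by auto
  have eq: "FD g x = FD f x" if "x \<in> S" for x
    using frechet_derivative_at[OF D[OF that]] by simp
  have "Ck_on k S (\<lambda>x. FD g x e)" for e
    by (rule Suc.IH[where f="\<lambda>x. FD f x e"]) (use Suc.prems eq in auto)
  then show ?case
    using D by (auto simp: differentiable_def)
qed

text \<open>The form in which most closure properties are proved: exhibit the derivative in closed
  form, then recognise that formula as \<open>Ck_on k\<close> by the induction hypothesis.\<close>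

lemma Ck_on_SucI:
  assumes "open S" "\<And>x. x \<in> S \<Longrightarrow> (f has_derivative f' x) (at x)"
    and "\<And>e. Ck_on k S (\<lambda>x. f' x e)"
  shows "Ck_on (Suc k) S f"
proof -
  have "FD f x = f' x" if "x \<in> S" for x
    using frechet_derivative_at[OF assms(2)[OF that]] by simp
  then have "Ck_on k S (\<lambda>x. FD f x e)" for e
    using assms(1) assms(3) Ck_on_cong[of S k "\<lambda>x. f' x e"] by auto
  then show ?thesis
    using assms(2) by (auto simp: differentiable_def)
qed

lemma Ck_on_Suc_has_derivative:
  "Ck_on (Suc k) S f \<Longrightarrow> x \<in> S \<Longrightarrow> (f has_derivative FD f x) (at x)"
  using frechet_derivative_works by auto

lemma Ck_on_Suc_imp: "Ck_on (Suc k) S f \<Longrightarrow> Ck_on k S f"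
proof (induction k arbitrary: f)
  case 0
  then show ?case
    by (auto intro!: continuous_at_imp_continuous_on differentiable_imp_continuous_within)
next
  case (Suc k)
  show ?case
    unfolding Ck_on.simps(2)[of k]
  proof (intro conjI allI)
    show "\<forall>x\<in>S. f differentiable at x"
      using Suc.prems by simp
    show "Ck_on k S (\<lambda>x. FD f x e)" for e
      by (rule Suc.IH) (use Suc.prems in simp)
  qed
qed

lemma Ck_on_le: "Ck_on k S f \<Longrightarrow> j \<le> k \<Longrightarrow> Ck_on j S f"
proof (induction k)
  case (Suc k)
  then show ?case
    by (metis Ck_on_Suc_imp le_Suc_eq)
qed simp

lemma Ck_on_imp_continuous_on: "Ck_on k S f \<Longrightarrow> continuous_on S f"
  using Ck_on_le[of k S f 0] by simp

lemma Ck_on_subset: "Ck_on k S f \<Longrightarrow> T \<subseteq> S \<Longrightarrow> Ck_on k T f"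
proof (induction k arbitrary: f)
  case 0
  then show ?case
    by (simp add: continuous_on_subset)
next
  case (Suc k)
  then show ?case
    by (simp add: subset_eq)
qed

text \<open>Meant for \<open>coefficient_smooth\<close>, where one divides by a function that is
  known to be nonzero only near the point under consideration.\<close>

lemma Ck_on_local:
  assumes "\<And>x. x \<in> S \<Longrightarrow> \<exists>U. open U \<and> x \<in> U \<and> Ck_on k U f"
  shows "Ck_on k S f"
  using assms
proof (induction k arbitrary: f)
  case 0
  have "continuous (at x) f" if x: "x \<in> S" for x
  proof -
    obtain U where "open U" "x \<in> U" "continuous_on U f"
      using 0[OF x] by auto
    then show ?thesis
      by (simp add: continuous_on_eq_continuous_at)
  qed
  then show ?case
    by (auto intro: continuous_at_imp_continuous_on)
next
  case (Suc k)
  have "Ck_on k S (\<lambda>x. FD f x e)" for e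
  proof (rule Suc.IH)
    show "\<exists>U. open U \<and> x \<in> U \<and> Ck_on k U (\<lambda>x. FD f x e)" if "x \<in> S" for x
      using Suc.prems[OF that] by auto
  qed
  moreover have "f differentiable at x" if "x \<in> S" for x
    using Suc.prems[OF that] by auto
  ultimately show ?case
    by simp
qed

lemma Ck_on_const: "open S \<Longrightarrow> Ck_on k S (\<lambda>x. c)"
proof (induction k arbitrary: c)
  case (Suc k)
  show ?case
    by (rule Ck_on_SucI[where f'="\<lambda>x e. 0", OF Suc.prems has_derivative_const Suc.IH[OF Suc.prems]])
qed simp

lemma Ck_on_bounded_linear:
  assumes "bounded_linear L" "open S" "Ck_on k S f"
  shows "Ck_on k S (\<lambda>x. L (f x))"
  using assms(3)
proof (induction k arbitrary: f)
  case 0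
  then show ?case
    using bounded_linear.continuous_on[OF assms(1)] by simp
next
  case (Suc k)
  show ?case
  proof (rule Ck_on_SucI[where f'="\<lambda>x e. L (FD f x e)"])
    show "((\<lambda>x. L (f x)) has_derivative (\<lambda>e. L (FD f x e))) (at x)"
      if "x \<in> S" for x
      using Ck_on_Suc_has_derivative[OF Suc.prems that] assms(1)
      by (rule bounded_linear.has_derivative[rotated])
    show "Ck_on k S (\<lambda>x. L (FD f x e))" for e
      by (rule Suc.IH) (use Suc.prems in simp)
  qed (rule assms(2))
qed

lemma Ck_on_add:
  assumes "open S" "Ck_on k S f" "Ck_on k S g"
  shows "Ck_on k S (\<lambda>x. f x + g x)"
  using assms(2,3)
proof (induction k arbitrary: f g)
  case 0
  then show ?case
    by (auto intro!: continuous_intros)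
next
  case (Suc k)
  show ?case
  proof (rule Ck_on_SucI[where
        f'="\<lambda>x e. FD f x e + FD g x e"])
    show "((\<lambda>x. f x + g x) has_derivative
        (\<lambda>e. FD f x e + FD g x e)) (at x)"
      if "x \<in> S" for x
      using Ck_on_Suc_has_derivative[OF Suc.prems(1) that] Ck_on_Suc_has_derivative[OF Suc.prems(2) that]
      by (rule has_derivative_add)
    show "Ck_on k S (\<lambda>x. FD f x e + FD g x e)" for e
      by (rule Suc.IH) (use Suc.prems in simp_all)
  qed (rule assms(1))
qed

lemma Ck_on_sum:
  assumes "open S" "\<And>i. i \<in> I \<Longrightarrow> Ck_on k S (f i)"
  shows "Ck_on k S (\<lambda>x. \<Sum>i\<in>I. f i x)"
  using assms(2)
proof (induction I rule: infinite_finite_induct)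
  case (insert i I)
  have "Ck_on k S (\<lambda>x. f i x + (\<Sum>i\<in>I. f i x))"
    using insert.IH insert.prems by (intro Ck_on_add assms(1)) simp_all
  then show ?case
    using insert.hyps by simp
qed (simp_all add: Ck_on_const[OF assms(1)])

lemma Ck_on_bilinear:
  assumes "bounded_bilinear B" "open S" "Ck_on k S f" "Ck_on k S g"
  shows "Ck_on k S (\<lambda>x. B (f x) (g x))"
  using assms(3,4)
proof (induction k arbitrary: f g)
  case 0
  then show ?case
    using bounded_bilinear.continuous_on[OF assms(1)] by simp
next
  case (Suc k)
  show ?case
  proof (rule Ck_on_SucI[where
        f'="\<lambda>x e. B (f x) (FD g x e) + B (FD f x e) (g x)"])
    show "((\<lambda>x. B (f x) (g x)) has_derivative
        (\<lambda>e. B (f x) (FD g x e) + B (FD f x e) (g x))) (at x)"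
      if "x \<in> S" for x
      using Ck_on_Suc_has_derivative[OF Suc.prems(1) that] Ck_on_Suc_has_derivative[OF Suc.prems(2) that]
      by (rule bounded_bilinear.FDERIV[OF assms(1)])
    show "Ck_on k S (\<lambda>x. B (f x) (FD g x e) + B (FD f x e) (g x))"
      for e
      using Suc.prems Ck_on_Suc_imp[OF Suc.prems(1)] Ck_on_Suc_imp[OF Suc.prems(2)]
      by (intro Ck_on_add Suc.IH assms(2)) simp_all
  qed (rule assms(2))
qed

lemmas Ck_on_mult = Ck_on_bilinear[OF bounded_bilinear_mult]

lemma Ck_on_inverse:
  fixes f :: "'e::real_normed_vector \<Rightarrow> 'f::real_normed_field"
  assumes "open S" "Ck_on k S f" "\<And>x. x \<in> S \<Longrightarrow> f x \<noteq> 0"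
  shows "Ck_on k S (\<lambda>x. inverse (f x))"
  using assms(2)
proof (induction k)
  case 0
  then show ?case
    using assms(3) by (auto intro!: continuous_intros)
next
  case (Suc k)
  let ?f' = "\<lambda>x e. FD f x e"
  show ?case
  proof (rule Ck_on_SucI[where f'="\<lambda>x e. - (inverse (f x) * ?f' x e * inverse (f x))"])
    show "((\<lambda>x. inverse (f x)) has_derivative (\<lambda>e. - (inverse (f x) * ?f' x e * inverse (f x)))) (at x)"
      if "x \<in> S" for x
      using Ck_on_Suc_has_derivative[OF Suc.prems(1) that] assms(3)[OF that]
      by (intro Deriv.has_derivative_inverse)
    show "Ck_on k S (\<lambda>x. - (inverse (f x) * ?f' x e * inverse (f x)))" for e
    proof -
      have 1: "Ck_on k S (\<lambda>x. inverse (f x))"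
        by (rule Suc.IH[OF Ck_on_Suc_imp[OF Suc.prems]])
      have 2: "Ck_on k S (\<lambda>x. ?f' x e)"
        using Suc.prems by simp
      show ?thesis
        by (rule Ck_on_bounded_linear[OF bounded_linear_minus[OF bounded_linear_ident] assms(1)
            Ck_on_mult[OF assms(1) Ck_on_mult[OF assms(1) 1 2] 1]])
    qed
  qed (rule assms(1))
qed

lemma Ck_on_power:
  fixes f :: "'e::real_normed_vector \<Rightarrow> 'f::real_normed_field"
  assumes "open S" "Ck_on k S f"
  shows "Ck_on k S (\<lambda>x. f x ^ m)"
proof (induction m)
  case 0
  show ?case
    using assms(1) by (simp add: Ck_on_const)
next
  case (Suc m)
  show ?case
    unfolding power_Suc by (rule Ck_on_mult[OF assms Suc])
qed

section \<open>Smoothness of the dual coframe\<close>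

text \<open>Where R is differentiable and vanishes, its partner need only be continuous: R (x + h) =
  O(|h|) absorbs the increment of g, which is o(1). This turns continuity of the coframe into
  differentiability.\<close>

lemma has_derivative_mult_null:
  fixes R g :: "'e::real_normed_vector \<Rightarrow> real"
  assumes R: "(R has_derivative R') (at x)" and R0: "R x = 0" and g: "isCont g x"
  shows "((\<lambda>y. R y * g y) has_derivative (\<lambda>h. R' h * g x)) (at x)"
proof -
  interpret R': bounded_linear R'
    using R by (rule has_derivative_bounded_linear)
  obtain K where K: "\<And>h. norm (R' h) \<le> norm h * K"
    using R'.bounded by blast
  define a where "a h = norm (R (x + h) - R' h) / norm h" for h
  have a: "(a \<longlongrightarrow> 0) (at 0)"
    using R R0 unfolding has_derivative_at a_def by simp
  have g': "((\<lambda>h. norm (g (x + h) - g x)) \<longlongrightarrow> 0) (at 0)"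
    using g unfolding isCont_iff by (intro tendsto_norm_zero LIM_zero)
  have lim: "((\<lambda>h. a h * norm (g x) + (a h + K) * norm (g (x + h) - g x)) \<longlongrightarrow> 0) (at 0)"
    using tendsto_add[OF tendsto_mult_left_zero[OF a, of "norm (g x)"]
        tendsto_mult[OF tendsto_add[OF a tendsto_const[of K]] g']] by simp
  have bound: "norm (norm (R (x + h) * g (x + h) - R x * g x - R' h * g x) / norm h)
      \<le> a h * norm (g x) + (a h + K) * norm (g (x + h) - g x)" if "h \<noteq> 0" for h
  proof -
    have h: "norm h > 0" using that by simp
    have "norm (R (x + h)) \<le> (a h + K) * norm h"
    proof -
      have "norm (R (x + h)) \<le> norm (R (x + h) - R' h) + norm (R' h)"
        using norm_triangle_sub by (metis add.commute)
      also have "\<dots> \<le> a h * norm h + K * norm h"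
        using K[of h] h by (simp add: a_def mult.commute)
      finally show ?thesis by (simp add: algebra_simps)
    qed
    then have "norm (R (x + h)) * norm (g (x + h) - g x) \<le> (a h + K) * norm h * norm (g (x + h) - g x)"
      by (rule mult_right_mono) simp
    \<comment> \<open>The error is split as (R (x + h) - R' h) g x + R (x + h) (g (x + h) - g
      x).\<close>
    moreover have "norm (R (x + h) * g (x + h) - R' h * g x)
        \<le> norm (R (x + h) - R' h) * norm (g x) + norm (R (x + h)) * norm (g (x + h) - g x)"
      unfolding norm_mult[symmetric]
      using norm_triangle_ineq[of "(R (x + h) - R' h) * g x" "R (x + h) * (g (x + h) - g x)"]
      by (simp add: algebra_simps)
    moreover have "norm (R (x + h) - R' h) = a h * norm h"
      using h by (simp add: a_def)
    ultimately have "norm (R (x + h) * g (x + h) - R' h * g x)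
        \<le> (a h * norm (g x) + (a h + K) * norm (g (x + h) - g x)) * norm h"
      by (simp add: algebra_simps)
    then show ?thesis
      using h R0 by (simp add: divide_le_eq)
  qed
  show ?thesis
    unfolding has_derivative_at
  proof
    show "bounded_linear (\<lambda>h. R' h * g x)"
      by (rule bounded_linear_mult_const) (rule R'.bounded_linear_axioms)
    show "((\<lambda>h. norm (R (x + h) * g (x + h) - R x * g x - R' h * g x) / norm h) \<longlongrightarrow> 0) (at 0)"
      by (rule Lim_null_comparison[OF _ lim]) (use bound in \<open>auto simp: eventually_at_filter\<close>)
  qed
qed

text \<open>The coframe is assumed linear at each point only; its dependence on the point is what
  has to be derived from the frame.\<close>

locale dual_frames =
  fixes I :: "'i set" and S :: "'e::euclidean_space set"
    and X :: "'i \<Rightarrow> 'e \<Rightarrow> 'e" and \<theta> :: "'i \<Rightarrow> 'e \<Rightarrow> 'e \<Rightarrow> real"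
  assumes finite_I: "finite I" and open_S: "open S"
    and linear: "\<And>i x. i \<in> I \<Longrightarrow> x \<in> S \<Longrightarrow> linear (\<theta> i x)"
    and dual: "\<And>i j x. i \<in> I \<Longrightarrow> j \<in> I \<Longrightarrow> x \<in> S \<Longrightarrow> \<theta> i x (X j x) = (if i = j then 1 else 0)"
    and complete: "\<And>x e. x \<in> S \<Longrightarrow> (\<Sum>j\<in>I. \<theta> j x e *\<^sub>R X j x) = e"
begin

text \<open>By duality at \<open>y\<close>, \<open>\<theta>\<^sub>i(y)(e) - \<theta>\<^sub>i(x)(e)\<close> is \<open>\<theta>\<^sub>i(y)\<close> applied to a vector depending only on the frame
  at \<open>y\<close> and vanishing for \<open>y = x\<close>; this transfers regularity from the frame to the coframe without
  determinants.\<close>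

definition displ :: "'e \<Rightarrow> 'e \<Rightarrow> 'e \<Rightarrow> 'e" where
  "displ x e y = (\<Sum>j\<in>I. \<theta> j x e *\<^sub>R (X j x - X j y))"

lemma coframe_diff:
  assumes "i \<in> I" "x \<in> S" "y \<in> S"
  shows "\<theta> i y e = \<theta> i x e + (\<Sum>b\<in>Basis. (displ x e y \<bullet> b) * \<theta> i y b)"
proof -
  interpret linear "\<theta> i y" using linear assms by simp
  have "displ x e y = e - (\<Sum>j\<in>I. \<theta> j x e *\<^sub>R X j y)"
    using complete[OF \<open>x \<in> S\<close>] by (simp add: displ_def scaleR_diff_right sum_subtractf)
  then have "\<theta> i y (displ x e y) = \<theta> i y e - (\<Sum>j\<in>I. \<theta> j x e * (if i = j then 1 else 0))"
    using assms dual by (simp add: diff sum scale)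
  also have "(\<Sum>j\<in>I. \<theta> j x e * (if i = j then 1 else 0)) = \<theta> i x e"
    using finite_I assms(1) by (simp add: if_distrib cong: if_cong)
  also have "\<theta> i y (displ x e y) = \<theta> i y (\<Sum>b\<in>Basis. (displ x e y \<bullet> b) *\<^sub>R b)"
    by (simp add: euclidean_representation)
  also have "\<dots> = (\<Sum>b\<in>Basis. (displ x e y \<bullet> b) * \<theta> i y b)"
    by (simp add: sum scale)
  finally show ?thesis by linarith
qed

lemma isCont_displ:
  assumes "\<And>j. j \<in> I \<Longrightarrow> continuous_on S (X j)" "x \<in> S"
  shows "isCont (displ x e) x"
  unfolding displ_def using assms open_S
  by (intro continuous_intros) (auto simp: continuous_on_eq_continuous_at)

text \<open>\<open>coframe_diff\<close> cannot be used at once, because its right-hand side contains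
  \<theta> at y, which is not yet known to be bounded. Summing it over all coefficients gives N y
  \<le> N x + d y * N y with d tending to 0, hence N y \<le> 2 * N x near x. With this bound the
  right-hand side of \<open>coframe_diff\<close> converges.\<close>

lemma coframe_isCont:
  assumes X: "\<And>j. j \<in> I \<Longrightarrow> continuous_on S (X j)" and i: "i \<in> I" and x: "x \<in> S"
  shows "isCont (\<lambda>y. \<theta> i y e) x"
proof -
  define N where "N y = (\<Sum>i\<in>I. \<Sum>b\<in>Basis. \<bar>\<theta> i y b\<bar>)" for y
  define d where "d y = (\<Sum>b\<in>(Basis::'e set). norm (displ x b y))" for y
  have N_ge: "(\<Sum>b\<in>Basis. \<bar>\<theta> i y b\<bar>) \<le> N y" if "i \<in> I" for i y
    unfolding N_def
    by (rule member_le_sum[where f="\<lambda>i. \<Sum>b\<in>Basis. \<bar>\<theta> i y b\<bar>"]) (use that finite_I in \<open>auto intro: sum_nonneg\<close>)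
  have diff: "\<bar>\<theta> i y e - \<theta> i x e\<bar> \<le> norm (displ x e y) * (\<Sum>b\<in>Basis. \<bar>\<theta> i y b\<bar>)"
    if "i \<in> I" "y \<in> S" for i y e
  proof -
    have "\<bar>\<theta> i y e - \<theta> i x e\<bar> \<le> (\<Sum>b\<in>Basis. \<bar>(displ x e y \<bullet> b) * \<theta> i y b\<bar>)"
      using coframe_diff[OF that(1) x that(2), of e]
        sum_abs[of "\<lambda>b. (displ x e y \<bullet> b) * \<theta> i y b" Basis] by linarith
    also have "\<dots> \<le> (\<Sum>b\<in>Basis. norm (displ x e y) * \<bar>\<theta> i y b\<bar>)"
      by (intro sum_mono) (auto simp: abs_mult Basis_le_norm intro!: mult_right_mono)
    finally show ?thesis by (simp add: sum_distrib_left)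
  qed
  have N_le: "N y \<le> N x + d y * N y" if y: "y \<in> S" for y
  proof -
    have "N y \<le> (\<Sum>i\<in>I. \<Sum>b\<in>Basis. \<bar>\<theta> i x b\<bar> + norm (displ x b y) * (\<Sum>b\<in>Basis. \<bar>\<theta> i y b\<bar>))"
      unfolding N_def
    proof (intro sum_mono)
      fix i b assume "i \<in> I"
      from diff[OF this y, of b] show
        "\<bar>\<theta> i y b\<bar> \<le> \<bar>\<theta> i x b\<bar> + norm (displ x b y) * (\<Sum>b\<in>Basis. \<bar>\<theta> i y b\<bar>)"
        by linarith
    qed
    also have "\<dots> = N x + d y * N y"
      by (simp add: N_def d_def sum.distrib sum_distrib_left[of "d y", unfolded d_def] sum_distrib_right[symmetric])
    finally show ?thesis .
  qed
  have R0: "displ x e x = 0" for e by (simp add: displ_def)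
  have Rlim: "(displ x e \<longlongrightarrow> 0) (at x)" for e
    using isCont_displ[OF X x, of e] by (simp add: isCont_def R0)
  have "(d \<longlongrightarrow> (\<Sum>b\<in>(Basis::'e set). norm (0::'e))) (at x)"
    unfolding d_def by (intro tendsto_sum tendsto_norm Rlim)
  then have "eventually (\<lambda>y. d y < 1/2) (at x)"
    using order_tendstoD(2)[of d 0 "at x" "1/2"] by simp
  moreover have evS: "eventually (\<lambda>y. y \<in> S) (at x)"
    using open_S x eventually_at_topological by blast
  ultimately have "eventually (\<lambda>y. norm (\<theta> i y e - \<theta> i x e) \<le> norm (displ x e y) * (2 * N x)) (at x)"
  proof eventually_elim
    case (elim y)
    have "0 \<le> N y" by (auto simp: N_def intro!: sum_nonneg)
    then have "d y * N y \<le> 1/2 * N y"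
      using elim by (intro mult_right_mono) auto
    then have "N y \<le> 2 * N x"
      using N_le[OF elim(2)] by linarith
    then have "(\<Sum>b\<in>Basis. \<bar>\<theta> i y b\<bar>) \<le> 2 * N x"
      using N_ge[OF i, of y] by linarith
    then show ?case
      using diff[OF i elim(2), of e] by (smt (verit) mult_left_mono norm_ge_zero real_norm_def)
  qed
  moreover have "((\<lambda>y. norm (displ x e y) * (2 * N x)) \<longlongrightarrow> 0) (at x)"
    by (intro tendsto_mult_left_zero tendsto_norm_zero Rlim)
  ultimately have "((\<lambda>y. \<theta> i y e - \<theta> i x e) \<longlongrightarrow> 0) (at x)"
    by (rule Lim_null_comparison)
  then show ?thesis
    unfolding isCont_def by (rule LIM_zero_cancel)
qed

text \<open>In \<open>coframe_diff\<close> every summand is a coordinate of \<open>displ\<close>,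
  differentiable and zero at y = x, times a coefficient that is merely continuous, so
  \<open>has_derivative_mult_null\<close> applies. The result is d\<theta>_i(e) = - (sum over j of
  \<theta>_j(e) \<theta>_i(dX_j)), the rule for differentiating an inverse matrix.\<close>

lemma coframe_has_derivative:
  assumes X: "\<And>j. j \<in> I \<Longrightarrow> Ck_on (Suc 0) S (X j)" and i: "i \<in> I" and x: "x \<in> S"
  shows "((\<lambda>y. \<theta> i y e) has_derivative (\<lambda>h. \<Sum>b\<in>Basis.
    ((\<Sum>j\<in>I. \<theta> j x e *\<^sub>R (0 - FD (X j) x h)) \<bullet> b) * \<theta> i x b)) (at x)"
proof -
  have Xc: "continuous_on S (X j)" if "j \<in> I" for j
    using X[OF that] by (rule Ck_on_imp_continuous_on)
  have displ': "(displ x e has_derivative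
      (\<lambda>h. \<Sum>j\<in>I. \<theta> j x e *\<^sub>R (0 - FD (X j) x h))) (at x)"
    unfolding displ_def
    by (intro has_derivative_sum has_derivative_scaleR_right has_derivative_diff has_derivative_const
        Ck_on_Suc_has_derivative[OF X x])
  have "((\<lambda>y. (displ x e y \<bullet> b) * \<theta> i y b) has_derivative
      (\<lambda>h. ((\<Sum>j\<in>I. \<theta> j x e *\<^sub>R (0 - FD (X j) x h)) \<bullet> b) * \<theta> i x b)) (at x)" for b
    by (rule has_derivative_mult_null[OF has_derivative_inner_left[OF displ']])
      (use coframe_isCont[OF Xc i x] in \<open>auto simp: displ_def\<close>)
  then have "((\<lambda>y. \<theta> i x e + (\<Sum>b\<in>Basis. (displ x e y \<bullet> b) * \<theta> i y b)) has_derivative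
      (\<lambda>h. 0 + (\<Sum>b\<in>Basis.
    ((\<Sum>j\<in>I. \<theta> j x e *\<^sub>R (0 - FD (X j) x h)) \<bullet> b) * \<theta> i x b))) (at x)"
    by (intro has_derivative_add has_derivative_const has_derivative_sum)
  then have "((\<lambda>y. \<theta> i x e + (\<Sum>b\<in>Basis. (displ x e y \<bullet> b) * \<theta> i y b)) has_derivative
      (\<lambda>h. \<Sum>b\<in>Basis.
    ((\<Sum>j\<in>I. \<theta> j x e *\<^sub>R (0 - FD (X j) x h)) \<bullet> b) * \<theta> i x b)) (at x)"
    by simp
  then show ?thesis
    by (rule has_derivative_transform_within_open[OF _ open_S x])
      (rule coframe_diff[OF i x, symmetric])
qed

text \<open>A bootstrap: the derivative just found involves only \<theta> itself and the derivatives
  of the frame.\<close>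

lemma coframe_Ck_on:
  assumes X: "\<And>j. j \<in> I \<Longrightarrow> Ck_on k S (X j)" and i: "i \<in> I"
  shows "Ck_on k S (\<lambda>y. \<theta> i y e)"
  using X i
proof (induction k arbitrary: i e)
  case 0
  then show ?case
    using coframe_isCont by (auto intro: continuous_at_imp_continuous_on)
next
  case (Suc k)
  have X1: "Ck_on (Suc 0) S (X j)" if "j \<in> I" for j
    using Suc.prems(1)[OF that] by (rule Ck_on_le) simp
  have X2: "Ck_on k S (\<lambda>x. FD (X j) x h)" if "j \<in> I" for j h
    using Suc.prems(1)[OF that] by simp
  have IH: "Ck_on k S (\<lambda>y. \<theta> j y e)" if "j \<in> I" for j e
    using Suc.IH Suc.prems(1) that Ck_on_Suc_imp by blast
  show ?case
  proof (rule Ck_on_SucI[OF open_S coframe_has_derivative[OF X1 \<open>i \<in> I\<close>]])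
    fix h
    have "Ck_on k S (\<lambda>x. \<theta> j x e *\<^sub>R (0 - FD (X j) x h))" if "j \<in> I" for j
      using Ck_on_bounded_linear[OF bounded_linear_minus[OF bounded_linear_ident] open_S X2[OF that]]
      by (intro Ck_on_bilinear[OF bounded_bilinear_scaleR open_S IH[OF that]]) simp
    then have "Ck_on k S (\<lambda>x. (\<Sum>j\<in>I. \<theta> j x e *\<^sub>R (0 - FD (X j) x h)) \<bullet> b)" for b
      by (intro Ck_on_bounded_linear[OF bounded_linear_inner_left open_S] Ck_on_sum open_S)
    then show "Ck_on k S (\<lambda>x. \<Sum>b\<in>Basis.
        ((\<Sum>j\<in>I. \<theta> j x e *\<^sub>R (0 - FD (X j) x h)) \<bullet> b) * \<theta> i x b)"
      by (intro Ck_on_sum open_S Ck_on_mult IH \<open>i \<in> I\<close>)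
  qed
qed

end

section \<open>Second derivatives\<close>

definition hess :: "('e::real_normed_vector \<Rightarrow> 'f::real_normed_vector) \<Rightarrow> 'e \<Rightarrow> 'e \<Rightarrow> 'e \<Rightarrow> 'f" where
  "hess f x a b = FD (\<lambda>y. FD f y b) x a"

lemma hess_eqI:
  assumes "open S" "x \<in> S" "\<And>y. y \<in> S \<Longrightarrow> (f has_derivative f' y) (at y)"
    and "((\<lambda>y. f' y b) has_derivative f'') (at x)"
  shows "hess f x a b = f'' a"
proof -
  have "f' y b = FD f y b" if "y \<in> S" for y
    using frechet_derivative_at[OF assms(3)[OF that]] by simp
  then have "((\<lambda>y. FD f y b) has_derivative f'') (at x)"
    using has_derivative_transform_within_open[OF assms(4,1,2)] by auto
  then show ?thesis
    unfolding hess_def using frechet_derivative_at by metis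
qed

lemma Ck_on_2_has_derivative:
  assumes "Ck_on (Suc (Suc 0)) S f" "x \<in> S"
  shows "((\<lambda>y. FD f y b) has_derivative (\<lambda>a. hess f x a b)) (at x)"
  using assms frechet_derivative_works[of "\<lambda>y. FD f y b" "at x"]
  by (simp add: hess_def)

lemma Ck_on_2_hess_continuous: "Ck_on (Suc (Suc 0)) S f \<Longrightarrow> continuous_on S (\<lambda>x. hess f x a b)"
  by (simp add: hess_def)

lemma has_derivative_line:
  fixes f :: "'e::real_normed_vector \<Rightarrow> real"
  assumes "(f has_derivative D) (at (c + s *\<^sub>R a))"
  shows "((\<lambda>s. f (c + s *\<^sub>R a)) has_real_derivative D a) (at s)"
proof -
  have "((\<lambda>s. c + s *\<^sub>R a) has_derivative (\<lambda>t. 0 + t *\<^sub>R a)) (at s)"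
    by (intro has_derivative_add has_derivative_const has_derivative_scaleR_left has_derivative_ident)
  from has_derivative_compose[OF this assms]
  have "((\<lambda>s. f (c + s *\<^sub>R a)) has_derivative (\<lambda>t. D (t *\<^sub>R a))) (at s)"
    by simp
  moreover have "(\<lambda>t. D (t *\<^sub>R a)) = (*) (D a)"
    using has_derivative_bounded_linear[OF assms] by (auto simp: bounded_linear.linear linear_scale)
  ultimately show ?thesis
    by (simp add: has_field_derivative_def)
qed

text \<open>The mean value theorem, first along a and then along b, makes the quotient a mixed
  second derivative at an intermediate point. The quotient is symmetric in a and b, so uniqueness of
  limits gives Schwarz's theorem in \<open>hess_commute_real\<close>.\<close>

lemma double_difference_tendsto:
  fixes u :: "'e::real_normed_vector \<Rightarrow> real"
  assumes S: "open S" "x \<in> S" and u: "Ck_on (Suc (Suc 0)) S u"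
  shows "((\<lambda>h. (u (x + h *\<^sub>R a + h *\<^sub>R b) - u (x + h *\<^sub>R a) - u (x + h *\<^sub>R b) + u x) / h\<^sup>2)
    \<longlongrightarrow> hess u x b a) (at_right 0)" (is "(?q \<longlongrightarrow> _) _")
proof (rule tendstoI)
  fix e :: real assume "e > 0"
  have "isCont (\<lambda>y. hess u y b a) x"
    using Ck_on_2_hess_continuous[OF u] S by (simp add: continuous_on_eq_continuous_at)
  then obtain d1 where d1: "d1 > 0" "\<And>y. dist y x < d1 \<Longrightarrow> dist (hess u y b a) (hess u x b a) < e"
    using \<open>e > 0\<close> unfolding continuous_at_eps_delta by (auto simp: dist_norm)
  obtain d2 where d2: "d2 > 0" "ball x d2 \<subseteq> S"
    using S openE by blast
  \<comment> \<open>The summand 1 keeps the divisor positive when a = b = 0.\<close>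
  define k where "k = norm a + norm b + 1"
  define d where "d = min d1 d2 / k"
  have k: "k > 0" by (simp add: k_def add_nonneg_pos)
  have near: "dist (x + s *\<^sub>R a + t *\<^sub>R b) x < min d1 d2" if "0 \<le> s" "s \<le> h" "0 \<le> t" "t \<le> h" "h < d" for s t h
  proof -
    have "dist (x + s *\<^sub>R a + t *\<^sub>R b) x \<le> s * norm a + t * norm b"
      using norm_triangle_ineq[of "s *\<^sub>R a" "t *\<^sub>R b"] that by (simp add: dist_norm add.assoc)
    also have "\<dots> \<le> h * norm a + h * norm b"
      using that by (intro add_mono mult_right_mono) auto
    also have "\<dots> \<le> h * k"
      using that by (simp add: k_def algebra_simps)
    also have "\<dots> < min d1 d2"
      using that k by (simp add: d_def pos_less_divide_eq)
    finally show ?thesis .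
  qed
  have inS: "x + s *\<^sub>R a + t *\<^sub>R b \<in> S" if "0 \<le> s" "s \<le> h" "0 \<le> t" "t \<le> h" "h < d" for s t h
    using near[OF that] d2 by (auto simp: dist_commute)
  have "dist (?q h) (hess u x b a) < e" if h: "0 < h" "h < d" for h
  proof -
    define Du where "Du y = FD u y" for y
    have Du: "(u has_derivative Du y) (at y)" if "y \<in> S" for y
      using Ck_on_Suc_has_derivative[OF u that] by (simp add: Du_def)
    \<comment> \<open>The difference along b, as a function of the displacement s along a; g h - g 0
      is the numerator of the quotient.\<close>
    define g where "g s = u (x + h *\<^sub>R b + s *\<^sub>R a) - u (x + s *\<^sub>R a)" for s
    have "(g has_real_derivative Du (x + h *\<^sub>R b + s *\<^sub>R a) a - Du (x + s *\<^sub>R a) a) (at s)"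
      if "0 \<le> s" "s \<le> h" for s
      unfolding g_def
      using inS[OF that, of h] inS[OF that, of 0] h
      by (intro DERIV_diff has_derivative_line Du) (auto simp: algebra_simps)
    then obtain s where s: "0 < s" "s < h"
      "g h - g 0 = (h - 0) * (Du (x + h *\<^sub>R b + s *\<^sub>R a) a - Du (x + s *\<^sub>R a) a)"
      using MVT2[OF h(1), of g "\<lambda>s. Du (x + h *\<^sub>R b + s *\<^sub>R a) a - Du (x + s *\<^sub>R a) a"] by blast
    have "((\<lambda>t. Du (x + s *\<^sub>R a + t *\<^sub>R b) a) has_real_derivative hess u (x + s *\<^sub>R a + t *\<^sub>R b) b a) (at t)"
      if "0 \<le> t" "t \<le> h" for t
      unfolding Du_def using s h that
      by (intro has_derivative_line Ck_on_2_has_derivative[OF u] inS[of s h]) auto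
    then obtain t where t: "0 < t" "t < h"
      "Du (x + s *\<^sub>R a + h *\<^sub>R b) a - Du (x + s *\<^sub>R a + 0 *\<^sub>R b) a = (h - 0) * hess u (x + s *\<^sub>R a + t *\<^sub>R b) b a"
      using MVT2[OF h(1), of "\<lambda>t. Du (x + s *\<^sub>R a + t *\<^sub>R b) a" "\<lambda>t. hess u (x + s *\<^sub>R a + t *\<^sub>R b) b a"]
      by blast
    have "g h - g 0 = h * h * hess u (x + s *\<^sub>R a + t *\<^sub>R b) b a"
      using s(3) t(3) by (simp add: algebra_simps)
    then have "?q h = hess u (x + s *\<^sub>R a + t *\<^sub>R b) b a"
      using h by (simp add: g_def power2_eq_square field_simps)
    then show ?thesis
      using d1(2) near[of s h t] s t h by auto
  qed
  moreover have "d > 0" using d1 d2 k by (simp add: d_def)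
  ultimately show "eventually (\<lambda>h. dist (?q h) (hess u x b a) < e) (at_right 0)"
    unfolding eventually_at_right_field by blast
qed

lemma hess_commute_real:
  fixes u :: "'e::real_normed_vector \<Rightarrow> real"
  assumes "open S" "x \<in> S" "Ck_on (Suc (Suc 0)) S u"
  shows "hess u x a b = hess u x b a"
proof (rule tendsto_unique[OF trivial_limit_at_right_real])
  show "((\<lambda>h. (u (x + h *\<^sub>R a + h *\<^sub>R b) - u (x + h *\<^sub>R a) - u (x + h *\<^sub>R b) + u x) / h\<^sup>2)
    \<longlongrightarrow> hess u x b a) (at_right 0)"
    by (rule double_difference_tendsto[OF assms])
  show "((\<lambda>h. (u (x + h *\<^sub>R a + h *\<^sub>R b) - u (x + h *\<^sub>R a) - u (x + h *\<^sub>R b) + u x) / h\<^sup>2)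
    \<longlongrightarrow> hess u x a b) (at_right 0)"
    using double_difference_tendsto[OF assms, of b a] by (simp add: algebra_simps)
qed

lemma frechet_derivative_bounded_linear:
  assumes "bounded_linear L" "Ck_on (Suc k) S f" "x \<in> S"
  shows "FD (\<lambda>y. L (f y)) x a = L (FD f x a)"
  using frechet_derivative_at[OF bounded_linear.has_derivative[OF assms(1) Ck_on_Suc_has_derivative[OF assms(2,3)]]]
  by metis

lemma hess_bounded_linear:
  assumes "bounded_linear L" "open S" "x \<in> S" "Ck_on (Suc (Suc 0)) S f"
  shows "hess (\<lambda>y. L (f y)) x a b = L (hess f x a b)"
  by (rule hess_eqI[OF assms(2,3) bounded_linear.has_derivative[OF assms(1) Ck_on_Suc_has_derivative[OF assms(4)]]
        bounded_linear.has_derivative[OF assms(1) Ck_on_2_has_derivative[OF assms(4,3)]]])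

lemma hess_commute:
  fixes f :: "'e::real_normed_vector \<Rightarrow> complex"
  assumes "open S" "x \<in> S" "Ck_on (Suc (Suc 0)) S f"
  shows "hess f x a b = hess f x b a"
proof (rule complex_eqI)
  note Ck = Ck_on_bounded_linear[OF _ assms(1,3)]
  show "Re (hess f x a b) = Re (hess f x b a)"
    using hess_commute_real[OF assms(1,2) Ck[OF bounded_linear_Re]]
    by (simp add: hess_bounded_linear[OF bounded_linear_Re assms])
  show "Im (hess f x a b) = Im (hess f x b a)"
    using hess_commute_real[OF assms(1,2) Ck[OF bounded_linear_Im]]
    by (simp add: hess_bounded_linear[OF bounded_linear_Im assms])
qed

text \<open>\<open>Ck_on\<close> speaks of derivatives in fixed directions. Expansion in the basis
  reduces a direction that varies with the point to finitely many fixed ones.\<close>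

lemma frechet_derivative_Basis_sum:
  assumes "(f has_derivative f') (at x)"
  shows "f' e = (\<Sum>b\<in>Basis. (e \<bullet> b) *\<^sub>R f' (b::'e::euclidean_space))"
proof -
  interpret bounded_linear f' using assms by (rule has_derivative_bounded_linear)
  have "f' e = f' (\<Sum>b\<in>Basis. (e \<bullet> b) *\<^sub>R b)"
    by (simp add: euclidean_representation)
  then show ?thesis
    by (simp add: sum scaleR)
qed

lemma hess_Basis_sum:
  fixes f :: "'e::euclidean_space \<Rightarrow> 'f::real_normed_vector"
  assumes "open S" "x \<in> S" "Ck_on (Suc (Suc 0)) S f"
  shows "hess f x a e = (\<Sum>b\<in>Basis. (e \<bullet> b) *\<^sub>R hess f x a b)"
proof -
  have "((\<lambda>y. \<Sum>b\<in>Basis. (e \<bullet> b) *\<^sub>R FD f y b) has_derivative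
      (\<lambda>a. \<Sum>b\<in>Basis. (e \<bullet> b) *\<^sub>R hess f x a b)) (at x)"
    by (intro has_derivative_sum has_derivative_scaleR_right Ck_on_2_has_derivative[OF assms(3,2)])
  then have "((\<lambda>y. FD f y e) has_derivative
      (\<lambda>a. \<Sum>b\<in>Basis. (e \<bullet> b) *\<^sub>R hess f x a b)) (at x)"
    by (rule has_derivative_transform_within_open[OF _ assms(1,2)])
      (rule frechet_derivative_Basis_sum[OF Ck_on_Suc_has_derivative[OF assms(3)], symmetric])
  from frechet_derivative_at[OF this, THEN fun_cong, of a] show ?thesis
    unfolding hess_def[of f x a e] by simp
qed

lemma has_derivative_along_field:
  fixes f :: "'e::euclidean_space \<Rightarrow> 'f::real_normed_vector"
  assumes S: "open S" "x \<in> S" and f: "Ck_on (Suc (Suc 0)) S f" and V: "Ck_on (Suc 0) S V"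
  shows "((\<lambda>y. FD f y (V y)) has_derivative
    (\<lambda>a. hess f x a (V x) + FD f x (FD V x a))) (at x)"
proof -
  note Df = Ck_on_Suc_has_derivative[OF f]
  have "((\<lambda>y. \<Sum>b\<in>Basis. (V y \<bullet> b) *\<^sub>R FD f y b) has_derivative
      (\<lambda>a. \<Sum>b\<in>Basis. (V x \<bullet> b) *\<^sub>R hess f x a b
        + (FD V x a \<bullet> b) *\<^sub>R FD f x b)) (at x)"
    by (intro has_derivative_sum has_derivative_scaleR has_derivative_inner_left
        Ck_on_2_has_derivative[OF f S(2)] Ck_on_Suc_has_derivative[OF V S(2)])
  then have "((\<lambda>y. FD f y (V y)) has_derivative
      (\<lambda>a. \<Sum>b\<in>Basis. (V x \<bullet> b) *\<^sub>R hess f x a b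
        + (FD V x a \<bullet> b) *\<^sub>R FD f x b)) (at x)"
    by (rule has_derivative_transform_within_open[OF _ S])
      (rule frechet_derivative_Basis_sum[OF Df, symmetric])
  then show ?thesis
    by (simp add: sum.distrib hess_Basis_sum[OF S f, symmetric]
        frechet_derivative_Basis_sum[OF Df[OF S(2)], symmetric])
qed

text \<open>Since \<open>W f = \<i> V f\<close>, one has \<open>V V f + W W f = - \<i> [V, W] f = - (J [V, W]) f\<close>: only
  derivatives of first order remain on the right-hand side.\<close>

lemma pseudoholomorphic_hess:
  fixes f :: "'e::euclidean_space \<Rightarrow> complex"
  assumes S: "open S" "x \<in> S" and f: "Ck_on (Suc (Suc 0)) S f"
    and V: "Ck_on (Suc 0) S V" and W: "Ck_on (Suc 0) S W"
    and VW: "\<And>y. y \<in> S \<Longrightarrow> W y = J y (V y)"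
    and hol: "\<And>y e. y \<in> S \<Longrightarrow> FD f y (J y e) = \<i> * FD f y e"
  defines "DV \<equiv> FD V x" and "DW \<equiv> FD W x"
  shows "hess f x (V x) (V x) + hess f x (W x) (W x) = - FD f x
      (J x (DW (V x) - DV (W x)) + DV (V x) + DW (W x))"
proof -
  let ?D = "FD f x"
  have Df: "(f has_derivative ?D) (at x)"
    by (rule Ck_on_Suc_has_derivative[OF f S(2)])
  have lin: "linear ?D"
    using has_derivative_linear[OF Df] .
  note dV = has_derivative_along_field[OF S f V] and dW = has_derivative_along_field[OF S f W]
  have "((\<lambda>y. FD f y (W y)) has_derivative
      (\<lambda>a. \<i> * (hess f x a (V x) + ?D (DV a)))) (at x)"
    unfolding DV_def
    by (rule has_derivative_transform_within_open[OF has_derivative_mult_right[OF dV] S])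
      (simp add: VW hol)
  from has_derivative_unique[OF dW this]
  have key: "hess f x a (W x) + ?D (DW a) = \<i> * (hess f x a (V x) + ?D (DV a))" for a
    by (simp add: DW_def fun_eq_iff)
  \<comment> \<open>With a = V and with a = W together with symmetry, \<open>key\<close> expresses
    both remaining second derivatives through \<open>hess f x (V x) (V x)\<close>, which then
    cancels. As \<open>hess\<close> freezes its directions, V V f differs from it by
    \<open>DV (V x)\<close> applied to f; this is the origin of \<open>DV (V x) + DW (W x)\<close>
    beside J [V, W], where [V, W] is \<open>DW (V x) - DV (W x)\<close>.\<close>
  have 1: "hess f x (V x) (W x) = \<i> * (hess f x (V x) (V x) + ?D (DV (V x))) - ?D (DW (V x))"
    using key[of "V x"] by (simp add: algebra_simps)
  have 2: "hess f x (W x) (W x) = \<i> * (hess f x (V x) (W x) + ?D (DV (W x))) - ?D (DW (W x))"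
    using key[of "W x"] hess_commute[OF S f, of "W x" "V x"] by (simp add: algebra_simps)
  show ?thesis
    unfolding 2 1 by (simp add: linear_add[OF lin] linear_diff[OF lin] hol S algebra_simps)
qed

section \<open>The strong maximum principle\<close>

text \<open>Were the second derivative along e positive, the first one, which is 0 at x, would be
  positive just beyond x, and the mean value theorem would give a larger value of u.\<close>

lemma hess_nonpos_at_max:
  fixes u :: "'e::real_normed_vector \<Rightarrow> real"
  assumes S: "open S" "x \<in> S" and u: "Ck_on (Suc (Suc 0)) S u"
    and max: "\<And>y. y \<in> S \<Longrightarrow> u y \<le> u x"
  shows "FD u x = (\<lambda>e. 0)" "hess u x e e \<le> 0"
proof -
  note Du = Ck_on_Suc_has_derivative[OF u]
  show D0: "FD u x = (\<lambda>e. 0)"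
    using differential_zero_maxmin[OF S(2,1) Du[OF S(2)]] max by blast
  show "hess u x e e \<le> 0"
  proof (rule ccontr)
    assume "\<not> hess u x e e \<le> 0"
    then have pos: "0 < hess u x e e" by simp
    have "((\<lambda>t. FD u (x + t *\<^sub>R e) e) has_real_derivative hess u x e e) (at 0)"
      by (rule has_derivative_line) (use Ck_on_2_has_derivative[OF u S(2)] in simp)
    from DERIV_pos_inc_right[OF this pos] obtain d1 where d1: "d1 > 0"
      "\<And>h. 0 < h \<Longrightarrow> h < d1 \<Longrightarrow> 0 < FD u (x + h *\<^sub>R e) e"
      by (auto simp: D0)
    obtain d2 where d2: "d2 > 0" "ball x d2 \<subseteq> S"
      using S openE by blast
    \<comment> \<open>The first bound gives h < d1; the second gives h * norm e < d2, so that the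
      segment from x stays in the ball.\<close>
    define h where "h = min (d1 / 2) (d2 / (norm e + 1))"
    have ne: "norm e + 1 > 0" by (simp add: add_nonneg_pos)
    have h: "0 < h" "h < d1" using d1 d2 ne by (auto simp: h_def)
    have inS: "x + t *\<^sub>R e \<in> S" if "0 \<le> t" "t \<le> h" for t
    proof -
      have "t * norm e \<le> d2 / (norm e + 1) * norm e"
        using that by (intro mult_right_mono) (auto simp: h_def)
      also have "\<dots> < d2"
        using d2 ne by (simp add: field_simps)
      finally show ?thesis
        using d2 that by (auto simp: dist_norm)
    qed
    have "((\<lambda>t. u (x + t *\<^sub>R e)) has_real_derivative FD u (x + t *\<^sub>R e) e) (at t)"
      if "0 \<le> t" "t \<le> h" for t
      by (intro has_derivative_line Du inS that)
    from MVT2[OF h(1) this] obtain z where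
      "0 < z" "z < h" "u (x + h *\<^sub>R e) - u (x + 0 *\<^sub>R e) = (h - 0) * FD u (x + z *\<^sub>R e) e"
      by blast
    moreover have "0 < h * FD u (x + z *\<^sub>R e) e"
      using d1(2)[of z] calculation h by simp
    ultimately have "u x < u (x + h *\<^sub>R e)" by simp
    with max[OF inS[of h]] h show False by simp
  qed
qed

text \<open>Hopf's comparison function about the centre y, without subtracting its value on the
  sphere through the touching point.\<close>

definition barrier :: "real \<Rightarrow> 'e::real_inner \<Rightarrow> 'e \<Rightarrow> real" where
  "barrier \<alpha> y x = exp (- \<alpha> * ((x - y) \<bullet> (x - y)))"

lemma barrier_has_derivative:
  "(barrier \<alpha> y has_derivative (\<lambda>e. - 2 * \<alpha> * ((x - y) \<bullet> e) * barrier \<alpha> y x)) (at x)"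
  unfolding barrier_def
  by (auto intro!: derivative_eq_intros simp: inner_commute algebra_simps)

lemma barrier_has_derivative2:
  "((\<lambda>x. - 2 * \<alpha> * ((x - y) \<bullet> b) * barrier \<alpha> y x) has_derivative
    (\<lambda>a. (4 * \<alpha>\<^sup>2 * ((x - y) \<bullet> a) * ((x - y) \<bullet> b) - 2 * \<alpha> * (a \<bullet> b)) * barrier \<alpha> y x)) (at x)"
  by (auto intro!: derivative_eq_intros barrier_has_derivative simp: algebra_simps power2_eq_square)

lemma continuous_on_barrier: "continuous_on S (barrier \<alpha> y)"
  unfolding barrier_def by (intro continuous_intros)

lemma Ck_on_barrier: "open S \<Longrightarrow> Ck_on (Suc (Suc 0)) S (barrier \<alpha> y)"
  by (intro Ck_on_SucI[OF _ barrier_has_derivative] Ck_on_SucI[OF _ barrier_has_derivative2])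
    (auto intro!: continuous_intros continuous_on_barrier)

text \<open>The term quadratic in \<alpha> wins for large \<alpha> as soon as e is not orthogonal to
  the radius x - y; a direction tangent to the sphere contributes nothing to it.\<close>

lemma hess_barrier:
  "hess (barrier \<alpha> y) x e e = (4 * \<alpha>\<^sup>2 * ((x - y) \<bullet> e)\<^sup>2 - 2 * \<alpha> * (e \<bullet> e)) * barrier \<alpha> y x"
  using hess_eqI[OF open_UNIV UNIV_I barrier_has_derivative barrier_has_derivative2, of \<alpha> y x e e]
  by (simp add: power2_eq_square algebra_simps)

lemma barrier_pos: "0 < barrier \<alpha> y x"
  by (simp add: barrier_def)

text \<open>Hopf's argument: if the maximum set is not a neighbourhood of one of its points, some ball on
  which \<open>u < M\<close> touches it from outside at a single point \<open>q\<close>. A field that is not tangent to the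
  ball at \<open>q\<close> makes the barrier strictly subharmonic near \<open>q\<close>, so that a small multiple of it
  produces an interior maximum which the second derivative test forbids.\<close>

lemma strong_maximum_principle:
  fixes u :: "'e::euclidean_space \<Rightarrow> real"
  assumes S: "open S" and u: "Ck_on (Suc (Suc 0)) S u"
    and cont: "\<And>i. i \<in> I \<Longrightarrow> continuous_on S (V i)" "\<And>i. i \<in> I \<Longrightarrow> continuous_on S (W i)"
      "\<And>i. i \<in> I \<Longrightarrow> continuous_on S (Z i)"
    and eq: "\<And>i x. i \<in> I \<Longrightarrow> x \<in> S \<Longrightarrow>
      hess u x (V i x) (V i x) + hess u x (W i x) (W i x) = - FD u x (Z i x)"
    and span: "\<And>x e. x \<in> S \<Longrightarrow> (\<And>i. i \<in> I \<Longrightarrow> e \<bullet> V i x = 0 \<and> e \<bullet> W i x = 0) \<Longrightarrow> e = 0"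
    and max: "\<And>x. x \<in> S \<Longrightarrow> u x \<le> M" and x0: "x0 \<in> S" "u x0 = M"
  obtains r where "r > 0" "ball x0 r \<subseteq> S" "\<And>x. x \<in> ball x0 r \<Longrightarrow> u x = M"
proof -
  obtain r2 where r2: "r2 > 0" "cball x0 r2 \<subseteq> S"
    using S x0 open_contains_cball by blast
  \<comment> \<open>A point y within r of x0 is at distance less than r from the maximum set, hence
    the ball about y that touches this set stays in the ball of radius 2 * r.\<close>
  define r where "r = r2 / 2"
  have r: "r > 0" "cball x0 (2 * r) \<subseteq> S"
    using r2 by (auto simp: r_def)
  have cu: "continuous_on S u"
    by (rule Ck_on_imp_continuous_on[OF u])
  have "u y = M" if y: "y \<in> ball x0 r" for y
  proof (rule ccontr)
    assume "u y \<noteq> M"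
    have yS: "y \<in> S" using y r by (auto simp: subset_iff)
    define F where "F = {x \<in> cball x0 (2 * r). u x = M}"
    have "F = cball x0 (2 * r) \<inter> u -` {M}" by (auto simp: F_def)
    then have "closed F"
      using continuous_closed_preimage[OF continuous_on_subset[OF cu r(2)], of "{M}"] by simp
    moreover have "x0 \<in> F" using x0 r by (simp add: F_def)
    ultimately obtain q where q: "q \<in> F" "\<And>z. z \<in> F \<Longrightarrow> dist y q \<le> dist y z"
      using distance_attains_inf[of F y] by auto
    define d where "d = dist y q"
    have d_r: "d < r"
      using q(2)[OF \<open>x0 \<in> F\<close>] y by (simp add: d_def dist_commute)
    have d0: "d > 0"
      using q(1) \<open>u y \<noteq> M\<close> by (auto simp: d_def F_def)
    have below: "z \<in> S \<and> u z < M" if "dist y z < d" for z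
    proof -
      have z: "z \<in> cball x0 (2 * r)"
        using dist_triangle[of x0 z y] y that d_r by simp
      then have "z \<in> S" using r by blast
      moreover have "z \<notin> F" using q(2)[of z] that by (auto simp: d_def)
      ultimately show ?thesis
        using max[of z] z by (auto simp: F_def less_le)
    qed
    have qS: "q \<in> S" and uq: "u q = M"
      using q(1) r by (auto simp: F_def)
    \<comment> \<open>The ball about y may touch the maximum set at several points. The ball about
      the midpoint y1 of y and q, of half the radius, meets its boundary sphere only at q.\<close>
    define w where "w = (1/2) *\<^sub>R (q - y)"
    define y1 where "y1 = y + w"
    have q_eq: "q = y1 + w"
    proof -
      have "(1/2) *\<^sub>R (q - y) + (1/2) *\<^sub>R (q - y) = q - y"
        by (metis scaleR_half_double scaleR_right_distrib)
      then show ?thesis by (simp add: y1_def w_def algebra_simps)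
    qed
    have w: "norm w = d / 2"
      by (simp add: w_def d_def dist_norm norm_minus_commute)
    have touch: "z \<in> S \<and> u z < M" if z: "dist y1 z \<le> d / 2" "z \<noteq> q" for z
    proof (rule below, rule ccontr)
      assume "\<not> dist y z < d"
      \<comment> \<open>Here norm a \<le> d / 2 = norm w while norm (a + w) \<ge> d; by the
        parallelogram law this forces a = w, that is z = q.\<close>
      define a where "a = z - y1"
      have a: "norm a \<le> d / 2" using z by (simp add: a_def dist_norm norm_minus_commute)
      have "d \<le> norm (a + w)"
        using \<open>\<not> dist y z < d\<close> by (simp add: a_def y1_def dist_norm norm_minus_commute)
      then have "d\<^sup>2 \<le> (norm (a + w))\<^sup>2"
        using d0 by (intro power_mono) auto
      moreover have "(norm a)\<^sup>2 \<le> (d / 2)\<^sup>2"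
        using a by (intro power_mono) auto
      moreover have "(norm (a + w))\<^sup>2 = (norm a)\<^sup>2 + 2 * (a \<bullet> w) + (norm w)\<^sup>2"
        by (simp add: power2_norm_eq_inner algebra_simps inner_commute)
      moreover have "(norm (a - w))\<^sup>2 = (norm a)\<^sup>2 - 2 * (a \<bullet> w) + (norm w)\<^sup>2"
        by (simp add: power2_norm_eq_inner algebra_simps inner_commute)
      ultimately have "(norm (a - w))\<^sup>2 \<le> 0"
        using w by (simp add: power2_eq_square field_simps)
      then have "a = w" by simp
      then show False using z q_eq by (simp add: a_def algebra_simps)
    qed
    have "q - y1 \<noteq> 0" using q_eq w d0 by auto
    \<comment> \<open>The fields span, so one of them is not tangent to the sphere at q.\<close>
    then obtain i where i: "i \<in> I" "(q - y1) \<bullet> V i q \<noteq> 0 \<or> (q - y1) \<bullet> W i q \<noteq> 0"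
      using span[OF qS, of "q - y1"] by blast
    \<comment> \<open>With L the operator of the equation, Z included, L h = 2 * \<alpha> * (2 *
      \<alpha> * \<kappa> - K) * h for the barrier h: \<kappa> collects the quadratic terms, K all
      others.\<close>
    define \<kappa> where "\<kappa> x = ((x - y1) \<bullet> V i x)\<^sup>2 + ((x - y1) \<bullet> W i x)\<^sup>2" for x
    define K where "K x = V i x \<bullet> V i x + W i x \<bullet> W i x + (x - y1) \<bullet> Z i x" for x
    have \<kappa>_q: "\<kappa> q > 0"
      using i(2) by (auto simp: \<kappa>_def intro: add_pos_nonneg add_nonneg_pos)
    have c\<kappa>: "continuous_on S \<kappa>" and cK: "continuous_on S K"
      unfolding \<kappa>_def K_def by (intro continuous_intros cont i)+
    have "isCont \<kappa> q" using c\<kappa> S qS by (simp add: continuous_on_eq_continuous_at)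
    then obtain s1 where s1: "s1 > 0" "\<And>x. dist x q < s1 \<Longrightarrow> dist (\<kappa> x) (\<kappa> q) < \<kappa> q / 2"
      using \<kappa>_q unfolding continuous_at_eps_delta by (metis dist_norm half_gt_zero real_norm_def)
    obtain s2 where s2: "s2 > 0" "cball q s2 \<subseteq> S"
      using S qS open_contains_cball by blast
    define s where "s = min (s1 / 2) s2"
    have s: "s > 0" "cball q s \<subseteq> S" using s1 s2 by (auto simp: s_def)
    have \<kappa>_half: "\<kappa> x \<ge> \<kappa> q / 2" if "x \<in> cball q s" for x
    proof -
      have "dist x q < s1" using that s1 by (auto simp: s_def dist_commute)
      from s1(2)[OF this] show ?thesis by (simp add: dist_real_def abs_if split: if_splits)
    qed
    have "bounded (K ` cball q s)"
      by (intro compact_imp_bounded compact_continuous_image continuous_on_subset[OF cK s(2)] compact_cball)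
    then obtain K0 where K0: "\<And>x. x \<in> cball q s \<Longrightarrow> \<bar>K x\<bar> \<le> K0"
      unfolding bounded_iff by (metis imageI real_norm_def)
    have "K0 \<ge> 0" using K0[of q] s by auto
    \<comment> \<open>Since \<kappa> \<ge> \<kappa> q / 2 near q, this gives 2 * \<alpha> * \<kappa>
      \<ge> K0 + 1 > K.\<close>
    define \<alpha> where "\<alpha> = (K0 + 1) / \<kappa> q"
    have \<alpha>: "\<alpha> > 0" using \<open>K0 \<ge> 0\<close> \<kappa>_q by (simp add: \<alpha>_def)
    define h where "h = barrier \<alpha> y1"
    have Lh: "0 < hess h x (V i x) (V i x) + hess h x (W i x) (W i x) + FD h x (Z i x)"
      if x: "x \<in> cball q s" for x
    proof -
      have "\<alpha> * \<kappa> q = K0 + 1" using \<kappa>_q by (simp add: \<alpha>_def)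
      moreover have "\<alpha> * (\<kappa> q / 2) \<le> \<alpha> * \<kappa> x"
        using \<kappa>_half[OF x] \<alpha> by (intro mult_left_mono) auto
      ultimately have "0 < 2 * \<alpha> * \<kappa> x - K x"
        using K0[OF x] by linarith
      then have "0 < 2 * \<alpha> * (2 * \<alpha> * \<kappa> x - K x) * h x"
        unfolding h_def using \<alpha> barrier_pos[of \<alpha> y1 x] by (intro mult_pos_pos) auto
      also have "\<dots> = hess h x (V i x) (V i x) + hess h x (W i x) (W i x) + FD h x (Z i x)"
        unfolding h_def hess_barrier frechet_derivative_at[OF barrier_has_derivative, symmetric]
        by (simp add: \<kappa>_def K_def algebra_simps power2_eq_square)
      finally show ?thesis .
    qed
    \<comment> \<open>The part of the small sphere on which the barrier may be as large as at q. It
      is compact and misses q, so u stays below M there by a margin that leaves room for a multiple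
      \<epsilon> of the barrier, which is at most 1.\<close>
    define P where "P = sphere q s \<inter> cball y1 (d / 2)"
    have P_below: "x \<in> S \<and> u x < M" if "x \<in> P" for x
      using touch[of x] that s by (auto simp: P_def)
    obtain \<epsilon> where \<epsilon>: "\<epsilon> > 0" "\<And>x. x \<in> P \<Longrightarrow> u x + \<epsilon> < M"
    proof (cases "P = {}")
      case True
      then show ?thesis using that[of 1] by simp
    next
      case False
      have "compact P" by (auto simp: P_def)
      moreover have "continuous_on P u"
        by (rule continuous_on_subset[OF cu]) (use P_below in auto)
      ultimately obtain p where p: "p \<in> P" "\<And>x. x \<in> P \<Longrightarrow> u x \<le> u p"
        using continuous_attains_sup[of P u] False by auto
      show ?thesis
      proof (rule that[of "(M - u p) / 2"])
        show "0 < (M - u p) / 2" using P_below[OF p(1)] by simp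
        show "u x + (M - u p) / 2 < M" if "x \<in> P" for x
          using p(2)[OF that] P_below[OF p(1)] by (simp add: field_simps)
      qed
    qed
    define g where "g x = u x + \<epsilon> * h x" for x
    have h_le_1: "h x \<le> 1" for x
      using \<alpha> by (simp add: h_def barrier_def)
    have h_out: "h x < h q" if "d / 2 < dist y1 x" for x
    proof -
      have "(d / 2)\<^sup>2 < (norm (x - y1))\<^sup>2"
        using that d0 by (intro power_strict_mono) (auto simp: dist_norm norm_minus_commute)
      then have "- \<alpha> * (norm (x - y1))\<^sup>2 < - \<alpha> * (d / 2)\<^sup>2"
        using \<alpha> by simp
      then show ?thesis
        unfolding h_def barrier_def power2_norm_eq_inner[symmetric]
        by (simp only: exp_less_cancel_iff q_eq w add_diff_cancel_left')
    qed
    \<comment> \<open>On P the gap \<epsilon> decides. Off P the point is farther from y1 than q, so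
      the barrier is strictly smaller, and u \<le> M suffices.\<close>
    have sphere: "g x < g q" if x: "x \<in> sphere q s" for x
    proof (cases "x \<in> P")
      case True
      have "\<epsilon> * h x \<le> \<epsilon> * 1" "0 < \<epsilon> * h q"
        using \<epsilon>(1) h_le_1[of x] barrier_pos[of \<alpha> y1 q] by (auto simp: h_def)
      then show ?thesis
        using \<epsilon>(2)[OF True] uq by (simp add: g_def)
    next
      case False
      then have "h x < h q" using x h_out by (auto simp: P_def)
      moreover have "u x \<le> M" using max s(2) x by (auto simp: subset_iff)
      ultimately show ?thesis
        using \<epsilon>(1) uq by (simp add: g_def add_le_less_mono)
    qed
    have ch: "continuous_on S h" by (simp add: h_def continuous_on_barrier)
    have "continuous_on (cball q s) g"
      unfolding g_def by (intro continuous_intros continuous_on_subset[OF cu s(2)] continuous_on_subset[OF ch s(2)])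
    then obtain z where z: "z \<in> cball q s" "\<And>x. x \<in> cball q s \<Longrightarrow> g x \<le> g z"
      using continuous_attains_sup[of "cball q s" g] s by auto
    have "g q \<le> g z" using z(2)[of q] s by simp
    then have zb: "z \<in> ball q s"
      using sphere[of z] z(1) by (auto simp: less_le)
    have zS: "z \<in> S" using z(1) s by blast
    have uh: "Ck_on (Suc (Suc 0)) S h"
      unfolding h_def by (rule Ck_on_barrier[OF S])
    have dg: "(g has_derivative (\<lambda>e. FD u x e + \<epsilon> * FD h x e)) (at x)"
      if "x \<in> S" for x
      unfolding g_def
      by (intro has_derivative_add has_derivative_mult_right Ck_on_Suc_has_derivative[OF u that]
          Ck_on_Suc_has_derivative[OF uh that])
    have d2g: "hess g z a b = hess u z a b + \<epsilon> * hess h z a b" for a b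
      by (rule hess_eqI[OF S zS dg])
        (auto intro!: has_derivative_add has_derivative_mult_right Ck_on_2_has_derivative[OF u zS]
          Ck_on_2_has_derivative[OF uh zS])
    have ug: "Ck_on (Suc (Suc 0)) (ball q s) g"
    proof (rule Ck_on_subset)
      show "Ck_on (Suc (Suc 0)) S g"
        unfolding g_def by (rule Ck_on_add[OF S u Ck_on_mult[OF S Ck_on_const[OF S] uh]])
      show "ball q s \<subseteq> S" using s by force
    qed
    have gmax: "g x \<le> g z" if "x \<in> ball q s" for x
      using z(2) that by simp
    \<comment> \<open>The maximum z of g over the closed ball is interior, so the operator applied
      to g is at most 0 at z; but it annihilates u and is positive on h.\<close>
    note test = hess_nonpos_at_max[OF open_ball zb ug gmax]
    have "FD u z e + \<epsilon> * FD h z e = 0" for e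
      using test(1) frechet_derivative_at[OF dg[OF zS]] by metis
    then have "FD u z (Z i z) = - \<epsilon> * FD h z (Z i z)"
      by (metis add.inverse_unique add.commute minus_mult_left)
    moreover have "hess g z (V i z) (V i z) + hess g z (W i z) (W i z) \<le> 0"
      using test(2)[of "V i z"] test(2)[of "W i z"] by simp
    ultimately have "\<epsilon> * (hess h z (V i z) (V i z) + hess h z (W i z) (W i z)
        + FD h z (Z i z)) \<le> 0"
      using eq[OF i(1) zS] by (simp add: d2g algebra_simps)
    then show False
      using Lh[OF z(1)] \<epsilon>(1) by (simp add: mult_le_0_iff)
  qed
  then show ?thesis
    using that[of r] r by (auto simp: subset_iff)
qed

section \<open>Exterior algebra on lists of vectors\<close>

lemma sum_fun_apply: "(\<Sum>i\<in>I. f i) x = (\<Sum>i\<in>I. f i x :: 'b::comm_monoid_add)"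
  by (induction I rule: infinite_finite_induct) simp_all

definition wedge1 :: "('t list \<Rightarrow> complex) \<Rightarrow> ('t list \<Rightarrow> complex) \<Rightarrow> 't list \<Rightarrow> complex" where
  "wedge1 \<theta> \<gamma> = wedge_map (tprod 1 \<theta> \<gamma>)"

lemma wedges_Cons: "wedges (\<theta> # \<theta>s) = wedge1 \<theta> (wedges \<theta>s)"
  by (simp add: wedge1_def)

declare wedges.simps(2) [simp del] upt_Suc [simp del]

lemma wedge1_sum:
  "wedge1 \<theta> \<gamma> xs = (\<Sum>i<length xs. (-1) ^ i * (\<theta> [xs ! i] * \<gamma> (omit i xs)))"
  by (simp add: wedge1_def wedge_map_def tprod_def)

lemma wedge1_Nil [simp]: "wedge1 \<theta> \<gamma> [] = 0"
  by (simp add: wedge1_sum)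

text \<open>Contraction with a vector is an antiderivation. Used as a recursion on the argument
  list, with \<gamma> generalised, it replaces the index bookkeeping of the sum over omitted entries
  in the identities that follow.\<close>

lemma wedge1_Cons: "wedge1 \<theta> \<gamma> (x # xs) = \<theta> [x] * \<gamma> xs - wedge1 \<theta> (\<lambda>ys. \<gamma> (x # ys)) xs"
  by (simp add: wedge1_sum sum.lessThan_Suc_shift sum_negf del: sum.lessThan_Suc)

lemma wedge1_cong:
  assumes "\<And>x. x \<in> set xs \<Longrightarrow> \<theta> [x] = \<theta>' [x]" "\<And>ys. set ys \<subseteq> set xs \<Longrightarrow> \<gamma> ys = \<gamma>' ys"
  shows "wedge1 \<theta> \<gamma> xs = wedge1 \<theta>' \<gamma>' xs"
  unfolding wedge1_sum
proof (rule sum.cong)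
  fix i assume "i \<in> {..<length xs}"
  moreover have "set (omit i xs) \<subseteq> set xs"
    by (simp add: set_take_subset set_drop_subset)
  ultimately show "(-1) ^ i * (\<theta> [xs ! i] * \<gamma> (omit i xs))
      = (-1) ^ i * (\<theta>' [xs ! i] * \<gamma>' (omit i xs))"
    using assms by simp
qed simp

lemma wedge1_add_right: "wedge1 \<theta> (\<gamma> + \<delta>) = wedge1 \<theta> \<gamma> + wedge1 \<theta> \<delta>"
  by (simp add: fun_eq_iff wedge1_sum algebra_simps sum.distrib)

lemma wedge1_scale_right: "wedge1 \<theta> (cscale c \<gamma>) = cscale c (wedge1 \<theta> \<gamma>)"
  by (simp add: fun_eq_iff wedge1_sum cscale_def sum_distrib_left algebra_simps)

lemma wedge1_0_right [simp]: "wedge1 \<theta> 0 = 0"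
  by (simp add: fun_eq_iff wedge1_sum)

lemma wedge1_add_left: "wedge1 (\<theta> + \<eta>) \<gamma> = wedge1 \<theta> \<gamma> + wedge1 \<eta> \<gamma>"
  by (simp add: fun_eq_iff wedge1_sum algebra_simps sum.distrib)

lemma wedge1_lincomb:
  "wedge1 \<theta> (\<lambda>ys. a * \<gamma> ys + b * \<delta> ys) xs = a * wedge1 \<theta> \<gamma> xs + b * wedge1 \<theta> \<delta> xs"
  by (simp add: wedge1_sum algebra_simps sum.distrib sum_distrib_left)

lemma wedge1_scale: "wedge1 \<theta> (\<lambda>ys. a * \<gamma> ys) xs = a * wedge1 \<theta> \<gamma> xs"
  by (simp add: wedge1_sum algebra_simps sum_distrib_left)

lemma wedge1_minus: "wedge1 \<theta> (\<lambda>ys. - \<gamma> ys) xs = - wedge1 \<theta> \<gamma> xs"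
  using wedge1_scale[of \<theta> "-1" \<gamma> xs] by simp

lemma wedge1_diff: "wedge1 \<theta> (\<lambda>ys. \<gamma> ys - \<delta> ys) xs = wedge1 \<theta> \<gamma> xs - wedge1 \<theta> \<delta> xs"
  using wedge1_lincomb[of \<theta> 1 \<gamma> "-1" \<delta> xs] by simp

lemma wedge1_swap: "wedge1 \<theta> (wedge1 \<eta> \<gamma>) xs = - wedge1 \<eta> (wedge1 \<theta> \<gamma>) xs"
proof (induction xs arbitrary: \<gamma>)
  case (Cons x xs)
  show ?case
    by (simp add: wedge1_Cons wedge1_diff wedge1_scale Cons.IH)
qed simp

text \<open>Brings a new (0,1)-factor behind the (1,0)-factors, the order that the generators of
  \<open>Lambda\<close> prescribe.\<close>

lemma wedge1_wedges_swap:
  "wedge1 \<eta> (wedges (\<theta>s @ \<eta>s)) = cscale ((-1) ^ length \<theta>s) (wedges (\<theta>s @ \<eta> # \<eta>s))"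
proof (induction \<theta>s)
  case Nil
  then show ?case by (simp add: wedges_Cons cscale_def)
next
  case (Cons \<theta> \<theta>s)
  have "wedge1 \<eta> (wedges ((\<theta> # \<theta>s) @ \<eta>s)) = cscale (-1) (wedge1 \<theta> (wedge1 \<eta> (wedges (\<theta>s @ \<eta>s))))"
    by (simp add: fun_eq_iff wedges_Cons cscale_def wedge1_swap[of \<eta>])
  then show ?case
    unfolding Cons.IH wedge1_scale_right by (simp add: wedges_Cons cscale_def fun_eq_iff)
qed

section \<open>Alternating, multilinear and complex-linear functions of lists\<close>

definition alternating :: "('t list \<Rightarrow> complex) \<Rightarrow> bool" where
  "alternating \<alpha> \<longleftrightarrow> (\<forall>us x y vs. \<alpha> (us @ x # y # vs) = - \<alpha> (us @ y # x # vs))"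

text \<open>The other arguments us and vs range over all lists: if one of them is not in T, a
  \<open>kform\<close> vanishes on both sides.\<close>

definition multilinear :: "('x \<Rightarrow> 'e::real_vector) set \<Rightarrow> (('x \<Rightarrow> 'e) list \<Rightarrow> complex) \<Rightarrow> bool" where
  "multilinear T \<alpha> \<longleftrightarrow> (\<forall>us vs. \<forall>\<xi>\<in>T. \<forall>\<eta>\<in>T. \<forall>a b. \<alpha> (us @ (rscale a \<xi> + rscale b \<eta>) # vs)
     = of_real a * \<alpha> (us @ \<xi> # vs) + of_real b * \<alpha> (us @ \<eta> # vs))"

definition kform :: "('x \<Rightarrow> 'e::real_vector) set \<Rightarrow> nat \<Rightarrow> (('x \<Rightarrow> 'e) list \<Rightarrow> complex) \<Rightarrow> bool" where
  "kform T k \<alpha> \<longleftrightarrow> (\<forall>xs. \<alpha> xs \<noteq> 0 \<longrightarrow> length xs = k \<and> set xs \<subseteq> T) \<and> alternating \<alpha> \<and> multilinear T \<alpha>"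

definition complex_linear :: "('t \<Rightarrow> 't) \<Rightarrow> 't set \<Rightarrow> ('t list \<Rightarrow> complex) \<Rightarrow> bool" where
  "complex_linear K T \<alpha> \<longleftrightarrow> (\<forall>us x vs. x \<in> T \<longrightarrow> \<alpha> (us @ K x # vs) = \<i> * \<alpha> (us @ x # vs))"

lemma alternatingD: "alternating \<alpha> \<Longrightarrow> \<alpha> (us @ x # y # vs) = - \<alpha> (us @ y # x # vs)"
  unfolding alternating_def by blast

lemma alternating_interior: "alternating \<alpha> \<Longrightarrow> alternating (\<lambda>ys. \<alpha> (x # ys))"
  unfolding alternating_def by (metis append_Cons)

lemma multilinearD:
  "multilinear T \<alpha> \<Longrightarrow> \<xi> \<in> T \<Longrightarrow> \<eta> \<in> T \<Longrightarrow> \<alpha> (us @ (rscale a \<xi> + rscale b \<eta>) # vs)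
     = of_real a * \<alpha> (us @ \<xi> # vs) + of_real b * \<alpha> (us @ \<eta> # vs)"
  unfolding multilinear_def by blast

lemma multilinear_interior:
  assumes "multilinear T \<alpha>"
  shows "multilinear T (\<lambda>ys. \<alpha> (x # ys))"
  unfolding multilinear_def using multilinearD[OF assms, of _ _ "x # _"] by simp

lemma complex_linearD: "complex_linear K T \<alpha> \<Longrightarrow> x \<in> T \<Longrightarrow> \<alpha> (us @ K x # vs) = \<i> * \<alpha> (us @ x # vs)"
  unfolding complex_linear_def by blast

lemma complex_linear_interior:
  assumes "complex_linear K T \<alpha>"
  shows "complex_linear K T (\<lambda>ys. \<alpha> (x # ys))"
  unfolding complex_linear_def using complex_linearD[OF assms, of _ "x # _"] by simp

lemma alternating_wedge1:
  assumes "alternating \<gamma>"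
  shows "alternating (wedge1 \<theta> \<gamma>)"
  unfolding alternating_def
proof (intro allI)
  fix us x y vs
  show "wedge1 \<theta> \<gamma> (us @ x # y # vs) = - wedge1 \<theta> \<gamma> (us @ y # x # vs)"
    using assms
  proof (induction us arbitrary: \<gamma>)
    case Nil
    have "wedge1 \<theta> (\<lambda>ys. \<gamma> (x # y # ys)) vs = - wedge1 \<theta> (\<lambda>ys. \<gamma> (y # x # ys)) vs"
      using alternatingD[OF Nil, of "[]" x y] by (simp add: wedge1_minus)
    then show ?case
      by (simp add: wedge1_Cons)
  next
    case (Cons u us)
    then show ?case
      using Cons.IH[OF alternating_interior[OF Cons.prems, of u]] alternatingD[OF Cons.prems, of us x y vs]
      by (simp add: wedge1_Cons)
  qed
qed

lemma multilinear_wedge1: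
  assumes "multilinear T \<gamma>" "multilinear T \<theta>"
  shows "multilinear T (wedge1 \<theta> \<gamma>)"
  unfolding multilinear_def
proof (intro allI ballI)
  fix us vs \<xi> \<eta> and a b :: real assume T: "\<xi> \<in> T" "\<eta> \<in> T"
  define z where "z = rscale a \<xi> + rscale b \<eta>"
  have z: "\<alpha> (us @ z # vs) = of_real a * \<alpha> (us @ \<xi> # vs) + of_real b * \<alpha> (us @ \<eta> # vs)"
    if "multilinear T \<alpha>" for \<alpha> us vs
    unfolding z_def by (rule multilinearD[OF that T])
  have "wedge1 \<theta> \<gamma> (us @ z # vs)
     = of_real a * wedge1 \<theta> \<gamma> (us @ \<xi> # vs) + of_real b * wedge1 \<theta> \<gamma> (us @ \<eta> # vs)"
    using assms(1)
  proof (induction us arbitrary: \<gamma>)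
    case Nil
    show ?case
      using z[OF Nil, of "[]"] z[OF assms(2), of "[]" "[]"]
      by (simp add: wedge1_Cons wedge1_lincomb algebra_simps)
  next
    case (Cons u us)
    show ?case
      using Cons.IH[OF multilinear_interior[OF Cons.prems, of u]] z[OF Cons.prems, of us vs]
      by (simp add: wedge1_Cons algebra_simps)
  qed
  then show "wedge1 \<theta> \<gamma> (us @ (rscale a \<xi> + rscale b \<eta>) # vs)
     = of_real a * wedge1 \<theta> \<gamma> (us @ \<xi> # vs) + of_real b * wedge1 \<theta> \<gamma> (us @ \<eta> # vs)"
    unfolding z_def .
qed

lemma complex_linear_wedge1:
  assumes "complex_linear K T \<gamma>" "complex_linear K T \<theta>"
  shows "complex_linear K T (wedge1 \<theta> \<gamma>)"
  unfolding complex_linear_def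
proof (intro allI impI)
  fix us x vs assume x: "x \<in> T"
  show "wedge1 \<theta> \<gamma> (us @ K x # vs) = \<i> * wedge1 \<theta> \<gamma> (us @ x # vs)"
    using assms(1)
  proof (induction us arbitrary: \<gamma>)
    case Nil
    show ?case
      using complex_linearD[OF Nil x, of "[]"] complex_linearD[OF assms(2) x, of "[]" "[]"]
      by (simp add: wedge1_Cons wedge1_scale algebra_simps)
  next
    case (Cons u us)
    show ?case
      using Cons.IH[OF complex_linear_interior[OF Cons.prems, of u]] complex_linearD[OF Cons.prems x, of us vs]
      by (simp add: wedge1_Cons algebra_simps)
  qed
qed

lemma kformD:
  assumes "kform T k \<alpha>"
  shows "alternating \<alpha>" "multilinear T \<alpha>" "\<alpha> xs \<noteq> 0 \<Longrightarrow> length xs = k" "\<alpha> xs \<noteq> 0 \<Longrightarrow> set xs \<subseteq> T"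
    "length xs \<noteq> k \<Longrightarrow> \<alpha> xs = 0" "\<not> set xs \<subseteq> T \<Longrightarrow> \<alpha> xs = 0"
  using assms unfolding kform_def by blast+

lemma kform_0: "kform T k 0"
  by (simp add: kform_def alternating_def multilinear_def)

lemma kform_add:
  assumes "kform T k \<alpha>" "kform T k \<beta>"
  shows "kform T k (\<alpha> + \<beta>)"
  unfolding kform_def
proof (intro conjI allI impI)
  fix xs assume "(\<alpha> + \<beta>) xs \<noteq> 0"
  then have "\<alpha> xs \<noteq> 0 \<or> \<beta> xs \<noteq> 0" by auto
  then show "length xs = k" "set xs \<subseteq> T"
    using kformD(3,4)[OF assms(1)] kformD(3,4)[OF assms(2)] by blast+
next
  show "alternating (\<alpha> + \<beta>)"
    using alternatingD[OF kformD(1)[OF assms(1)]] alternatingD[OF kformD(1)[OF assms(2)]]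
    unfolding alternating_def plus_fun_apply by (metis minus_add_distrib)
  show "multilinear T (\<alpha> + \<beta>)"
    unfolding multilinear_def plus_fun_apply[of \<alpha> \<beta>]
    by (intro allI ballI, subst (1 2) multilinearD[of T])
      (use kformD(2)[OF assms(1)] kformD(2)[OF assms(2)] in \<open>auto simp: distrib_left\<close>)
qed

lemma kform_scale:
  assumes "kform T k \<alpha>"
  shows "kform T k (cscale c \<alpha>)"
  unfolding kform_def cscale_def
proof (intro conjI allI impI)
  fix xs assume "c * \<alpha> xs \<noteq> 0"
  then have "\<alpha> xs \<noteq> 0" by auto
  then show "length xs = k" "set xs \<subseteq> T"
    using kformD(3,4)[OF assms] by blast+
next
  show "alternating (\<lambda>x. c * \<alpha> x)"
    using alternatingD[OF kformD(1)[OF assms]]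
    unfolding alternating_def by (metis mult_minus_right)
  show "multilinear T (\<lambda>x. c * \<alpha> x)"
    unfolding multilinear_def
    by (intro allI ballI, subst multilinearD[OF kformD(2)[OF assms]]) (auto simp: algebra_simps)
qed

lemma kform_sum: "(\<And>i. i \<in> I \<Longrightarrow> kform T k (f i)) \<Longrightarrow> kform T k (\<Sum>i\<in>I. f i)"
  by (induction I rule: infinite_finite_induct) (auto simp: kform_0 kform_add)

lemma kform_interior: "kform T (Suc k) \<alpha> \<Longrightarrow> kform T k (\<lambda>ys. \<alpha> (x # ys))"
  unfolding kform_def[of T k] using alternating_interior multilinear_interior kformD[of T "Suc k" \<alpha>]
  by (metis insert_subset length_Cons list.simps(15) nat.inject)

lemma kform_wedge1:
  assumes "kform T 1 \<theta>" "kform T k \<gamma>"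
  shows "kform T (Suc k) (wedge1 \<theta> \<gamma>)"
  unfolding kform_def
proof (intro conjI allI impI)
  fix xs assume "wedge1 \<theta> \<gamma> xs \<noteq> 0"
  then obtain i where i: "i < length xs" "\<theta> [xs ! i] * \<gamma> (omit i xs) \<noteq> 0"
    unfolding wedge1_sum by (metis (no_types, lifting) lessThan_iff mult_zero_right sum.neutral)
  then have nz: "\<theta> [xs ! i] \<noteq> 0" "\<gamma> (omit i xs) \<noteq> 0" by auto
  note * = kformD(4)[OF assms(1) nz(1)] kformD(3,4)[OF assms(2) nz(2)]
  show "length xs = Suc k" using *(2) i(1) by auto
  show "set xs \<subseteq> T"
    using *(1,3) i(1) by (subst id_take_nth_drop[OF i(1)]) auto
qed (rule alternating_wedge1[OF kformD(1)[OF assms(2)]],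
    rule multilinear_wedge1[OF kformD(2)[OF assms(2)] kformD(2)[OF assms(1)]])

lemma kform_wedges_Nil: "kform T 0 (wedges [])"
  by (simp add: kform_def alternating_def multilinear_def)

lemma kform_wedges:
  "(\<And>\<theta>. \<theta> \<in> set \<theta>s \<Longrightarrow> kform T 1 \<theta>) \<Longrightarrow> kform T (length \<theta>s) (wedges \<theta>s)"
proof (induction \<theta>s)
  case Nil
  show ?case using kform_wedges_Nil by simp
next
  case (Cons \<theta> \<theta>s)
  then show ?case by (simp add: wedges_Cons kform_wedge1)
qed

section \<open>Rearranging the arguments of an alternating function\<close>

lemma alternating_move:
  "alternating \<alpha> \<Longrightarrow> \<alpha> (us @ x # vs) = (-1) ^ length us * \<alpha> (x # us @ vs)"
proof (induction us arbitrary: \<alpha>)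
  case (Cons u us)
  show ?case
    using Cons.IH[OF alternating_interior[OF Cons.prems, of u]] alternatingD[OF Cons.prems, of "[]" u x]
    by simp
qed simp

text \<open>Phrased for vanishing only, which spares the signature of the permutation.\<close>

lemma alternating_perm:
  "alternating \<alpha> \<Longrightarrow> mset xs = mset ys \<Longrightarrow> \<alpha> xs = 0 \<longleftrightarrow> \<alpha> ys = 0"
proof (induction xs arbitrary: \<alpha> ys)
  case (Cons x xs)
  have "x \<in> set ys" using Cons.prems(2) by (metis list.set_intros(1) mset_eq_setD)
  then obtain us vs where ys: "ys = us @ x # vs" by (meson split_list)
  then have "mset xs = mset (us @ vs)" using Cons.prems(2) by simp
  from Cons.IH[OF alternating_interior[OF Cons.prems(1), of x] this]
  show ?case
    unfolding ys alternating_move[OF Cons.prems(1), of us] by simp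
qed simp

lemma alternating_not_distinct:
  assumes "alternating \<alpha>" "\<not> distinct xs"
  shows "\<alpha> xs = 0"
proof -
  obtain as bs cs x where "xs = as @ [x] @ bs @ [x] @ cs"
    using assms(2) not_distinct_decomp by blast
  then have "mset xs = mset ([] @ x # x # as @ bs @ cs)" by simp
  moreover have "\<alpha> ([] @ x # x # as @ bs @ cs) = 0"
    using alternatingD[OF assms(1), of "[]" x x] by simp
  ultimately show ?thesis
    using alternating_perm[OF assms(1)] by blast
qed

text \<open>The derivation induced by \<open>K\<close>; forms of type \<open>(a, b)\<close> are its eigenvectors for the
  eigenvalue \<open>\<i> (a - b)\<close>, hence the decomposition into types is unique.\<close>

primrec der :: "('t \<Rightarrow> 't) \<Rightarrow> 't list \<Rightarrow> ('t list \<Rightarrow> complex) \<Rightarrow> complex" where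
  "der K [] \<alpha> = 0"
| "der K (x # xs) \<alpha> = \<alpha> (K x # xs) + der K xs (\<lambda>ys. \<alpha> (x # ys))"

lemma der_lincomb:
  "der K xs (\<lambda>ys. a * \<alpha> ys + b * \<beta> ys) = a * der K xs \<alpha> + b * der K xs \<beta>"
  by (induction xs arbitrary: \<alpha> \<beta>) (simp_all add: algebra_simps)

lemma der_0: "der K xs (\<lambda>ys. 0) = 0"
  using der_lincomb[of K xs 0 _ 0] by simp

lemma der_sum: "der K xs (\<lambda>ys. \<Sum>i\<in>I. f i ys) = (\<Sum>i\<in>I. der K xs (f i))"
proof (induction I rule: infinite_finite_induct)
  case (insert i I)
  then show ?case using der_lincomb[of K xs 1 "f i" 1] by simp
qed (simp_all add: der_0)

lemma der_scale: "der K xs (\<lambda>ys. a * \<alpha> ys) = a * der K xs \<alpha>"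
  using der_lincomb[of K xs a \<alpha> 0 \<alpha>] by simp

lemma der_cong:
  assumes "K ` T \<subseteq> T"
  shows "set xs \<subseteq> T \<Longrightarrow> (\<And>ys. set ys \<subseteq> T \<Longrightarrow> \<alpha> ys = \<beta> ys) \<Longrightarrow> der K xs \<alpha> = der K xs \<beta>"
proof (induction xs arbitrary: \<alpha> \<beta>)
  case (Cons x xs)
  have "der K xs (\<lambda>ys. \<alpha> (x # ys)) = der K xs (\<lambda>ys. \<beta> (x # ys))"
    by (rule Cons.IH) (use Cons.prems in auto)
  moreover have "\<alpha> (K x # xs) = \<beta> (K x # xs)"
    by (rule Cons.prems(2)) (use Cons.prems assms in auto)
  ultimately show ?case by simp
qed simp

text \<open>The Leibniz rule for \<open>der\<close>, in the case of a first factor that is an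
  eigenvector.\<close>

lemma der_wedge1:
  assumes "\<And>x. x \<in> T \<Longrightarrow> \<theta> [K x] = c * \<theta> [x]"
  shows "set xs \<subseteq> T \<Longrightarrow> der K xs (wedge1 \<theta> \<gamma>) = c * wedge1 \<theta> \<gamma> xs + wedge1 \<theta> (\<lambda>ys. der K ys \<gamma>) xs"
proof (induction xs arbitrary: \<gamma>)
  case (Cons x xs)
  have "der K xs (\<lambda>ys. \<theta> [x] * \<gamma> ys + (-1) * wedge1 \<theta> (\<lambda>ys. \<gamma> (x # ys)) ys)
      = \<theta> [x] * der K xs \<gamma> + (-1) * der K xs (wedge1 \<theta> (\<lambda>ys. \<gamma> (x # ys)))"
    by (rule der_lincomb)
  moreover have "wedge1 \<theta> (\<lambda>ys. 1 * \<gamma> (K x # ys) + 1 * der K ys (\<lambda>ys. \<gamma> (x # ys))) xs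
      = 1 * wedge1 \<theta> (\<lambda>ys. \<gamma> (K x # ys)) xs + 1 * wedge1 \<theta> (\<lambda>ys. der K ys (\<lambda>ys. \<gamma> (x # ys))) xs"
    by (rule wedge1_lincomb)
  ultimately show ?case
    using Cons.IH[of "\<lambda>ys. \<gamma> (x # ys)"] Cons.prems assms[of x]
    by (simp add: wedge1_Cons algebra_simps)
qed simp

text \<open>Eigenvalues add up under wedge products. \<open>Lambda_der\<close> applies this twice,
  first to the (0,1)-factors and then to the (1,0)-factors in front of them.\<close>

lemma der_wedges_append:
  assumes "\<And>\<theta> x. \<theta> \<in> set \<theta>s \<Longrightarrow> x \<in> T \<Longrightarrow> \<theta> [K x] = c * \<theta> [x]"
    and "\<And>xs. set xs \<subseteq> T \<Longrightarrow> der K xs (wedges \<eta>s) = d * wedges \<eta>s xs"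
  shows "set xs \<subseteq> T \<Longrightarrow> der K xs (wedges (\<theta>s @ \<eta>s)) = (of_nat (length \<theta>s) * c + d) * wedges (\<theta>s @ \<eta>s) xs"
  using assms(1)
proof (induction \<theta>s arbitrary: xs)
  case Nil
  then show ?case by (simp add: assms(2))
next
  case (Cons \<theta> \<theta>s)
  let ?d = "of_nat (length \<theta>s) * c + d"
  have "wedge1 \<theta> (\<lambda>ys. der K ys (wedges (\<theta>s @ \<eta>s))) xs = wedge1 \<theta> (\<lambda>ys. ?d * wedges (\<theta>s @ \<eta>s) ys) xs"
    by (rule wedge1_cong) (use Cons in auto)
  also have "\<dots> = ?d * wedge1 \<theta> (wedges (\<theta>s @ \<eta>s)) xs"
    by (rule wedge1_scale)
  finally show ?case
    using der_wedge1[of T \<theta> K c xs "wedges (\<theta>s @ \<eta>s)"] Cons.prems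
    by (simp add: wedges_Cons algebra_simps)
qed

lemma der_wedges_Nil: "der K xs (wedges []) = 0"
  by (cases xs) (simp_all add: der_0)

text \<open>The relations for all powers extend to all polynomials in \<mu>; the polynomial whose
  roots are the other eigenvalues isolates h j.\<close>

lemma sum_eigenvalues_0:
  fixes \<mu> h :: "nat \<Rightarrow> complex"
  assumes "\<And>r. (\<Sum>i\<le>k. \<mu> i ^ r * h i) = 0" "inj_on \<mu> {..k}" "j \<le> k"
  shows "h j = 0"
proof -
  have poly: "(\<Sum>i\<le>k. poly P (\<mu> i) * h i) = 0" for P
  proof -
    have "(\<Sum>i\<le>k. poly P (\<mu> i) * h i) = (\<Sum>r\<le>degree P. coeff P r * (\<Sum>i\<le>k. \<mu> i ^ r * h i))"
      unfolding poly_altdef sum_distrib_left sum_distrib_right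
      by (subst sum.swap) (simp add: algebra_simps)
    then show ?thesis using assms(1) by simp
  qed
  define P where "P = (\<Prod>i\<in>{..k} - {j}. [:- \<mu> i, 1:])"
  have "poly P (\<mu> i) = 0" if "i \<le> k" "i \<noteq> j" for i
    using that by (auto simp: P_def poly_prod prod_zero_iff)
  then have "(\<Sum>i\<le>k. poly P (\<mu> i) * h i) = (\<Sum>i\<le>k. if i = j then poly P (\<mu> j) * h j else 0)"
    by (intro sum.cong) auto
  then have "poly P (\<mu> j) * h j = 0" using poly[of P] assms(3) by simp
  moreover have "poly P (\<mu> j) \<noteq> 0"
    using assms(2,3) by (auto simp: P_def poly_prod prod_zero_iff inj_on_def)
  ultimately show ?thesis by simp
qed

section \<open>Forms at a point\<close>

lemma cotangent_C_iff: "\<theta> \<in> cotangent_C A p \<longleftrightarrow> kform (tangent_space A p) 1 \<theta>"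
proof
  assume \<theta>: "\<theta> \<in> cotangent_C A p"
  then have supp: "\<theta> xs = 0" if "length xs \<noteq> 1" for xs
    using that unfolding cotangent_C_def by force
  have "multilinear (tangent_space A p) \<theta>"
    unfolding multilinear_def
  proof (intro allI ballI)
    fix us vs \<xi> \<eta> and a b :: real assume "\<xi> \<in> tangent_space A p" "\<eta> \<in> tangent_space A p"
    then have "\<theta> [rscale a \<xi> + rscale b \<eta>] = of_real a * \<theta> [\<xi>] + of_real b * \<theta> [\<eta>]"
      using \<theta> unfolding cotangent_C_def by blast
    then show "\<theta> (us @ (rscale a \<xi> + rscale b \<eta>) # vs) = of_real a * \<theta> (us @ \<xi> # vs) + of_real b * \<theta> (us @ \<eta> # vs)"
      by (cases "us = [] \<and> vs = []") (auto simp: supp)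
  qed
  moreover have "alternating \<theta>"
    unfolding alternating_def by (simp add: supp)
  ultimately show "kform (tangent_space A p) 1 \<theta>"
    using \<theta> unfolding kform_def cotangent_C_def by force
next
  assume k: "kform (tangent_space A p) 1 \<theta>"
  have "\<exists>\<xi>\<in>tangent_space A p. xs = [\<xi>]" if "\<theta> xs \<noteq> 0" for xs
    using kformD(3,4)[OF k that] by (auto simp: length_Suc_conv)
  moreover have "\<theta> [rscale a \<xi> + rscale b \<eta>] = of_real a * \<theta> [\<xi>] + of_real b * \<theta> [\<eta>]"
    if "\<xi> \<in> tangent_space A p" "\<eta> \<in> tangent_space A p" for \<xi> \<eta> a b
    using multilinearD[OF kformD(2)[OF k] that, of "[]" a b "[]"] by simp
  ultimately show "\<theta> \<in> cotangent_C A p"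
    unfolding cotangent_C_def by blast
qed

text \<open>The linear algebra of a single tangent space. Keeping p as a parameter allows
  \<open>framed_acs\<close> to import the results at all points at once.\<close>

locale complex_frame =
  fixes A :: "('a, 'e::euclidean_space) chart set"
    and J :: "'a \<Rightarrow> ('a, 'e) tvec \<Rightarrow> ('a, 'e) tvec" and p :: 'a and n :: nat
    and v w :: "nat \<Rightarrow> ('a, 'e) tvec" and v' w' :: "nat \<Rightarrow> ('a, 'e) tvec \<Rightarrow> real"
  assumes T_0: "0 \<in> tangent_space A p"
    and T_lin: "\<And>\<xi> \<eta> a b. \<xi> \<in> tangent_space A p \<Longrightarrow> \<eta> \<in> tangent_space A p \<Longrightarrow>
      rscale a \<xi> + rscale b \<eta> \<in> tangent_space A p"
    and J_T: "\<And>\<xi>. \<xi> \<in> tangent_space A p \<Longrightarrow> J p \<xi> \<in> tangent_space A p"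
    and JJ: "\<And>\<xi>. \<xi> \<in> tangent_space A p \<Longrightarrow> J p (J p \<xi>) = - \<xi>"
    and J_lin: "\<And>\<xi> \<eta> a b. \<xi> \<in> tangent_space A p \<Longrightarrow> \<eta> \<in> tangent_space A p \<Longrightarrow>
      J p (rscale a \<xi> + rscale b \<eta>) = rscale a (J p \<xi>) + rscale b (J p \<eta>)"
    and frame_T: "\<And>i. i \<in> {1..n} \<Longrightarrow> v i \<in> tangent_space A p" "\<And>i. i \<in> {1..n} \<Longrightarrow> w i \<in> tangent_space A p"
    and Jv: "\<And>i. i \<in> {1..n} \<Longrightarrow> J p (v i) = w i" and Jw: "\<And>i. i \<in> {1..n} \<Longrightarrow> J p (w i) = - v i"
    and covec: "\<And>i. i \<in> {1..n} \<Longrightarrow> real_covector A p (v' i)" "\<And>i. i \<in> {1..n} \<Longrightarrow> real_covector A p (w' i)"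
    and dual: "\<And>i j. i \<in> {1..n} \<Longrightarrow> j \<in> {1..n} \<Longrightarrow> v' i (v j) = (if i = j then 1 else 0)"
      "\<And>i j. i \<in> {1..n} \<Longrightarrow> j \<in> {1..n} \<Longrightarrow> v' i (w j) = 0"
      "\<And>i j. i \<in> {1..n} \<Longrightarrow> j \<in> {1..n} \<Longrightarrow> w' i (w j) = (if i = j then 1 else 0)"
      "\<And>i j. i \<in> {1..n} \<Longrightarrow> j \<in> {1..n} \<Longrightarrow> w' i (v j) = 0"
    and expand: "\<And>\<xi>. \<xi> \<in> tangent_space A p \<Longrightarrow>
      \<xi> = (\<Sum>i=1..n. rscale (v' i \<xi>) (v i) + rscale (w' i \<xi>) (w i))"
begin

abbreviation "T \<equiv> tangent_space A p"

text \<open>Membership in T is carried through the same induction, since multilinearity is available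
  only for arguments in T.\<close>

lemma multilinear_sum:
  assumes \<alpha>: "multilinear T \<alpha>" and "finite I" "\<And>i. i \<in> I \<Longrightarrow> f i \<in> T" "\<And>i. i \<in> I \<Longrightarrow> g i \<in> T"
  shows "(\<Sum>i\<in>I. rscale (c i) (f i) + rscale (d i) (g i)) \<in> T \<and>
    \<alpha> (us @ (\<Sum>i\<in>I. rscale (c i) (f i) + rscale (d i) (g i)) # vs) =
    (\<Sum>i\<in>I. of_real (c i) * \<alpha> (us @ f i # vs) + of_real (d i) * \<alpha> (us @ g i # vs))"
  using assms(2-4)
proof (induction I rule: finite_induct)
  case empty
  have "rscale 0 0 + rscale 0 0 = (0 :: ('a, 'e) tvec)" by (simp add: rscale_def fun_eq_iff)
  then show ?case
    unfolding sum.empty using multilinearD[OF \<alpha> T_0 T_0, of us 0 0 vs] T_0 by (simp del: zero_fun_apply)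
next
  case (insert i I)
  define s where "s = (\<Sum>i\<in>I. rscale (c i) (f i) + rscale (d i) (g i))"
  define t where "t = rscale (c i) (f i) + rscale (d i) (g i)"
  have s: "s \<in> T" "\<alpha> (us @ s # vs) =
      (\<Sum>i\<in>I. of_real (c i) * \<alpha> (us @ f i # vs) + of_real (d i) * \<alpha> (us @ g i # vs))"
    using insert.IH[OF insert.prems(1) insert.prems(2)] unfolding s_def by blast+
  have t: "t \<in> T" "\<alpha> (us @ t # vs) = of_real (c i) * \<alpha> (us @ f i # vs) + of_real (d i) * \<alpha> (us @ g i # vs)"
    unfolding t_def using insert.prems by (auto intro!: T_lin multilinearD[OF \<alpha>])
  have ts: "rscale 1 t + rscale 1 s = t + s" by (simp add: rscale_def fun_eq_iff)
  have "t + s \<in> T" using T_lin[OF t(1) s(1), of 1 1] unfolding ts .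
  moreover have "\<alpha> (us @ (t + s) # vs) = \<alpha> (us @ t # vs) + \<alpha> (us @ s # vs)"
    using multilinearD[OF \<alpha> t(1) s(1), of us 1 1 vs] unfolding ts by simp
  ultimately show ?case
    unfolding sum.insert[OF insert.hyps] s_def[symmetric] t_def[symmetric] s(2) t(2) by (rule conjI)
qed

lemma multilinear_expand:
  assumes "multilinear T \<alpha>" "x \<in> T"
  shows "\<alpha> (us @ x # vs) = (\<Sum>i=1..n. of_real (v' i x) * \<alpha> (us @ v i # vs) + of_real (w' i x) * \<alpha> (us @ w i # vs))"
  by (subst expand[OF assms(2)]) (use multilinear_sum[OF assms(1), of "{1..n}"] frame_T in auto)

section \<open>The coframes of types (1,0) and (0,1), and the form psi\<close>

definition phi :: "nat \<Rightarrow> ('a, 'e) ctensor" where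
  "phi i = complex_one_form A (\<lambda>_. v' i) (\<lambda>_. w' i) p"

definition phib :: "nat \<Rightarrow> ('a, 'e) ctensor" where
  "phib i = complex_one_form A (\<lambda>_. v' i) (\<lambda>_ x. - w' i x) p"

definition psi :: "('a, 'e) ctensor" where
  "psi = wedges (map phi [1..<Suc n])"

abbreviation "vs \<equiv> map v [1..<Suc n]"

lemma phi_apply: "x \<in> T \<Longrightarrow> phi i [x] = of_real (v' i x) + \<i> * of_real (w' i x)"
  and phib_apply: "x \<in> T \<Longrightarrow> phib i [x] = of_real (v' i x) - \<i> * of_real (w' i x)"
  by (simp_all add: phi_def phib_def complex_one_form_def)

lemma complex_one_form_cotangent:
  assumes "real_covector A p (f p)" "real_covector A p (g p)"
  shows "complex_one_form A f g p \<in> cotangent_C A p"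
  unfolding cotangent_C_def
proof (intro CollectI conjI allI impI ballI)
  fix xs assume "complex_one_form A f g p xs \<noteq> 0"
  then show "\<exists>\<xi>\<in>T. xs = [\<xi>]"
    by (auto simp: complex_one_form_def split: list.splits if_splits)
next
  fix \<xi> \<eta> and a b :: real assume T: "\<xi> \<in> T" "\<eta> \<in> T"
  have "f p (rscale a \<xi> + rscale b \<eta>) = a * f p \<xi> + b * f p \<eta>" "g p (rscale a \<xi> + rscale b \<eta>) = a * g p \<xi> + b * g p \<eta>"
    using assms T unfolding real_covector_def by blast+
  moreover have "rscale a \<xi> + rscale b \<eta> \<in> T" by (rule T_lin[OF T])
  ultimately show "complex_one_form A f g p [rscale a \<xi> + rscale b \<eta>]
      = of_real a * complex_one_form A f g p [\<xi>] + of_real b * complex_one_form A f g p [\<eta>]"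
    unfolding complex_one_form_def using T by (simp add: algebra_simps)
qed

text \<open>Both sides are real linear in x, so the frame decides; at w_i one uses J w_i = - v_i and
  c^2 = -1. The lemma serves c = \<i> for \<open>phi\<close> and c = - \<i> for
  \<open>phib\<close>.\<close>

lemma one_form_J:
  assumes k: "kform T 1 \<theta>" and v: "\<And>i. i \<in> {1..n} \<Longrightarrow> \<theta> [w i] = c * \<theta> [v i]" and c: "c * c = -1" and x: "x \<in> T"
  shows "\<theta> [J p x] = c * \<theta> [x]"
proof -
  \<comment> \<open>The map x \<mapsto> \<theta> [J p x], extended by 0 to lists of other lengths so
    that \<open>multilinear_expand\<close> applies.\<close>
  let ?K = "\<lambda>xs. case xs of [x] \<Rightarrow> \<theta> [J p x] | _ \<Rightarrow> 0"
  have K: "multilinear T ?K"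
    unfolding multilinear_def
  proof (intro allI ballI)
    fix us vs \<xi> \<eta> and a b :: real assume T: "\<xi> \<in> T" "\<eta> \<in> T"
    have "\<theta> [J p (rscale a \<xi> + rscale b \<eta>)] = of_real a * \<theta> [J p \<xi>] + of_real b * \<theta> [J p \<eta>]"
      unfolding J_lin[OF T]
      using multilinearD[OF kformD(2)[OF k] J_T[OF T(1)] J_T[OF T(2)], of "[]" a b "[]"] by simp
    then show "?K (us @ (rscale a \<xi> + rscale b \<eta>) # vs) = of_real a * ?K (us @ \<xi> # vs) + of_real b * ?K (us @ \<eta> # vs)"
      by (cases us; cases vs) (auto split: list.split)
  qed
  have w: "\<theta> [J p (w i)] = c * \<theta> [w i]" if i: "i \<in> {1..n}" for i
  proof -
    have "- v i = rscale (-1) (v i) + rscale 0 (v i)" by (simp add: rscale_def fun_eq_iff)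
    then have "\<theta> [- v i] = - \<theta> [v i]"
      using multilinearD[OF kformD(2)[OF k] frame_T(1)[OF i] frame_T(1)[OF i], of "[]" "-1" 0 "[]"] by simp
    then show ?thesis
      using Jw[OF i] v[OF i] c by (metis minus_mult_left mult.assoc mult_1)
  qed
  have "\<theta> [J p x] = ?K ([] @ x # [])" by simp
  also have "\<dots> = (\<Sum>i=1..n. of_real (v' i x) * ?K ([] @ v i # []) + of_real (w' i x) * ?K ([] @ w i # []))"
    by (rule multilinear_expand[OF K x])
  also have "\<dots> = (\<Sum>i=1..n. c * (of_real (v' i x) * \<theta> ([] @ v i # []) + of_real (w' i x) * \<theta> ([] @ w i # [])))"
    by (rule sum.cong) (use v w Jv in \<open>auto simp: algebra_simps\<close>)
  also have "\<dots> = c * \<theta> ([] @ x # [])"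
    unfolding sum_distrib_left[symmetric] multilinear_expand[OF kformD(2)[OF k] x] ..
  finally show ?thesis by simp
qed

lemma phi_kform: "i \<in> {1..n} \<Longrightarrow> kform T 1 (phi i)"
  and phib_kform: "i \<in> {1..n} \<Longrightarrow> kform T 1 (phib i)"
proof -
  assume i: "i \<in> {1..n}"
  show "kform T 1 (phi i)"
    unfolding phi_def cotangent_C_iff[symmetric] using covec[OF i] by (rule complex_one_form_cotangent)
  have "real_covector A p (\<lambda>x. - w' i x)"
    using covec(2)[OF i] unfolding real_covector_def by simp
  then show "kform T 1 (phib i)"
    unfolding phib_def cotangent_C_iff[symmetric] using covec[OF i] by (intro complex_one_form_cotangent)
qed

lemma phi_Lambda10: "i \<in> {1..n} \<Longrightarrow> phi i \<in> Lambda10 A J p"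
  unfolding Lambda10_def cotangent_C_iff
  using one_form_J[OF phi_kform, of i \<i>] phi_kform dual frame_T by (auto simp: phi_apply)

lemma phib_Lambda01: "i \<in> {1..n} \<Longrightarrow> phib i \<in> Lambda01 A J p"
  unfolding Lambda01_def cotangent_C_iff
  using one_form_J[OF phib_kform, of i "- \<i>"] phib_kform dual frame_T by (auto simp: phib_apply)

lemma Lambda_gen:
  "set \<theta>s \<subseteq> Lambda10 A J p \<Longrightarrow> set \<eta>s \<subseteq> Lambda01 A J p \<Longrightarrow>
    wedges (\<theta>s @ \<eta>s) \<in> Lambda A J (length \<theta>s) (length \<eta>s) p"
  unfolding Lambda_def by (intro cfun.span_base) blast

lemma Lambda_subspace: "cfun.subspace (Lambda A J a b p)"
  unfolding Lambda_def by (rule cfun.subspace_span)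

lemma Lambda_induct:
  assumes "\<alpha> \<in> Lambda A J a b p" "cfun.subspace {\<alpha>. P \<alpha>}"
    and "\<And>\<theta>s \<eta>s. length \<theta>s = a \<Longrightarrow> set \<theta>s \<subseteq> Lambda10 A J p \<Longrightarrow> length \<eta>s = b \<Longrightarrow>
      set \<eta>s \<subseteq> Lambda01 A J p \<Longrightarrow> P (wedges (\<theta>s @ \<eta>s))"
  shows "P \<alpha>"
proof -
  have "Lambda A J a b p \<subseteq> {\<alpha>. P \<alpha>}"
    unfolding Lambda_def by (rule cfun.span_minimal[OF _ assms(2)]) (use assms(3) in auto)
  then show ?thesis using assms(1) by blast
qed

lemma Lambda_kform: "\<alpha> \<in> Lambda A J a b p \<Longrightarrow> kform T (a + b) \<alpha>"
proof (erule Lambda_induct)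
  show "cfun.subspace {\<alpha>. kform T (a + b) \<alpha>}"
    by (auto simp: cfun.subspace_def kform_0 kform_add kform_scale)
  fix \<theta>s \<eta>s assume *: "length \<theta>s = a" "set \<theta>s \<subseteq> Lambda10 A J p" "length \<eta>s = b" "set \<eta>s \<subseteq> Lambda01 A J p"
  have "kform T (length (\<theta>s @ \<eta>s)) (wedges (\<theta>s @ \<eta>s))"
    by (rule kform_wedges) (use * in \<open>auto simp: Lambda10_def Lambda01_def cotangent_C_iff subset_iff\<close>)
  then show "kform T (a + b) (wedges (\<theta>s @ \<eta>s))" using * by simp
qed

section \<open>The decomposition into types: uniqueness, then existence\<close>

lemma Lambda_der:
  "\<alpha> \<in> Lambda A J a b p \<Longrightarrow> set xs \<subseteq> T \<Longrightarrow> der (J p) xs \<alpha> = \<i> * (of_nat a - of_nat b) * \<alpha> xs"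
proof (erule Lambda_induct)
  show "cfun.subspace {\<alpha>. der (J p) xs \<alpha> = \<i> * (of_nat a - of_nat b) * \<alpha> xs}"
    unfolding cfun.subspace_def
  proof (safe)
    show "der (J p) xs 0 = \<i> * (of_nat a - of_nat b) * 0 xs"
      using der_0[of "J p" xs] by (simp add: zero_fun_def)
    fix \<alpha> \<beta> :: "('a, 'e) ctensor" and c
    assume *: "der (J p) xs \<alpha> = \<i> * (of_nat a - of_nat b) * \<alpha> xs" "der (J p) xs \<beta> = \<i> * (of_nat a - of_nat b) * \<beta> xs"
    have "der (J p) xs (\<alpha> + \<beta>) = der (J p) xs \<alpha> + der (J p) xs \<beta>"
      using der_lincomb[of "J p" xs 1 \<alpha> 1 \<beta>] by (simp add: plus_fun_def)
    then show "der (J p) xs (\<alpha> + \<beta>) = \<i> * (of_nat a - of_nat b) * (\<alpha> + \<beta>) xs"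
      using * by (simp add: algebra_simps)
  next
    fix \<alpha> :: "('a, 'e) ctensor" and c
    assume *: "der (J p) xs \<alpha> = \<i> * (of_nat a - of_nat b) * \<alpha> xs"
    then show "der (J p) xs (cscale c \<alpha>) = \<i> * (of_nat a - of_nat b) * cscale c \<alpha> xs"
      using der_scale[of "J p" xs c \<alpha>] by (simp add: cscale_def)
  qed
next
  fix \<theta>s \<eta>s assume xs: "set xs \<subseteq> T"
    and *: "length \<theta>s = a" "set \<theta>s \<subseteq> Lambda10 A J p" "length \<eta>s = b" "set \<eta>s \<subseteq> Lambda01 A J p"
  have 1: "der (J p) xs (wedges \<eta>s) = (of_nat (length \<eta>s) * - \<i> + 0) * wedges \<eta>s xs" if "set xs \<subseteq> T" for xs
    using der_wedges_append[of \<eta>s T "J p" "- \<i>" "[]" 0 xs, unfolded append_Nil2 der_wedges_Nil] that *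
    by (auto simp: Lambda01_def)
  have "der (J p) xs (wedges (\<theta>s @ \<eta>s))
      = (of_nat (length \<theta>s) * \<i> + (of_nat (length \<eta>s) * - \<i> + 0)) * wedges (\<theta>s @ \<eta>s) xs"
    by (rule der_wedges_append[OF _ 1 xs]) (use * in \<open>auto simp: Lambda10_def\<close>)
  then show "der (J p) xs (wedges (\<theta>s @ \<eta>s)) = \<i> * (of_nat a - of_nat b) * wedges (\<theta>s @ \<eta>s) xs"
    using * by (simp add: algebra_simps)
qed

text \<open>Applying the derivation r times to the vanishing sum multiplies the i-th component by
  the r-th power of its eigenvalue. The eigenvalues \<i> (2 i - k) are pairwise distinct, so
  \<open>sum_eigenvalues_0\<close> applies.\<close>

lemma type_unique_0:
  assumes g: "\<And>i. i \<le> k \<Longrightarrow> g i \<in> Lambda A J i (k - i) p" and sum: "(\<Sum>i\<le>k. g i) = 0" and j: "j \<le> k"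
  shows "g j = 0"
proof
  fix xs
  define \<mu> :: "nat \<Rightarrow> complex" where "\<mu> i = \<i> * (of_nat i - of_nat (k - i))" for i
  have inj: "inj_on \<mu> {..k}"
    by (auto simp: inj_on_def \<mu>_def of_nat_diff)
  show "g j xs = 0 xs"
  proof (cases "set xs \<subseteq> T")
    case False
    then show ?thesis using kformD(6)[OF Lambda_kform[OF g[OF j]]] by simp
  next
    case True
    have "(\<Sum>i\<le>k. \<mu> i ^ r * g i xs) = 0" if "set xs \<subseteq> T" for r xs
      using that
    proof (induction r arbitrary: xs)
      case 0
      have "(\<Sum>i\<le>k. g i xs) = (\<Sum>i\<le>k. g i) xs" by (simp add: sum_fun_apply)
      then show ?case using sum by simp
    next
      case (Suc r)
      have "(\<Sum>i\<le>k. \<mu> i ^ Suc r * g i xs) = (\<Sum>i\<le>k. \<mu> i ^ r * der (J p) xs (g i))"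
      proof (rule sum.cong)
        fix i assume "i \<in> {..k}"
        then have "der (J p) xs (g i) = \<mu> i * g i xs"
          using Lambda_der[OF g Suc.prems] by (simp add: \<mu>_def)
        then show "\<mu> i ^ Suc r * g i xs = \<mu> i ^ r * der (J p) xs (g i)" by simp
      qed simp
      also have "\<dots> = der (J p) xs (\<lambda>ys. \<Sum>i\<le>k. \<mu> i ^ r * g i ys)"
        by (simp add: der_sum der_scale)
      \<comment> \<open>The induction hypothesis concerns lists in T only; that is enough because J
        preserves T.\<close>
      also have "\<dots> = der (J p) xs (\<lambda>ys. 0)"
        by (rule der_cong[of _ T]) (use J_T Suc in auto)
      finally show ?case by (simp add: der_0)
    qed
    from sum_eigenvalues_0[where \<mu>=\<mu> and k=k and h="\<lambda>i. g i xs", OF this[OF True] inj j] show ?thesis by simp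
  qed
qed

text \<open>Evaluates the definite description from any explicit decomposition; uniqueness is
  applied to the difference of two of them.\<close>

lemma type_component_eq:
  assumes g: "\<And>i. i \<le> a + b \<Longrightarrow> g i \<in> Lambda A J i (a + b - i) p" and sum: "\<beta> = (\<Sum>i\<le>a + b. g i)"
  shows "type_component A J a b p \<beta> = g a"
  unfolding type_component_def
proof (rule the_equality)
  show "\<exists>g'. (\<forall>i\<le>a + b. g' i \<in> Lambda A J i (a + b - i) p) \<and> \<beta> = (\<Sum>i\<le>a + b. g' i) \<and> g a = g' a"
    using g sum by blast
  fix \<gamma> assume "\<exists>g'. (\<forall>i\<le>a + b. g' i \<in> Lambda A J i (a + b - i) p) \<and> \<beta> = (\<Sum>i\<le>a + b. g' i) \<and> \<gamma> = g' a"
  then obtain g' where g': "\<And>i. i \<le> a + b \<Longrightarrow> g' i \<in> Lambda A J i (a + b - i) p" "\<beta> = (\<Sum>i\<le>a + b. g' i)" "\<gamma> = g' a"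
    by blast
  define h where "h i = g' i - g i" for i
  have "h a = 0"
  proof (rule type_unique_0[of "a + b"])
    show "h i \<in> Lambda A J i (a + b - i) p" if "i \<le> a + b" for i
      unfolding h_def by (intro cfun.subspace_diff Lambda_subspace g g' that)
    show "(\<Sum>i\<le>a + b. h i) = 0"
      unfolding h_def sum_subtractf using g'(2) sum by simp
  qed simp
  then show "\<gamma> = g a" using g'(3) by (simp add: h_def)
qed

lemma Lambda_wedge10:
  assumes \<theta>: "\<theta> \<in> Lambda10 A J p"
  shows "\<gamma> \<in> Lambda A J a b p \<Longrightarrow> wedge1 \<theta> \<gamma> \<in> Lambda A J (Suc a) b p"
proof (erule Lambda_induct)
  show "cfun.subspace {\<gamma>. wedge1 \<theta> \<gamma> \<in> Lambda A J (Suc a) b p}"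
    using Lambda_subspace[of "Suc a" b]
    by (auto simp: cfun.subspace_def wedge1_add_right wedge1_scale_right)
  fix \<theta>s \<eta>s assume "length \<theta>s = a" "set \<theta>s \<subseteq> Lambda10 A J p" "length \<eta>s = b" "set \<eta>s \<subseteq> Lambda01 A J p"
  then show "wedge1 \<theta> (wedges (\<theta>s @ \<eta>s)) \<in> Lambda A J (Suc a) b p"
    using Lambda_gen[of "\<theta> # \<theta>s" \<eta>s] \<theta> by (simp add: wedges_Cons)
qed

lemma Lambda_wedge01:
  assumes \<eta>: "\<eta> \<in> Lambda01 A J p"
  shows "\<gamma> \<in> Lambda A J a b p \<Longrightarrow> wedge1 \<eta> \<gamma> \<in> Lambda A J a (Suc b) p"
proof (erule Lambda_induct)
  show "cfun.subspace {\<gamma>. wedge1 \<eta> \<gamma> \<in> Lambda A J a (Suc b) p}"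
    using Lambda_subspace[of a "Suc b"]
    by (auto simp: cfun.subspace_def wedge1_add_right wedge1_scale_right)
  fix \<theta>s \<eta>s assume "length \<theta>s = a" "set \<theta>s \<subseteq> Lambda10 A J p" "length \<eta>s = b" "set \<eta>s \<subseteq> Lambda01 A J p"
  then show "wedge1 \<eta> (wedges (\<theta>s @ \<eta>s)) \<in> Lambda A J a (Suc b) p"
    using Lambda_gen[of \<theta>s "\<eta> # \<eta>s"] \<eta> Lambda_subspace[of a "Suc b"]
    by (auto simp: wedge1_wedges_swap intro: cfun.subspace_scale)
qed

text \<open>With Z = (v - \<i> w) / 2 dual to \<phi>, this is \<phi>(\<xi>) \<beta>(Z) plus its
  conjugate counterpart equal to v'(\<xi>) \<beta>(v) + w'(\<xi>) \<beta>(w), up to a common sign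
  s.\<close>

lemma half_identity:
  fixes a b x y s :: complex
  shows "s * ((a + \<i> * b) * (1/2 * (x + - \<i> * y))) + s * ((a - \<i> * b) * (1/2 * (x + \<i> * y))) = s * (a * x + b * y)"
proof -
  \<comment> \<open>Naming 1/2 leaves \<open>algebra\<close> a polynomial identity with the
    relations 2 * h = 1 and \<i> * \<i> = -1.\<close>
  define h :: complex where "h = 1/2"
  have h: "h = 1/2" "2 * h = 1" unfolding h_def by simp_all
  have "\<i> * \<i> = -1" by simp
  with h(2) show ?thesis unfolding h(1)[symmetric] by algebra
qed

text \<open>Wedging each member of a coframe with the contraction by its dual vector and summing
  multiplies a form of degree k + 1 by k + 1. For the coframe \<open>phi\<close>,
  \<open>phib\<close> the contractions decompose by induction, and each wedge factor shifts the type
  in a known way.\<close>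

lemma type_decomposition:
  "kform T k \<beta> \<Longrightarrow> \<exists>g. (\<forall>i\<le>k. g i \<in> Lambda A J i (k - i) p) \<and> \<beta> = (\<Sum>i\<le>k. g i)"
proof (induction k arbitrary: \<beta>)
  case 0
  have "\<beta> = cscale (\<beta> []) (wedges [])"
    using kformD(5)[OF 0] by (auto simp: fun_eq_iff cscale_def)
  moreover have "cscale (\<beta> []) (wedges []) \<in> Lambda A J 0 0 p"
    using Lambda_gen[of "[]" "[]"] by (intro cfun.subspace_scale Lambda_subspace) simp
  ultimately have "\<beta> \<in> Lambda A J 0 0 p" by simp
  then show ?case by (intro exI[of _ "\<lambda>_. \<beta>"]) simp
next
  case (Suc k)
  let ?dec = "\<lambda>k \<beta>. \<exists>g. (\<forall>i\<le>k. g i \<in> Lambda A J i (k - i) p) \<and> \<beta> = (\<Sum>i\<le>k. g i)"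
  have dec_add: "?dec k (\<alpha> + \<beta>)" if dec: "?dec k \<alpha>" "?dec k \<beta>" for k \<alpha> \<beta>
  proof -
    obtain g h where "\<forall>i\<le>k. g i \<in> Lambda A J i (k - i) p" "\<alpha> = (\<Sum>i\<le>k. g i)"
      "\<forall>i\<le>k. h i \<in> Lambda A J i (k - i) p" "\<beta> = (\<Sum>i\<le>k. h i)"
      using dec by blast
    then show ?thesis
      using cfun.subspace_add[OF Lambda_subspace]
      by (intro exI[of _ "\<lambda>i. g i + h i"]) (simp add: sum.distrib del: plus_fun_apply)
  qed
  have dec_scale: "?dec k (cscale c \<alpha>)" if dec: "?dec k \<alpha>" for k c \<alpha>
  proof -
    obtain g where "\<forall>i\<le>k. g i \<in> Lambda A J i (k - i) p" "\<alpha> = (\<Sum>i\<le>k. g i)"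
      using dec by blast
    then show ?thesis
      using cfun.subspace_scale[OF Lambda_subspace]
      by (intro exI[of _ "\<lambda>i. cscale c (g i)"]) (simp add: cfun.scale_sum_right)
  qed
  have dec_0: "?dec k 0" for k
    using cfun.subspace_0[OF Lambda_subspace] by (intro exI[of _ "\<lambda>i. 0"]) (simp del: zero_fun_apply)
  have dec_sum: "?dec k (\<Sum>i\<in>I. f i)" if "finite I" "\<And>i. i \<in> I \<Longrightarrow> ?dec k (f i)" for k and I :: "nat set" and f
    using that
  proof (induction I rule: finite_induct)
    case empty
    show ?case unfolding sum.empty by (rule dec_0)
  next
    case (insert i I)
    have "?dec k (f i + (\<Sum>i\<in>I. f i))"
      by (rule dec_add) (use insert in auto)
    then show ?case unfolding sum.insert[OF insert.hyps] .
  qed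
  have wedge_sum: "wedge1 \<theta> (\<Sum>i\<le>k. g i) = (\<Sum>i\<le>k. wedge1 \<theta> (g i))" for \<theta> g and k :: nat
    by (induction k) (simp_all add: wedge1_add_right del: plus_fun_apply)
  have dec_phi: "?dec (Suc k) (wedge1 \<theta> \<gamma>)" if \<theta>: "\<theta> \<in> Lambda10 A J p" and dec: "?dec k \<gamma>" for \<theta> \<gamma>
  proof -
    obtain g where g: "\<forall>i\<le>k. g i \<in> Lambda A J i (k - i) p" "\<gamma> = (\<Sum>i\<le>k. g i)"
      using dec by blast
    \<comment> \<open>A (1,0)-factor raises the first index by one, so component 0 is empty.\<close>
    define h where "h i = (case i of 0 \<Rightarrow> 0 | Suc i \<Rightarrow> wedge1 \<theta> (g i))" for i
    have "\<forall>i\<le>Suc k. h i \<in> Lambda A J i (Suc k - i) p"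
      using g(1) Lambda_wedge10[OF \<theta>] cfun.subspace_0[OF Lambda_subspace]
      unfolding h_def by (auto split: nat.split simp del: zero_fun_apply)
    moreover have "wedge1 \<theta> \<gamma> = (\<Sum>i\<le>Suc k. h i)"
      unfolding sum.atMost_Suc_shift g(2) wedge_sum by (simp add: h_def del: zero_fun_apply plus_fun_apply)
    ultimately show ?thesis by blast
  qed
  have dec_phib: "?dec (Suc k) (wedge1 \<eta> \<gamma>)" if \<eta>: "\<eta> \<in> Lambda01 A J p" and dec: "?dec k \<gamma>" for \<eta> \<gamma>
  proof -
    obtain g where g: "\<forall>i\<le>k. g i \<in> Lambda A J i (k - i) p" "\<gamma> = (\<Sum>i\<le>k. g i)"
      using dec by blast
    \<comment> \<open>A (0,1)-factor keeps the first index, so the top component is empty.\<close>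
    define h where "h i = (if i = Suc k then 0 else wedge1 \<eta> (g i))" for i
    have "\<forall>i\<le>Suc k. h i \<in> Lambda A J i (Suc k - i) p"
      using g(1) Lambda_wedge01[OF \<eta>] cfun.subspace_0[OF Lambda_subspace]
      unfolding h_def by (auto simp: le_Suc_eq Suc_diff_le simp del: zero_fun_apply)
    moreover have "wedge1 \<eta> \<gamma> = (\<Sum>i\<le>Suc k. h i)"
      unfolding g(2) wedge_sum by (simp add: h_def del: zero_fun_apply plus_fun_apply)
    ultimately show ?thesis by blast
  qed
  define U where "U i = (\<lambda>ys. \<beta> (v i # ys))" for i
  define V where "V i = (\<lambda>ys. \<beta> (w i # ys))" for i
  \<comment> \<open>Contractions with the vectors (v_i - \<i> w_i) / 2 and (v_i + \<i> w_i) / 2,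
    dual to \<open>phi\<close> and \<open>phib\<close>; this is \<open>Suc k\<close> times
    \<beta>.\<close>
  define \<beta>' where "\<beta>' = (\<Sum>i=1..n. wedge1 (phi i) (cscale (1/2) (U i + cscale (- \<i>) (V i)))
      + wedge1 (phib i) (cscale (1/2) (U i + cscale \<i> (V i))))"
  have UV: "?dec k (U i)" "?dec k (V i)" for i
    unfolding U_def V_def by (intro Suc.IH kform_interior Suc.prems)+
  have "?dec (Suc k) \<beta>'"
    unfolding \<beta>'_def
    by (intro dec_sum dec_add dec_phi dec_phib phi_Lambda10 phib_Lambda01 dec_scale UV) simp_all
  then have "?dec (Suc k) (cscale (1 / of_nat (Suc k)) \<beta>')"
    by (rule dec_scale)
  moreover have "cscale (1 / of_nat (Suc k)) \<beta>' = \<beta>"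
  proof
    fix xs
    have k1: "kform T (Suc k) \<beta>'"
      unfolding \<beta>'_def U_def V_def
      by (intro kform_sum kform_add kform_wedge1 kform_scale kform_interior Suc.prems phi_kform phib_kform) simp_all
    show "cscale (1 / of_nat (Suc k)) \<beta>' xs = \<beta> xs"
    proof (cases "length xs = Suc k \<and> set xs \<subseteq> T")
      case False
      then have "\<beta>' xs = 0" "\<beta> xs = 0"
        using kformD(5,6)[OF k1, of xs] kformD(5,6)[OF Suc.prems, of xs] by blast+
      then show ?thesis by (simp add: cscale_def)
    next
      case True
      define rest where "rest i = omit i xs" for i
      have "\<beta>' xs = (\<Sum>j=1..n. \<Sum>i<length xs. (-1) ^ i *
          (of_real (v' j (xs ! i)) * \<beta> (v j # rest i) + of_real (w' j (xs ! i)) * \<beta> (w j # rest i)))"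
        unfolding \<beta>'_def sum_fun_apply
      proof (rule sum.cong)
        fix j
        show "(wedge1 (phi j) (cscale (1/2) (U j + cscale (- \<i>) (V j)))
            + wedge1 (phib j) (cscale (1/2) (U j + cscale \<i> (V j)))) xs = (\<Sum>i<length xs. (-1) ^ i *
          (of_real (v' j (xs ! i)) * \<beta> (v j # rest i) + of_real (w' j (xs ! i)) * \<beta> (w j # rest i)))"
          unfolding plus_fun_apply[of "wedge1 _ _" "wedge1 _ _" xs] wedge1_sum sum.distrib[symmetric]
        proof (rule sum.cong)
          fix i assume "i \<in> {..<length xs}"
          then have "xs ! i \<in> T" using True by auto
          then show "(-1) ^ i * (phi j [xs ! i] * cscale (1/2) (U j + cscale (- \<i>) (V j)) (omit i xs)) +
              (-1) ^ i * (phib j [xs ! i] * cscale (1/2) (U j + cscale \<i> (V j)) (omit i xs)) =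
              (-1) ^ i * (of_real (v' j (xs ! i)) * \<beta> (v j # rest i) + of_real (w' j (xs ! i)) * \<beta> (w j # rest i))"
            unfolding U_def V_def rest_def cscale_def plus_fun_apply phi_apply[OF \<open>xs ! i \<in> T\<close>] phib_apply[OF \<open>xs ! i \<in> T\<close>]
            using half_identity by simp
        qed simp
      qed simp
      also have "\<dots> = (\<Sum>i<length xs. (-1) ^ i * \<beta> (xs ! i # rest i))"
      proof (subst sum.swap, rule sum.cong)
        fix i assume "i \<in> {..<length xs}"
        then have "xs ! i \<in> T" using True by auto
        from multilinear_expand[OF kformD(2)[OF Suc.prems] this, of "[]" "rest i"]
        show "(\<Sum>j=1..n. (-1) ^ i * (of_real (v' j (xs ! i)) * \<beta> (v j # rest i) + of_real (w' j (xs ! i)) * \<beta> (w j # rest i)))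
            = (-1) ^ i * \<beta> (xs ! i # rest i)"
          by (simp add: sum_distrib_left)
      qed simp
      \<comment> \<open>Moving the i-th argument back to its place costs the sign (-1) ^ i, so each
        of the k + 1 positions contributes \<beta> xs.\<close>
      also have "\<dots> = (\<Sum>i<length xs. \<beta> xs)"
      proof (rule sum.cong)
        fix i assume "i \<in> {..<length xs}"
        then have i: "i < length xs" by simp
        have "\<beta> xs = \<beta> (take i xs @ xs ! i # drop (Suc i) xs)"
          using id_take_nth_drop[OF i] by simp
        also have "\<dots> = (-1) ^ i * \<beta> (xs ! i # rest i)"
          using alternating_move[OF kformD(1)[OF Suc.prems], of "take i xs"] i by (simp add: rest_def)
        finally show "(-1) ^ i * \<beta> (xs ! i # rest i) = \<beta> xs" by simp
      qed simp
      finally show ?thesis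
        using True by (simp add: cscale_def del: of_nat_Suc)
    qed
  qed
  ultimately show ?case by (simp only:)
qed

end

context complex_frame
begin

section \<open>The canonical line\<close>

lemma Lambda_n0_complex_linear:
  "\<alpha> \<in> Lambda A J a 0 p \<Longrightarrow> complex_linear (J p) T \<alpha>"
proof (erule Lambda_induct)
  show "cfun.subspace {\<alpha>. complex_linear (J p) T \<alpha>}"
    unfolding cfun.subspace_def complex_linear_def
    by (auto simp: cscale_def algebra_simps)
  fix \<theta>s \<eta>s :: "('a, 'e) ctensor list" assume "length \<theta>s = a" "set \<theta>s \<subseteq> Lambda10 A J p" "length \<eta>s = 0"
  have "complex_linear (J p) T (wedges \<theta>s)"
    using \<open>set \<theta>s \<subseteq> Lambda10 A J p\<close>
  proof (induction \<theta>s)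
    case Nil
    then show ?case by (simp add: complex_linear_def)
  next
    case (Cons \<theta> \<theta>s)
    have k: "kform T 1 \<theta>" and J: "\<And>x. x \<in> T \<Longrightarrow> \<theta> [J p x] = \<i> * \<theta> [x]"
      using Cons.prems by (auto simp: Lambda10_def cotangent_C_iff)
    have "complex_linear (J p) T \<theta>"
      unfolding complex_linear_def
    proof (intro allI impI)
      fix us x vs assume "x \<in> T"
      then show "\<theta> (us @ J p x # vs) = \<i> * \<theta> (us @ x # vs)"
        using J kformD(5)[OF k] by (cases "us = [] \<and> vs = []") auto
    qed
    then show ?case
      using Cons by (simp add: wedges_Cons complex_linear_wedge1)
  qed
  then show "complex_linear (J p) T (wedges (\<theta>s @ \<eta>s))"
    using \<open>length \<eta>s = 0\<close> by simp
qed

text \<open>The reason why the (n,0)-forms are a line: complex linearity trades w_i for \<i> v_i, so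
  only lists of v_i matter; repetitions give 0, and n distinct ones are a permutation of
  \<open>vs\<close>.\<close>

lemma complex_linear_zero:
  assumes k: "kform T n \<delta>" and J: "complex_linear (J p) T \<delta>" and v: "\<delta> vs = 0"
  shows "\<delta> = 0"
proof
  fix xs
  have frame: "\<delta> (map v is) = 0" if "set is \<subseteq> {1..n}" for "is"
  proof (cases "distinct is \<and> length is = n")
    case False
    then show ?thesis
      using alternating_not_distinct[OF kformD(1)[OF k], of "map v is"] kformD(5)[OF k, of "map v is"]
      by (auto simp: distinct_map)
  next
    case True
    then have "card (set is) = n" using distinct_card by blast
    then have "set is = {1..n}" using that by (intro card_subset_eq) auto
    then have "set is = set [1..<Suc n]"
      by (simp only: set_upt atLeastLessThanSuc_atLeastAtMost)
    then have "mset is = mset [1..<Suc n]"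
      using set_eq_iff_mset_eq_distinct[of "is" "[1..<Suc n]"] True distinct_upt by blast
    then have "mset (map v is) = mset vs" by (simp only: mset_map)
    then show ?thesis
      using alternating_perm[OF kformD(1)[OF k]] v by blast
  qed
  \<comment> \<open>Arguments are expanded in the frame from left to right; \<open>is\<close>
    records those already replaced.\<close>
  have "\<delta> (map v is @ xs) = 0" if "set is \<subseteq> {1..n}" for "is" xs
    using that
  proof (induction xs arbitrary: "is")
    case Nil
    then show ?case using frame by simp
  next
    case (Cons x xs)
    show ?case
    proof (cases "x \<in> T")
      case False
      then have "\<not> set (map v is @ x # xs) \<subseteq> T" by auto
      then show ?thesis by (rule kformD(6)[OF k])
    next
      case True
      have "\<delta> (map v is @ v i # xs) = 0 \<and> \<delta> (map v is @ w i # xs) = 0" if i: "i \<in> {1..n}" for i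
        using Cons.IH[of "is @ [i]"] Cons.prems i complex_linearD[OF J frame_T(1)[OF i], of "map v is" xs] Jv[OF i]
        by simp
      then show ?thesis
        unfolding multilinear_expand[OF kformD(2)[OF k] True] by (intro sum.neutral) simp
    qed
  qed
  from this[of "[]" xs] show "\<delta> xs = 0 xs" by simp
qed

text \<open>A \<open>phi i\<close> vanishes on all v_j with j \<noteq> i, so only the leading term
  of \<open>wedge1_Cons\<close> survives. The value 1 makes \<alpha> vs the coefficient of \<alpha>
  with respect to \<open>psi\<close>.\<close>

lemma wedges_phi_vs: "distinct is \<Longrightarrow> set is \<subseteq> {1..n} \<Longrightarrow> wedges (map phi is) (map v is) = 1"
proof (induction "is")
  case (Cons i "is")
  have "wedge1 (phi i) \<gamma> (map v is) = 0" for \<gamma>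
    unfolding wedge1_sum
  proof (rule sum.neutral, intro ballI)
    fix j assume "j \<in> {..<length (map v is)}"
    then have j: "is ! j \<in> set is" "map v is ! j = v (is ! j)" by auto
    then have "is ! j \<in> {1..n}" "is ! j \<noteq> i"
      using Cons.prems by (meson distinct.simps(2) list.set_intros(2) subsetD, metis distinct.simps(2))
    then have "phi i [map v is ! j] = 0"
      using Cons.prems frame_T dual j(2) by (auto simp: phi_apply)
    then show "(-1) ^ j * (phi i [map v is ! j] * \<gamma> (take j (map v is) @ drop (Suc j) (map v is))) = 0"
      by simp
  qed
  moreover have "phi i [v i] = 1"
    using Cons.prems frame_T dual by (simp add: phi_apply)
  ultimately show ?case
    using Cons by (simp add: wedges_Cons wedge1_Cons)
qed simp

lemma psi_vs: "psi vs = 1"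
  unfolding psi_def by (rule wedges_phi_vs) auto

lemma psi_Lambda: "psi \<in> Lambda A J n 0 p"
proof -
  have "set (map phi [1..<Suc n]) \<subseteq> Lambda10 A J p"
    using phi_Lambda10 by auto
  from Lambda_gen[OF this, of "[]"] show ?thesis by (simp add: psi_def)
qed

lemma psi_kform: "kform T n psi"
  using Lambda_kform[OF psi_Lambda] by simp

lemma Lambda_n0_eq:
  assumes \<alpha>: "\<alpha> \<in> Lambda A J n 0 p"
  shows "\<alpha> = cscale (\<alpha> vs) psi"
proof -
  have "\<alpha> - cscale (\<alpha> vs) psi \<in> Lambda A J n 0 p"
    by (intro cfun.subspace_diff cfun.subspace_scale Lambda_subspace \<alpha> psi_Lambda)
  from complex_linear_zero[OF _ Lambda_n0_complex_linear[OF this]] Lambda_kform[OF this]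
  have "\<alpha> - cscale (\<alpha> vs) psi = 0"
    using psi_vs by (simp add: cscale_def)
  then show ?thesis by simp
qed

section \<open>Inverting the wedge product with psi\<close>

lemma one_form_eqI:
  assumes "kform T 1 \<eta>" "kform T 1 \<eta>'" "\<And>x. x \<in> T \<Longrightarrow> \<eta> [x] = \<eta>' [x]"
  shows "\<eta> = \<eta>'"
proof
  fix xs
  show "\<eta> xs = \<eta>' xs"
  proof (cases "length xs = 1 \<and> set xs \<subseteq> T")
    case True
    then show ?thesis using assms(3) by (auto simp: length_Suc_conv)
  next
    case False
    then show ?thesis using kformD(5,6)[OF assms(1)] kformD(5,6)[OF assms(2)] by metis
  qed
qed

text \<open>\<eta> can be read off from its product with \<open>psi\<close>. Contracting
  \<open>psi\<close> with w_j gives \<i> times the contraction with v_j, whereas \<eta> takes the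
  factor - \<i>; in the combination \<open>val\<close> the contraction terms cancel and \<eta> [v j]
  doubles.\<close>

lemma wedge1_psi_inj:
  assumes \<eta>: "\<eta> \<in> Lambda01 A J p" "\<eta>' \<in> Lambda01 A J p" and eq: "wedge1 \<eta> psi = wedge1 \<eta>' psi"
  shows "\<eta> = \<eta>'"
proof -
  have w: "\<eta> [w j] = - \<i> * \<eta> [v j]" if "\<eta> \<in> Lambda01 A J p" "j \<in> {1..n}" for \<eta> j
    using that frame_T(1)[of j] Jv[of j] unfolding Lambda01_def by auto
  have val: "2 * \<eta> [v j] = wedge1 \<eta> psi (v j # vs) + \<i> * wedge1 \<eta> psi (w j # vs)"
    if \<eta>: "\<eta> \<in> Lambda01 A J p" and j: "j \<in> {1..n}" for \<eta> j
  proof -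
    have "(\<lambda>ys. psi (w j # ys)) = (\<lambda>ys. \<i> * psi (v j # ys))"
      using complex_linearD[OF Lambda_n0_complex_linear[OF psi_Lambda] frame_T(1)[OF j], of "[]"] Jv[OF j]
      by simp
    then have 1: "wedge1 \<eta> psi (w j # vs) = \<eta> [w j] - \<i> * wedge1 \<eta> (\<lambda>ys. psi (v j # ys)) vs"
      unfolding wedge1_Cons psi_vs by (simp add: wedge1_scale)
    have 2: "wedge1 \<eta> psi (v j # vs) = \<eta> [v j] - wedge1 \<eta> (\<lambda>ys. psi (v j # ys)) vs"
      unfolding wedge1_Cons psi_vs by simp
    show ?thesis unfolding 1 2 w[OF \<eta> j] by (simp add: algebra_simps)
  qed
  have k: "kform T 1 \<eta>" "kform T 1 \<eta>'"
    using \<eta> by (auto simp: Lambda01_def cotangent_C_iff)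
  have vw: "\<eta> [v j] = \<eta>' [v j] \<and> \<eta> [w j] = \<eta>' [w j]" if j: "j \<in> {1..n}" for j
  proof -
    have "2 * \<eta> [v j] = 2 * \<eta>' [v j]"
      unfolding val[OF \<eta>(1) j] val[OF \<eta>(2) j] eq ..
    then have "\<eta> [v j] = \<eta>' [v j]" by simp
    then show ?thesis
      using w[OF \<eta>(1) j] w[OF \<eta>(2) j] by simp
  qed
  show ?thesis
  proof (rule one_form_eqI[OF k])
    fix x assume x: "x \<in> T"
    have "\<eta> ([] @ x # []) = \<eta>' ([] @ x # [])"
      unfolding multilinear_expand[OF kformD(2)[OF k(1)] x] multilinear_expand[OF kformD(2)[OF k(2)] x]
      by (intro sum.cong) (use vw in simp_all)
    then show "\<eta> [x] = \<eta>' [x]" by simp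
  qed
qed

lemma Lambda01_subspace: "cfun.subspace (Lambda01 A J p)"
  unfolding cfun.subspace_def
proof (safe)
  show "0 \<in> Lambda01 A J p" by (simp add: Lambda01_def cotangent_C_iff kform_0)
  fix \<eta> \<eta>' assume "\<eta> \<in> Lambda01 A J p" "\<eta>' \<in> Lambda01 A J p"
  then show "\<eta> + \<eta>' \<in> Lambda01 A J p"
    unfolding Lambda01_def cotangent_C_iff by (auto intro: kform_add simp: algebra_simps)
next
  fix \<eta> c assume "\<eta> \<in> Lambda01 A J p"
  then show "cscale c \<eta> \<in> Lambda01 A J p"
    using kform_scale[of T 1 \<eta> c] unfolding Lambda01_def cotangent_C_iff by (auto simp: cscale_def)
qed

abbreviation "W01 \<equiv> cfun.span {tprod 1 \<eta> \<sigma> | \<eta> \<sigma>. \<eta> \<in> Lambda01 A J p \<and> \<sigma> \<in> Lambda A J n 0 p}"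

text \<open>As the (n,0)-forms are multiples of \<open>psi\<close>, the span in
  \<open>dbar_canonical\<close> consists of pure tensors, and injectivity of
  \<open>wedge_map\<close> on it is \<open>wedge1_psi_inj\<close>.\<close>

lemma W01_eq: "W01 = {tprod 1 \<eta> psi | \<eta>. \<eta> \<in> Lambda01 A J p}" (is "_ = ?R")
proof
  show "?R \<subseteq> W01"
    using psi_Lambda by (blast intro: cfun.span_base)
  have "cfun.subspace ?R"
    unfolding cfun.subspace_def
  proof (safe)
    have "tprod 1 0 psi = 0" by (simp add: tprod_def fun_eq_iff)
    then show "\<exists>\<eta>. 0 = tprod 1 \<eta> psi \<and> \<eta> \<in> Lambda01 A J p"
      using cfun.subspace_0[OF Lambda01_subspace] by metis
  next
    fix \<eta> \<eta>' assume *: "\<eta> \<in> Lambda01 A J p" "\<eta>' \<in> Lambda01 A J p"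
    have "tprod 1 \<eta> psi + tprod 1 \<eta>' psi = tprod 1 (\<eta> + \<eta>') psi"
      by (simp add: tprod_def fun_eq_iff algebra_simps)
    then show "\<exists>\<eta>''. tprod 1 \<eta> psi + tprod 1 \<eta>' psi = tprod 1 \<eta>'' psi \<and> \<eta>'' \<in> Lambda01 A J p"
      using cfun.subspace_add[OF Lambda01_subspace *] by blast
  next
    fix \<eta> c assume *: "\<eta> \<in> Lambda01 A J p"
    have "cscale c (tprod 1 \<eta> psi) = tprod 1 (cscale c \<eta>) psi"
      by (simp add: tprod_def cscale_def fun_eq_iff)
    then show "\<exists>\<eta>'. cscale c (tprod 1 \<eta> psi) = tprod 1 \<eta>' psi \<and> \<eta>' \<in> Lambda01 A J p"
      using cfun.subspace_scale[OF Lambda01_subspace *] by blast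
  qed
  moreover have "tprod 1 \<eta> \<sigma> \<in> ?R" if "\<eta> \<in> Lambda01 A J p" "\<sigma> \<in> Lambda A J n 0 p" for \<eta> \<sigma>
  proof -
    have "tprod 1 \<eta> \<sigma> = tprod 1 (cscale (\<sigma> vs) \<eta>) psi"
      by (subst Lambda_n0_eq[OF that(2)]) (simp add: tprod_def cscale_def fun_eq_iff)
    then show ?thesis
      using cfun.subspace_scale[OF Lambda01_subspace that(1)] by blast
  qed
  ultimately show "W01 \<subseteq> ?R"
    by (intro cfun.span_minimal) blast+
qed

lemma inv_wedge_map:
  assumes "\<eta> \<in> Lambda01 A J p"
  shows "inv_into W01 wedge_map (wedge1 \<eta> psi) = tprod 1 \<eta> psi"
proof -
  have inj: "inj_on wedge_map W01"
    unfolding W01_eq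
  proof (rule inj_onI, clarify)
    fix \<eta> \<eta>' assume "\<eta> \<in> Lambda01 A J p" "\<eta>' \<in> Lambda01 A J p"
      "wedge_map (tprod 1 \<eta> psi) = wedge_map (tprod 1 \<eta>' psi)"
    then show "tprod 1 \<eta> psi = tprod 1 \<eta>' psi"
      using wedge1_psi_inj[of \<eta> \<eta>'] unfolding wedge1_def by blast
  qed
  have "tprod 1 \<eta> psi \<in> W01" unfolding W01_eq using assms by blast
  from inv_into_f_f[OF inj this] show ?thesis by (simp add: wedge1_def)
qed

text \<open>The projection of a complex 1-form onto the eigenvalue - \<i> of composition with
  J.\<close>

definition dbar_part :: "('a, 'e) ctensor \<Rightarrow> ('a, 'e) ctensor" where
  "dbar_part \<theta> = (\<lambda>xs. case xs of [x] \<Rightarrow> if x \<in> T then (\<theta> [x] + \<i> * \<theta> [J p x]) / 2 else 0 | _ \<Rightarrow> 0)"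

lemma dbar_part_Lambda01:
  assumes k: "kform T 1 \<theta>"
  shows "dbar_part \<theta> \<in> Lambda01 A J p" and "\<theta> - dbar_part \<theta> \<in> Lambda10 A J p"
proof -
  have ap: "dbar_part \<theta> [x] = (\<theta> [x] + \<i> * \<theta> [J p x]) / 2" if "x \<in> T" for x
    using that by (simp add: dbar_part_def)
  have minus: "\<theta> [- x] = - \<theta> [x]" if "x \<in> T" for x
  proof -
    have "- x = rscale (-1) x + rscale 0 x" by (simp add: rscale_def fun_eq_iff)
    then show ?thesis
      using multilinearD[OF kformD(2)[OF k] that that, of "[]" "-1" 0 "[]"] by simp
  qed
  have c: "dbar_part \<theta> \<in> cotangent_C A p"
    unfolding cotangent_C_def
  proof (intro CollectI conjI allI impI ballI)
    fix xs assume "dbar_part \<theta> xs \<noteq> 0"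
    then show "\<exists>\<xi>\<in>T. xs = [\<xi>]"
      by (auto simp: dbar_part_def split: list.splits if_splits)
  next
    fix \<xi> \<eta> and a b :: real assume T: "\<xi> \<in> T" "\<eta> \<in> T"
    show "dbar_part \<theta> [rscale a \<xi> + rscale b \<eta>] = of_real a * dbar_part \<theta> [\<xi>] + of_real b * dbar_part \<theta> [\<eta>]"
      unfolding ap[OF T_lin[OF T]] ap[OF T(1)] ap[OF T(2)] J_lin[OF T]
      using multilinearD[OF kformD(2)[OF k] T, of "[]" a b "[]"]
        multilinearD[OF kformD(2)[OF k] J_T[OF T(1)] J_T[OF T(2)], of "[]" a b "[]"]
      by (simp add: field_simps del: plus_fun_apply)
  qed
  have J: "dbar_part \<theta> [J p x] = - \<i> * dbar_part \<theta> [x]" if "x \<in> T" for x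
    using that by (simp add: ap J_T JJ minus field_simps)
  show "dbar_part \<theta> \<in> Lambda01 A J p"
    using c J by (simp add: Lambda01_def)
  have "kform T 1 (\<theta> + cscale (-1) (dbar_part \<theta>))"
    using c k unfolding cotangent_C_iff by (intro kform_add kform_scale)
  moreover have "\<theta> + cscale (-1) (dbar_part \<theta>) = \<theta> - dbar_part \<theta>"
    by (simp add: cscale_def fun_eq_iff)
  ultimately have "kform T 1 (\<theta> - dbar_part \<theta>)" by simp
  moreover have "(\<theta> - dbar_part \<theta>) [J p x] = \<i> * (\<theta> - dbar_part \<theta>) [x]" if "x \<in> T" for x
    using that by (simp add: ap J_T JJ minus field_simps)
  ultimately show "\<theta> - dbar_part \<theta> \<in> Lambda10 A J p"
    by (simp add: Lambda10_def cotangent_C_iff del: minus_apply)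
qed

text \<open>The (n,1)-part of \<theta> \<and> psi comes from the (0,1)-part of \<theta>, and that of
  d\<psi> is 0 by hypothesis. For non-integrable J, d\<psi> may have components of further types, so
  its whole decomposition is carried along.\<close>

lemma dbar_canonical_eq:
  assumes ds: "ext_deriv A s p = wedge1 \<theta> psi + cscale c (ext_deriv A \<psi> p)"
    and \<theta>: "kform T 1 \<theta>" and d\<psi>: "kform T (Suc n) (ext_deriv A \<psi> p)" and dbar: "dbar_form A J n 0 \<psi> p = 0"
  shows "dbar_canonical A J n s p = tprod 1 (dbar_part \<theta>) psi"
proof -
  obtain g where g: "\<forall>i\<le>Suc n. g i \<in> Lambda A J i (Suc n - i) p" "ext_deriv A \<psi> p = (\<Sum>i\<le>Suc n. g i)"
    using type_decomposition[OF d\<psi>] by blast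
  have "type_component A J n (Suc 0) p (ext_deriv A \<psi> p) = g n"
    by (rule type_component_eq) (use g in auto)
  then have gn: "g n = 0" using dbar by (simp add: dbar_form_def)
  define a where "a = wedge1 (dbar_part \<theta>) psi"
  define b where "b = wedge1 (\<theta> - dbar_part \<theta>) psi"
  have a: "a \<in> Lambda A J n (Suc 0) p"
    unfolding a_def by (rule Lambda_wedge01[OF dbar_part_Lambda01(1)[OF \<theta>] psi_Lambda])
  have b: "b \<in> Lambda A J (Suc n) 0 p"
    unfolding b_def by (rule Lambda_wedge10[OF dbar_part_Lambda01(2)[OF \<theta>] psi_Lambda])
  have ab: "wedge1 \<theta> psi = a + b"
    unfolding a_def b_def wedge1_add_left[symmetric] by simp
  \<comment> \<open>The types of ds: those of c d\<psi>, plus the two parts a and b of \<theta>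
    \<and> psi in types (n,1) and (n+1,0).\<close>
  define h where "h i = cscale c (g i) + (if i = n then a else if i = Suc n then b else 0)" for i
  have "type_component A J n (Suc 0) p (ext_deriv A s p) = h n"
  proof (rule type_component_eq)
    show "h i \<in> Lambda A J i (n + Suc 0 - i) p" if "i \<le> n + Suc 0" for i
    proof -
      have "cscale c (g i) \<in> Lambda A J i (n + Suc 0 - i) p"
        using g(1) that by (intro cfun.subspace_scale Lambda_subspace) simp
      moreover have "(if i = n then a else if i = Suc n then b else 0) \<in> Lambda A J i (n + Suc 0 - i) p"
        using a b cfun.subspace_0[OF Lambda_subspace] by simp
      ultimately show ?thesis
        unfolding h_def by (intro cfun.subspace_add Lambda_subspace)
    qed
    have "(\<Sum>i\<le>Suc n. if i = n then a else if i = Suc n then b else 0) = a + b"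
    proof -
      have "(\<Sum>i\<le>Suc n. if i = n then a else if i = Suc n then b else 0) =
        (\<Sum>i\<le>Suc n. if i = n then a else 0) + (\<Sum>i\<le>Suc n. if i = Suc n then b else 0)"
        unfolding sum.distrib[symmetric] by (rule sum.cong) auto
      then show ?thesis by (simp del: sum.atMost_Suc plus_fun_apply)
    qed
    then have "(\<Sum>i\<le>Suc n. h i) = cscale c (ext_deriv A \<psi> p) + (a + b)"
      unfolding h_def sum.distrib g(2) cfun.scale_sum_right by simp
    then show "ext_deriv A s p = (\<Sum>i\<le>n + Suc 0. h i)"
      unfolding ds ab by (simp add: add.commute del: plus_fun_apply sum.atMost_Suc)
  qed
  then have "dbar_form A J n 0 s p = wedge1 (dbar_part \<theta>) psi"
    using gn by (simp add: dbar_form_def h_def a_def del: plus_fun_apply)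
  then show ?thesis
    unfolding dbar_canonical_def using inv_wedge_map[OF dbar_part_Lambda01(1)[OF \<theta>]] by simp
qed

end

section \<open>Calculus in charts\<close>

locale smooth_manifold =
  fixes A :: "('a::{t2_space,second_countable_topology}, 'e::euclidean_space) chart set"
  assumes atlas: "smooth_atlas A"
begin

lemma chart_facts:
  assumes "c \<in> A"
  shows chart_open: "open (fst c)" and chart_image_open: "open (snd c ` fst c)"
    and chart_homeo: "homeomorphism (fst c) (snd c ` fst c) (snd c) (chart_inv c)"
  using atlas assms by (auto simp: smooth_atlas_def is_chart_def)

lemma chart_inv_chart [simp]: "c \<in> A \<Longrightarrow> q \<in> fst c \<Longrightarrow> chart_inv c (snd c q) = q"
  and chart_chart_inv [simp]: "c \<in> A \<Longrightarrow> x \<in> snd c ` fst c \<Longrightarrow> snd c (chart_inv c x) = x"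
  and chart_inv_in: "c \<in> A \<Longrightarrow> x \<in> snd c ` fst c \<Longrightarrow> chart_inv c x \<in> fst c"
  using chart_homeo[of c] by (auto simp: homeomorphism_def simp del: split_paired_All)

lemma charts_at_iff: "c \<in> charts_at A q \<longleftrightarrow> c \<in> A \<and> q \<in> fst c"
  by (auto simp: charts_at_def)

lemma charts_at_chart_inv: "c \<in> A \<Longrightarrow> x \<in> snd c ` fst c \<Longrightarrow> c \<in> charts_at A (chart_inv c x)"
  by (simp add: charts_at_iff chart_inv_in)

lemma charts_at_nonempty: obtains c where "c \<in> charts_at A q"
  using atlas unfolding smooth_atlas_def charts_at_iff by blast

lemma chart_image_of_open:
  assumes "c \<in> A" "open U"
  shows "open (snd c ` (fst c \<inter> U))"
proof -
  have "open (snd c ` fst c \<inter> chart_inv c -` U)"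
    using chart_homeo[OF assms(1)] chart_image_open[OF assms(1)] assms(2)
    by (intro continuous_open_preimage) (auto simp: homeomorphism_def)
  also have "snd c ` fst c \<inter> chart_inv c -` U = snd c ` (fst c \<inter> U)"
    using assms(1) by force
  finally show ?thesis .
qed

lemma eventually_chart:
  assumes "c \<in> charts_at A q" "open U" "q \<in> U"
  shows "open (snd c ` (fst c \<inter> U))" "snd c q \<in> snd c ` (fst c \<inter> U)"
    "\<And>x. x \<in> snd c ` (fst c \<inter> U) \<Longrightarrow> chart_inv c x \<in> U \<and> chart_inv c x \<in> fst c"
  using chart_image_of_open[of c U] assms by (auto simp: charts_at_iff)

section \<open>Changes of coordinates\<close>

lemma transition_has_derivative:
  assumes "c \<in> charts_at A q" "c' \<in> charts_at A q"
  shows "(snd c' \<circ> chart_inv c has_derivative FD (snd c' \<circ> chart_inv c) (snd c q)) (at (snd c q))"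
proof -
  have "smooth_on (snd c ` (fst c \<inter> fst c')) (snd c' \<circ> chart_inv c)"
    using atlas assms unfolding smooth_atlas_def charts_at_iff by blast
  then have "Ck_on (Suc 0) (snd c ` (fst c \<inter> fst c')) (snd c' \<circ> chart_inv c)"
    unfolding smooth_on_def by blast
  then show ?thesis
    by (rule Ck_on_Suc_has_derivative) (use assms in \<open>auto simp: charts_at_iff\<close>)
qed

lemma transition_linear:
  "c \<in> charts_at A q \<Longrightarrow> c' \<in> charts_at A q \<Longrightarrow> linear (FD (snd c' \<circ> chart_inv c) (snd c q))"
  using transition_has_derivative has_derivative_linear by blast

text \<open>One chain rule for two purposes: g a coordinate map gives the cocycle identity, g a
  function gives the chart independence of its differential.\<close>

lemma transition_compose:
  assumes c: "c \<in> charts_at A q" and c': "c' \<in> charts_at A q"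
    and g: "((\<lambda>x. g (chart_inv c' x)) has_derivative D) (at (snd c' q))"
  shows "((\<lambda>x. g (chart_inv c x)) has_derivative
    (\<lambda>e. D (FD (snd c' \<circ> chart_inv c) (snd c q) e))) (at (snd c q))"
proof -
  have o: "open (fst c')" "q \<in> fst c'" using c' chart_open by (auto simp: charts_at_iff)
  have A: "c \<in> A" "c' \<in> A" "q \<in> fst c" using c c' by (auto simp: charts_at_iff)
  have "((\<lambda>x. g (chart_inv c' x)) has_derivative D) (at ((snd c' \<circ> chart_inv c) (snd c q)))"
    using g A by simp
  from diff_chain_at[OF transition_has_derivative[OF c c'] this]
  have "((\<lambda>x. g (chart_inv c' x)) \<circ> (snd c' \<circ> chart_inv c) has_derivative
    (D \<circ> FD (snd c' \<circ> chart_inv c) (snd c q))) (at (snd c q))" .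
  from has_derivative_transform_within_open[OF this eventually_chart(1,2)[OF c o], of "\<lambda>x. g (chart_inv c x)"]
  show ?thesis
    using A eventually_chart(3)[OF c o] by (simp add: o_def)
qed

lemma transition_cocycle:
  assumes "c \<in> charts_at A q" "c' \<in> charts_at A q" "c'' \<in> charts_at A q"
  shows "FD (snd c'' \<circ> chart_inv c) (snd c q) e =
    FD (snd c'' \<circ> chart_inv c') (snd c' q)
      (FD (snd c' \<circ> chart_inv c) (snd c q) e)"
proof -
  have "((\<lambda>x. snd c'' (chart_inv c' x)) has_derivative
      FD (snd c'' \<circ> chart_inv c') (snd c' q)) (at (snd c' q))"
    using transition_has_derivative[OF assms(2,3)] by (simp add: o_def)
  from fun_cong[OF frechet_derivative_at[OF transition_compose[OF assms(1,2) this]], of e]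
  show ?thesis unfolding o_def by simp
qed

lemma transition_refl:
  assumes "c \<in> charts_at A q"
  shows "FD (snd c \<circ> chart_inv c) (snd c q) e = e"
proof -
  have c: "c \<in> A" "q \<in> fst c" using assms by (auto simp: charts_at_iff)
  have "((\<lambda>x. x) has_derivative (\<lambda>x. x)) (at (snd c q))" by simp
  from has_derivative_transform_within_open[OF this chart_image_open[OF c(1)], of "snd c \<circ> chart_inv c"]
  have "(snd c \<circ> chart_inv c has_derivative (\<lambda>x. x)) (at (snd c q))"
    using c by simp
  from frechet_derivative_at[OF this] show ?thesis by metis
qed

section \<open>Tangent vectors in coordinates\<close>

lemma chart_vec_chart: "c \<in> charts_at A q \<Longrightarrow> chart_vec A c q e c = e"
  by (simp add: chart_vec_def transition_refl)

lemma chart_vec_tangent: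
  assumes "c \<in> charts_at A q"
  shows "chart_vec A c q e \<in> tangent_space A q"
  unfolding tangent_space_def
proof (intro CollectI conjI allI impI ballI)
  fix c' c'' assume c': "c' \<in> charts_at A q" and c'': "c'' \<in> charts_at A q"
  show "chart_vec A c q e c'' =
      FD (snd c'' \<circ> chart_inv c') (snd c' q) (chart_vec A c q e c')"
    unfolding chart_vec_def if_P[OF c'] if_P[OF c''] by (rule transition_cocycle[OF assms c' c''])
qed (simp only: chart_vec_def if_False)

lemma tangent_spaceD:
  assumes "\<xi> \<in> tangent_space A q"
  shows "c \<notin> charts_at A q \<Longrightarrow> \<xi> c = 0"
    and "c \<in> charts_at A q \<Longrightarrow> c' \<in> charts_at A q \<Longrightarrow>
      \<xi> c' = FD (snd c' \<circ> chart_inv c) (snd c q) (\<xi> c)"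
  using assms unfolding tangent_space_def by blast+

lemma chart_vec_of_tangent:
  assumes "c \<in> charts_at A q" "\<xi> \<in> tangent_space A q"
  shows "chart_vec A c q (\<xi> c) = \<xi>"
proof
  fix c'
  show "chart_vec A c q (\<xi> c) c' = \<xi> c'"
  proof (cases "c' \<in> charts_at A q")
    case True
    show ?thesis
      unfolding chart_vec_def if_P[OF True] by (rule tangent_spaceD(2)[OF assms(2,1) True, symmetric])
  next
    case False
    show ?thesis
      unfolding chart_vec_def if_not_P[OF False] tangent_spaceD(1)[OF assms(2) False] ..
  qed
qed

lemma chart_vec_lin:
  assumes "c \<in> charts_at A q"
  shows "chart_vec A c q (a *\<^sub>R e + b *\<^sub>R f) = rscale a (chart_vec A c q e) + rscale b (chart_vec A c q f)"
proof
  fix c'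
  show "chart_vec A c q (a *\<^sub>R e + b *\<^sub>R f) c' = (rscale a (chart_vec A c q e) + rscale b (chart_vec A c q f)) c'"
    using transition_linear[OF assms, of c'] unfolding chart_vec_def plus_fun_apply rscale_def
    by (simp add: linear_add linear_scale del: o_apply)
qed

lemma map_chart_vec:
  "c \<in> charts_at A q \<Longrightarrow> set ys \<subseteq> tangent_space A q \<Longrightarrow> map (chart_vec A c q) (map (\<lambda>\<eta>. \<eta> c) ys) = ys"
  by (induction ys) (auto simp: chart_vec_of_tangent)

section \<open>Smooth functions and their differentials\<close>

definition smooth_fun :: "('a \<Rightarrow> complex) \<Rightarrow> bool" where
  "smooth_fun f \<longleftrightarrow> (\<forall>c\<in>A. \<forall>k. Ck_on k (snd c ` fst c) (\<lambda>x. f (chart_inv c x)))"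

definition chart_diff :: "('a, 'e) chart \<Rightarrow> ('a \<Rightarrow> complex) \<Rightarrow> 'a \<Rightarrow> 'e \<Rightarrow> complex" where
  "chart_diff c f q = FD (\<lambda>x. f (chart_inv c x)) (snd c q)"

lemma chart_diff_has_derivative:
  assumes "smooth_fun f" "c \<in> charts_at A q"
  shows "((\<lambda>x. f (chart_inv c x)) has_derivative chart_diff c f q) (at (snd c q))"
  unfolding chart_diff_def
  using assms by (intro Ck_on_Suc_has_derivative[of 0 "snd c ` fst c"]) (auto simp: smooth_fun_def charts_at_iff simp del: Ck_on.simps)

lemma chart_diff_transition:
  assumes "smooth_fun f" "c \<in> charts_at A q" "c' \<in> charts_at A q" "\<xi> \<in> tangent_space A q"
  shows "chart_diff c f q (\<xi> c) = chart_diff c' f q (\<xi> c')"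
proof -
  have "\<xi> c' = FD (snd c' \<circ> chart_inv c) (snd c q) (\<xi> c)"
    by (rule tangent_spaceD(2)[OF assms(4,2,3)])
  with fun_cong[OF frechet_derivative_at[OF transition_compose[OF assms(2,3) chart_diff_has_derivative[OF assms(1,3)]]],
      of "\<xi> c"]
  show ?thesis by (simp only: chart_diff_def)
qed

lemma smooth_fun_const: "smooth_fun (\<lambda>q. k)"
  by (auto simp: smooth_fun_def intro: Ck_on_const chart_image_open)

lemma smooth_fun_mult: "smooth_fun f \<Longrightarrow> smooth_fun g \<Longrightarrow> smooth_fun (\<lambda>q. f q * g q)"
  unfolding smooth_fun_def by (intro ballI allI Ck_on_mult chart_image_open) auto

lemma chart_diff_mult:
  assumes "smooth_fun f" "smooth_fun g" "c \<in> charts_at A q"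
  shows "chart_diff c (\<lambda>q. f q * g q) q e = f q * chart_diff c g q e + chart_diff c f q e * g q"
proof -
  have "chart_inv c (snd c q) = q" using assms(3) by (simp add: charts_at_iff)
  with has_derivative_mult[OF chart_diff_has_derivative[OF assms(1,3)] chart_diff_has_derivative[OF assms(2,3)]]
  have "((\<lambda>x. f (chart_inv c x) * g (chart_inv c x)) has_derivative
      (\<lambda>e. f q * chart_diff c g q e + chart_diff c f q e * g q)) (at (snd c q))" by simp
  from fun_cong[OF frechet_derivative_at[OF this], of e] show ?thesis
    unfolding chart_diff_def[of c "\<lambda>q. f q * g q"] by simp
qed

lemma chart_diff_const: "chart_diff c (\<lambda>q. k) q e = 0"
  by (simp add: chart_diff_def)

lemma chart_diff_local:
  assumes "smooth_fun f" "c \<in> charts_at A q" "open U" "q \<in> U" "\<And>q. q \<in> U \<Longrightarrow> f q = g q"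
  shows "chart_diff c f q = chart_diff c g q"
proof -
  have "((\<lambda>x. g (chart_inv c x)) has_derivative chart_diff c f q) (at (snd c q))"
    by (rule has_derivative_transform_within_open[OF chart_diff_has_derivative[OF assms(1,2)]
          eventually_chart(1,2)[OF assms(2-4)]])
      (use eventually_chart(3)[OF assms(2-4)] assms(5) in auto)
  from frechet_derivative_at[OF this] show ?thesis
    unfolding chart_diff_def[of c g] .
qed

end

section \<open>The frame and its canonical form\<close>

locale framed_acs = smooth_manifold A
  for A :: "('a::{t2_space,second_countable_topology}, 'e::euclidean_space) chart set" +
  fixes J :: "'a \<Rightarrow> ('a, 'e) tvec \<Rightarrow> ('a, 'e) tvec" and n :: nat
    and v w :: "nat \<Rightarrow> 'a \<Rightarrow> ('a, 'e) tvec" and v' w' :: "nat \<Rightarrow> 'a \<Rightarrow> ('a, 'e) tvec \<Rightarrow> real"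
  assumes acs: "almost_complex_structure A J" and frame: "global_frame A n v w"
    and J_v: "\<And>i p. i \<in> {1..n} \<Longrightarrow> J p (v i p) = w i p"
    and J_w: "\<And>i p. i \<in> {1..n} \<Longrightarrow> J p (w i p) = - v i p"
    and coframe: "dual_coframe A n v w v' w'"
begin

lemma span_frame:
  "rfun.span (set (map (\<lambda>i. v i q) [1..<Suc n] @ map (\<lambda>i. w i q) [1..<Suc n])) = tangent_space A q"
  using frame by (simp add: global_frame_def Let_def)

lemma tangent_subspace: "rfun.subspace (tangent_space A q)"
  using span_frame[of q] rfun.subspace_span by metis

lemma frame_tangent: "i \<in> {1..n} \<Longrightarrow> v i q \<in> tangent_space A q" "i \<in> {1..n} \<Longrightarrow> w i q \<in> tangent_space A q"
  unfolding span_frame[symmetric] by (auto intro!: rfun.span_base)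

lemma coframe_facts:
  assumes "i \<in> {1..n}"
  shows "real_covector A q (v' i q)" "real_covector A q (w' i q)"
    "j \<in> {1..n} \<Longrightarrow> v' i q (v j q) = (if i = j then 1 else 0)"
    "j \<in> {1..n} \<Longrightarrow> v' i q (w j q) = 0"
    "j \<in> {1..n} \<Longrightarrow> w' i q (w j q) = (if i = j then 1 else 0)"
    "j \<in> {1..n} \<Longrightarrow> w' i q (v j q) = 0"
  using coframe assms unfolding dual_coframe_def by blast+

text \<open>The tangent vectors fixed by E form a subspace containing the frame by duality, hence
  everything. Covectors are linear on the tangent space only, so P includes membership in
  it.\<close>

lemma frame_expansion:
  assumes "\<xi> \<in> tangent_space A q"
  shows "\<xi> = (\<Sum>i=1..n. rscale (v' i q \<xi>) (v i q) + rscale (w' i q \<xi>) (w i q))"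
proof -
  define E where "E \<xi> = (\<Sum>i=1..n. rscale (v' i q \<xi>) (v i q) + rscale (w' i q \<xi>) (w i q))" for \<xi>
  define P where "P = {\<xi> \<in> tangent_space A q. E \<xi> = \<xi>}"
  have E_lin: "E (rscale a \<xi> + rscale b \<eta>) = rscale a (E \<xi>) + rscale b (E \<eta>)"
    if "\<xi> \<in> tangent_space A q" "\<eta> \<in> tangent_space A q" for \<xi> \<eta> a b
  proof -
    have lin: "v' i q (rscale a \<xi> + rscale b \<eta>) = a * v' i q \<xi> + b * v' i q \<eta>"
      "w' i q (rscale a \<xi> + rscale b \<eta>) = a * w' i q \<xi> + b * w' i q \<eta>" if "i \<in> {1..n}" for i
      using coframe_facts(1,2)[OF that, of q] \<open>\<xi> \<in> _\<close> \<open>\<eta> \<in> _\<close> unfolding real_covector_def by blast+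
    have "E (rscale a \<xi> + rscale b \<eta>) = (\<Sum>i=1..n. rscale a (rscale (v' i q \<xi>) (v i q) + rscale (w' i q \<xi>) (w i q))
        + rscale b (rscale (v' i q \<eta>) (v i q) + rscale (w' i q \<eta>) (w i q)))"
      unfolding E_def
    proof (rule sum.cong)
      fix i assume "i \<in> {1..n}"
      show "rscale (v' i q (rscale a \<xi> + rscale b \<eta>)) (v i q) + rscale (w' i q (rscale a \<xi> + rscale b \<eta>)) (w i q)
        = rscale a (rscale (v' i q \<xi>) (v i q) + rscale (w' i q \<xi>) (w i q))
        + rscale b (rscale (v' i q \<eta>) (v i q) + rscale (w' i q \<eta>) (w i q))"
        unfolding lin[OF \<open>i \<in> {1..n}\<close>] by (simp add: rscale_def fun_eq_iff algebra_simps)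
    qed simp
    then show ?thesis
      unfolding E_def sum.distrib rfun.scale_sum_right rfun.scale_right_distrib by simp
  qed
  have "rfun.subspace P"
    unfolding rfun.subspace_def
  proof (safe)
    have 0: "rscale 0 0 + rscale 0 0 = (0 :: ('a, 'e) tvec)" by (simp add: rscale_def fun_eq_iff)
    have T0: "0 \<in> tangent_space A q" by (rule rfun.subspace_0[OF tangent_subspace])
    have "E 0 = 0" using E_lin[OF T0 T0, of 0 0] unfolding 0 by (simp add: rscale_def fun_eq_iff)
    then show "0 \<in> P" using T0 by (simp add: P_def)
  next
    fix \<xi> \<eta> assume *: "\<xi> \<in> P" "\<eta> \<in> P"
    have 1: "rscale 1 \<zeta> + rscale 1 \<kappa> = \<zeta> + \<kappa>" for \<zeta> \<kappa> :: "('a, 'e) tvec" by (simp add: rscale_def fun_eq_iff)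
    show "\<xi> + \<eta> \<in> P"
      using * E_lin[of \<xi> \<eta> 1 1] rfun.subspace_add[OF tangent_subspace, of \<xi> q \<eta>] unfolding 1 P_def by simp
  next
    fix c \<xi> assume *: "\<xi> \<in> P"
    have 1: "rscale c \<zeta> + rscale 0 \<zeta> = rscale c \<zeta>" for \<zeta> :: "('a, 'e) tvec" by (simp add: rscale_def fun_eq_iff)
    show "rscale c \<xi> \<in> P"
      using * E_lin[of \<xi> \<xi> c 0] rfun.subspace_scale[OF tangent_subspace, of \<xi> q c] unfolding 1 P_def by simp
  qed
  moreover have "v j q \<in> P" "w j q \<in> P" if j: "j \<in> {1..n}" for j
  proof -
    have "E (v j q) = (\<Sum>i=1..n. if i = j then v j q else 0)"
      unfolding E_def by (rule sum.cong) (use coframe_facts(3-6)[where j=j and q=q] j in \<open>auto simp: rscale_def fun_eq_iff\<close>)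
    moreover have "E (w j q) = (\<Sum>i=1..n. if i = j then w j q else 0)"
      unfolding E_def by (rule sum.cong) (use coframe_facts(3-6)[where j=j and q=q] j in \<open>auto simp: rscale_def fun_eq_iff\<close>)
    ultimately show "v j q \<in> P" "w j q \<in> P"
      using j frame_tangent[OF j] by (simp_all add: P_def)
  qed
  then have "set (map (\<lambda>i. v i q) [1..<Suc n] @ map (\<lambda>i. w i q) [1..<Suc n]) \<subseteq> P"
    by auto
  ultimately have "tangent_space A q \<subseteq> P"
    unfolding span_frame[symmetric] by (intro rfun.span_minimal)
  then show ?thesis using assms by (auto simp: P_def E_def)
qed

sublocale F: complex_frame A J q n "\<lambda>i. v i q" "\<lambda>i. w i q" "\<lambda>i. v' i q" "\<lambda>i. w' i q" for q
proof
  show "0 \<in> tangent_space A q" by (rule rfun.subspace_0[OF tangent_subspace])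
  show "rscale a \<xi> + rscale b \<eta> \<in> tangent_space A q"
    if "\<xi> \<in> tangent_space A q" "\<eta> \<in> tangent_space A q" for \<xi> \<eta> a b
    using that by (intro rfun.subspace_add rfun.subspace_scale tangent_subspace)
  show "J q \<xi> \<in> tangent_space A q" "J q (J q \<xi>) = - \<xi>" if "\<xi> \<in> tangent_space A q" for \<xi>
    using acs that unfolding almost_complex_structure_def by blast+
  show "J q (rscale a \<xi> + rscale b \<eta>) = rscale a (J q \<xi>) + rscale b (J q \<eta>)"
    if "\<xi> \<in> tangent_space A q" "\<eta> \<in> tangent_space A q" for \<xi> \<eta> a b
    using acs that unfolding almost_complex_structure_def by blast
qed (use frame_tangent J_v J_w coframe_facts frame_expansion in \<open>simp_all\<close>)

abbreviation psi :: "'a \<Rightarrow> ('a, 'e) ctensor" where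
  "psi q \<equiv> F.psi q"

abbreviation frame_list :: "'a \<Rightarrow> ('a, 'e) tvec list" where
  "frame_list q \<equiv> map (\<lambda>i. v i q) [1..<Suc n]"

lemma frame_component_smooth:
  assumes "i \<in> {1..n}" "c \<in> A"
  shows "Ck_on k (snd c ` fst c) (\<lambda>x. v i (chart_inv c x) c)" "Ck_on k (snd c ` fst c) (\<lambda>x. w i (chart_inv c x) c)"
  using frame assms unfolding global_frame_def smooth_vector_field_def smooth_on_def by blast+

text \<open>The index (b, i) merges the v_i and w_i into one family of 2n fields, the form required
  by \<open>dual_frames\<close>.\<close>

definition frame_field :: "('a, 'e) chart \<Rightarrow> bool \<times> nat \<Rightarrow> 'e \<Rightarrow> 'e" where
  "frame_field c = (\<lambda>(b, i) x. (if b then v i else w i) (chart_inv c x) c)"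

definition coframe_field :: "('a, 'e) chart \<Rightarrow> bool \<times> nat \<Rightarrow> 'e \<Rightarrow> 'e \<Rightarrow> real" where
  "coframe_field c = (\<lambda>(b, i) x e. (if b then v' i else w' i) (chart_inv c x) (chart_vec A c (chart_inv c x) e))"

lemma sum_bool_prod: "(\<Sum>j\<in>(UNIV :: bool set) \<times> I. f j) = (\<Sum>i\<in>I. f (True, i) + f (False, i))"
proof -
  have "(\<Sum>j\<in>(UNIV :: bool set) \<times> I. f j) = (\<Sum>b\<in>UNIV. \<Sum>i\<in>I. f (b, i))"
    by (simp add: sum.cartesian_product)
  then show ?thesis by (simp add: UNIV_bool sum.distrib add.commute)
qed

lemma dual_frames_chart:
  assumes "c \<in> A"
  shows "dual_frames (UNIV \<times> {1..n}) (snd c ` fst c) (frame_field c) (coframe_field c)"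
proof (rule dual_frames.intro)
  note ca = charts_at_chart_inv[OF assms]
  show "finite ((UNIV :: bool set) \<times> {1..n})" by simp
  show "open (snd c ` fst c)" by (rule chart_image_open[OF assms])
  show "linear (coframe_field c j x)" if jI: "j \<in> UNIV \<times> {1..n}" and xS: "x \<in> snd c ` fst c" for j x
  proof -
    obtain b i where j: "j = (b, i)" "i \<in> {1..n}" using jI by auto
    define f where "f = (if b then v' i else w' i) (chart_inv c x)"
    have "real_covector A (chart_inv c x) f" using coframe_facts(1,2)[OF j(2)] by (simp add: f_def)
    then have f: "f (chart_vec A c (chart_inv c x) (a *\<^sub>R e + b *\<^sub>R e')) =
        a * f (chart_vec A c (chart_inv c x) e) + b * f (chart_vec A c (chart_inv c x) e')" for a b e e'
      unfolding chart_vec_lin[OF ca[OF xS]] real_covector_def using chart_vec_tangent[OF ca[OF xS]] by blast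
    show ?thesis
      using f[of 1 _ 1] f[of _ _ 0] by (intro linearI) (simp_all add: coframe_field_def j f_def)
  qed
  show "coframe_field c j x (frame_field c l x) = (if j = l then 1 else 0)"
    if jl: "j \<in> UNIV \<times> {1..n}" "l \<in> UNIV \<times> {1..n}" and x: "x \<in> snd c ` fst c" for j l x
  proof -
    obtain a i b k where j: "j = (a, i)" "i \<in> {1..n}" and l: "l = (b, k)" "k \<in> {1..n}"
      using jl by auto
    have "chart_vec A c (chart_inv c x) (v k (chart_inv c x) c) = v k (chart_inv c x)"
      "chart_vec A c (chart_inv c x) (w k (chart_inv c x) c) = w k (chart_inv c x)"
      using chart_vec_of_tangent[OF ca[OF x]] frame_tangent[OF l(2)] by auto
    then show ?thesis
      using coframe_facts(3-6)[OF j(2) l(2), of "chart_inv c x"]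
      by (cases a; cases b) (simp_all add: frame_field_def coframe_field_def j(1) l(1))
  qed
  show "(\<Sum>j\<in>UNIV \<times> {1..n}. coframe_field c j x e *\<^sub>R frame_field c j x) = e" if x: "x \<in> snd c ` fst c" for x e
  proof -
    let ?q = "chart_inv c x"
    have "e = chart_vec A c ?q e c" using chart_vec_chart[OF ca[OF x]] by simp
    also have "\<dots> = (\<Sum>i=1..n. rscale (v' i ?q (chart_vec A c ?q e)) (v i ?q) + rscale (w' i ?q (chart_vec A c ?q e)) (w i ?q)) c"
      by (rule fun_cong[OF frame_expansion[OF chart_vec_tangent[OF ca[OF x]]]])
    also have "\<dots> = (\<Sum>j\<in>UNIV \<times> {1..n}. coframe_field c j x e *\<^sub>R frame_field c j x)"
      unfolding sum_bool_prod sum_fun_apply by (simp add: frame_field_def coframe_field_def rscale_def)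
    finally show ?thesis by simp
  qed
qed

lemma coframe_smooth:
  assumes c: "c \<in> A" and i: "i \<in> {1..n}"
  shows "Ck_on k (snd c ` fst c) (\<lambda>x. v' i (chart_inv c x) (chart_vec A c (chart_inv c x) e))"
    and "Ck_on k (snd c ` fst c) (\<lambda>x. w' i (chart_inv c x) (chart_vec A c (chart_inv c x) e))"
proof -
  have X: "Ck_on k (snd c ` fst c) (frame_field c j)" if "j \<in> UNIV \<times> {1..n}" for j
    using frame_component_smooth[OF _ c] that by (auto simp: frame_field_def)
  note * = dual_frames.coframe_Ck_on[OF dual_frames_chart[OF c] X]
  show "Ck_on k (snd c ` fst c) (\<lambda>x. v' i (chart_inv c x) (chart_vec A c (chart_inv c x) e))"
    using *[of "(True, i)" e] i by (simp add: coframe_field_def)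
  show "Ck_on k (snd c ` fst c) (\<lambda>x. w' i (chart_inv c x) (chart_vec A c (chart_inv c x) e))"
    using *[of "(False, i)" e] i by (simp add: coframe_field_def)
qed

lemma wedges_smooth:
  assumes S: "open S" and \<theta>: "\<And>\<theta> e. \<theta> \<in> set \<theta>s \<Longrightarrow> Ck_on k S (\<lambda>x. \<theta> x [X x e])"
  shows "Ck_on k S (\<lambda>x. wedges (map (\<lambda>\<theta>. \<theta> x) \<theta>s) (map (X x) es))"
  using \<theta>
proof (induction \<theta>s arbitrary: es)
  case Nil
  have "Ck_on k S (\<lambda>x. if es = [] then 1 else 0 :: complex)" by (rule Ck_on_const[OF S])
  then show ?case by (rule Ck_on_cong[OF S]) simp
next
  case (Cons \<theta> \<theta>s)
  have "Ck_on k S (\<lambda>x. \<Sum>i<length es. (-1) ^ i * (\<theta> x [X x (es ! i)] *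
      wedges (map (\<lambda>\<theta>. \<theta> x) \<theta>s) (map (X x) (take i es @ drop (Suc i) es))))"
    by (intro Ck_on_sum Ck_on_mult Ck_on_const S Cons.IH Cons.prems) auto
  then show ?case
    by (rule Ck_on_cong[OF S]) (simp add: wedges_Cons wedge1_sum take_map drop_map)
qed

lemma psi_smooth: "smooth_tensor A psi"
  unfolding smooth_tensor_def smooth_on_def
proof (intro ballI allI)
  fix c es k assume c: "c \<in> A"
  let ?X = "\<lambda>x. chart_vec A c (chart_inv c x)"
  note S = chart_image_open[OF c]
  have "Ck_on k (snd c ` fst c) (\<lambda>x. wedges (map (\<lambda>\<theta>. \<theta> x) (map (\<lambda>i x. F.phi (chart_inv c x) i) [1..<Suc n])) (map (?X x) es))"
  proof (rule wedges_smooth[OF S])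
    fix \<theta> e assume "\<theta> \<in> set (map (\<lambda>i x. F.phi (chart_inv c x) i) [1..<Suc n])"
    then obtain i where i: "i \<in> {1..n}" and \<theta>: "\<theta> = (\<lambda>x. F.phi (chart_inv c x) i)"
      by (auto simp: less_Suc_eq_le)
    have 1: "Ck_on k (snd c ` fst c) (\<lambda>x. complex_of_real (v' i (chart_inv c x) (?X x e)))"
      by (rule Ck_on_bounded_linear[OF bounded_linear_of_real S coframe_smooth(1)[OF c i]])
    have 2: "Ck_on k (snd c ` fst c) (\<lambda>x. complex_of_real (w' i (chart_inv c x) (?X x e)))"
      by (rule Ck_on_bounded_linear[OF bounded_linear_of_real S coframe_smooth(2)[OF c i]])
    have "Ck_on k (snd c ` fst c) (\<lambda>x. of_real (v' i (chart_inv c x) (?X x e)) + \<i> * of_real (w' i (chart_inv c x) (?X x e)))"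
      by (rule Ck_on_add[OF S 1 Ck_on_mult[OF S Ck_on_const[OF S] 2]])
    then show "Ck_on k (snd c ` fst c) (\<lambda>x. \<theta> x [?X x e])"
      by (rule Ck_on_cong[OF S])
        (simp add: \<theta> F.phi_apply[OF chart_vec_tangent[OF charts_at_chart_inv[OF c]]])
  qed
  then show "Ck_on k (snd c ` fst c) (\<lambda>x. psi (chart_inv c x) (map (?X x) es))"
    by (simp add: F.psi_def o_def)
qed

end

section \<open>The operator \<open>\<partial>\<close>-bar in the frame\<close>

context framed_acs
begin

text \<open>The very choice made inside \<open>ext_deriv\<close>. Differentials of functions are
  taken in the same chart, so the product rule for d is a computation in one chart.\<close>

definition some_chart :: "'a \<Rightarrow> ('a, 'e) chart" where
  "some_chart q = (SOME c. c \<in> charts_at A q)"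

lemma some_chart: "some_chart q \<in> charts_at A q"
  unfolding some_chart_def by (rule someI_ex) (use charts_at_nonempty in blast)

lemma smooth_tensor_has_derivative:
  fixes es :: "'e list"
  assumes "smooth_tensor A \<alpha>" "c \<in> charts_at A q"
  defines "g \<equiv> \<lambda>x. \<alpha> (chart_inv c x) (map (chart_vec A c (chart_inv c x)) es)"
  shows "(g has_derivative FD g (snd c q)) (at (snd c q))"
proof -
  have "Ck_on (Suc 0) (snd c ` fst c) g"
    using assms unfolding smooth_tensor_def smooth_on_def charts_at_iff by blast
  then show ?thesis
    by (rule Ck_on_Suc_has_derivative) (use assms(2) in \<open>auto simp: charts_at_iff\<close>)
qed

definition one_form_of :: "'a \<Rightarrow> ('e \<Rightarrow> complex) \<Rightarrow> ('a, 'e) ctensor" where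
  "one_form_of q D = (\<lambda>xs. case xs of [\<xi>] \<Rightarrow> if \<xi> \<in> F.T q then D (\<xi> (some_chart q)) else 0 | _ \<Rightarrow> 0)"

lemma one_form_of_kform:
  assumes "linear D"
  shows "kform (F.T q) 1 (one_form_of q D)"
  unfolding cotangent_C_iff[symmetric] cotangent_C_def
proof (intro CollectI conjI allI impI ballI)
  fix xs assume "one_form_of q D xs \<noteq> 0"
  then show "\<exists>\<xi>\<in>F.T q. xs = [\<xi>]"
    by (auto simp: one_form_of_def split: list.splits if_splits)
next
  fix \<xi> \<eta> and a b :: real assume T: "\<xi> \<in> F.T q" "\<eta> \<in> F.T q"
  have "D ((rscale a \<xi> + rscale b \<eta>) (some_chart q)) = of_real a * D (\<xi> (some_chart q)) + of_real b * D (\<eta> (some_chart q))"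
    using assms by (simp add: rscale_def linear_add linear_scale scaleR_conv_of_real)
  then show "one_form_of q D [rscale a \<xi> + rscale b \<eta>] = of_real a * one_form_of q D [\<xi>] + of_real b * one_form_of q D [\<eta>]"
    using F.T_lin[OF T, of a b] T unfolding one_form_of_def by (simp del: plus_fun_apply)
qed

lemma one_form_of_apply: "\<xi> \<in> F.T q \<Longrightarrow> one_form_of q D [\<xi>] = D (\<xi> (some_chart q))"
  by (simp add: one_form_of_def)

lemma ext_deriv_sum:
  assumes "set xs \<subseteq> F.T q"
  shows "ext_deriv A \<alpha> q xs = (\<Sum>i<length xs. (-1) ^ i * frechet_derivative
     (\<lambda>x. \<alpha> (chart_inv (some_chart q) x) (map (chart_vec A (some_chart q) (chart_inv (some_chart q) x))
        (map (\<lambda>\<eta>. \<eta> (some_chart q)) (omit i xs))))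
     (at (snd (some_chart q) q)) ((xs ! i) (some_chart q)))"
  unfolding ext_deriv_def wedge_map_def chart_deriv_def some_chart_def[symmetric] if_P[OF assms] by simp

text \<open>In the chosen chart d\<alpha> is the sum of dx_b \<and> \<partial>_b \<alpha>, so the
  closure properties of \<open>kform\<close> suffice. It makes d\<psi> eligible for
  \<open>type_decomposition\<close>.\<close>

lemma ext_deriv_kform:
  assumes sm: "smooth_tensor A \<alpha>" and k: "\<And>q. kform (F.T q) k (\<alpha> q)"
  shows "kform (F.T q) (Suc k) (ext_deriv A \<alpha> q)"
proof -
  define c where "c = some_chart q"
  have c: "c \<in> charts_at A q" "c \<in> A" "q \<in> fst c" using some_chart by (auto simp: c_def charts_at_iff)
  let ?T = "F.T q"
  define g where "g ys = (\<lambda>x. \<alpha> (chart_inv c x) (map (chart_vec A c (chart_inv c x)) (map (\<lambda>\<eta>. \<eta> c) ys)))" for ys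
  define D where "D ys = FD (g ys) (snd c q)" for ys
  have gD: "(g ys has_derivative D ys) (at (snd c q))" for ys
    unfolding g_def D_def by (rule smooth_tensor_has_derivative[OF sm c(1)])
  \<comment> \<open>Identities between coefficient functions on the chart image pass to their
    derivatives; the symmetry and linearity of \<partial>_b \<alpha> are obtained in this
    way.\<close>
  have D_eq: "D ys e = D' e" if "(g' has_derivative D') (at (snd c q))"
    and "\<And>x. x \<in> snd c ` fst c \<Longrightarrow> g' x = g ys x" for ys g' D' e
  proof -
    have "(g ys has_derivative D') (at (snd c q))"
      by (rule has_derivative_transform_within_open[OF that(1) chart_image_open[OF c(2)]]) (use c that in auto)
    from fun_cong[OF has_derivative_unique[OF gD this]] show ?thesis .
  qed
  \<comment> \<open>D ys sees only the components of ys in the chart c and could be nonzero off the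
    tangent space; the cut-off enforces the support condition.\<close>
  define \<beta> where "\<beta> b ys = (if set ys \<subseteq> ?T then D ys b else 0)" for b ys
  have \<beta>: "kform ?T k (\<beta> b)" for b
    unfolding kform_def
  proof (intro conjI allI impI)
    fix ys assume nz: "\<beta> b ys \<noteq> 0"
    show "set ys \<subseteq> ?T" using nz by (auto simp: \<beta>_def split: if_splits)
    show "length ys = k"
    proof (rule ccontr)
      assume "length ys \<noteq> k"
      then have "g ys = (\<lambda>x. 0)"
        unfolding g_def using kformD(5)[OF k] by simp
      then have "D ys b = 0" unfolding D_def by simp
      then show False using nz by (simp add: \<beta>_def split: if_splits)
    qed
  next
    show "alternating (\<beta> b)"
      unfolding alternating_def
    proof (intro allI)
      fix us x y vs
      have "g (us @ x # y # vs) z = - g (us @ y # x # vs) z" for z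
        unfolding g_def map_append list.map by (rule alternatingD[OF kformD(1)[OF k]])
      then have "D (us @ x # y # vs) b = - D (us @ y # x # vs) b"
        by (intro D_eq[OF has_derivative_minus[OF gD]]) simp
      moreover have "set (us @ x # y # vs) = set (us @ y # x # vs)" by auto
      ultimately show "\<beta> b (us @ x # y # vs) = - \<beta> b (us @ y # x # vs)"
        unfolding \<beta>_def by simp
    qed
    show "multilinear ?T (\<beta> b)"
      unfolding multilinear_def
    proof (intro allI ballI)
      fix us vs \<xi> \<eta> and s t :: real assume T: "\<xi> \<in> ?T" "\<eta> \<in> ?T"
      define z where "z = rscale s \<xi> + rscale t \<eta>"
      have zT: "z \<in> ?T" unfolding z_def by (rule F.T_lin[OF T])
      have zc: "z c = s *\<^sub>R \<xi> c + t *\<^sub>R \<eta> c" by (simp add: z_def rscale_def)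
      have "D (us @ z # vs) b = of_real s * D (us @ \<xi> # vs) b + of_real t * D (us @ \<eta> # vs) b"
      proof (rule D_eq[OF has_derivative_add[OF has_derivative_mult_right[OF gD] has_derivative_mult_right[OF gD]]])
        fix x assume x: "x \<in> snd c ` fst c"
        note cx = charts_at_chart_inv[OF c(2) x]
        show "of_real s * g (us @ \<xi> # vs) x + of_real t * g (us @ \<eta> # vs) x = g (us @ z # vs) x"
          using multilinearD[OF kformD(2)[OF k] chart_vec_tangent[OF cx] chart_vec_tangent[OF cx], of _ s "\<xi> c" t "\<eta> c"]
          unfolding g_def by (simp add: zc chart_vec_lin[OF cx] del: plus_fun_apply)
      qed
      then show "\<beta> b (us @ (rscale s \<xi> + rscale t \<eta>) # vs)
          = of_real s * \<beta> b (us @ \<xi> # vs) + of_real t * \<beta> b (us @ \<eta> # vs)"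
        unfolding z_def[symmetric] \<beta>_def using T zT by auto
    qed
  qed
  define dx where "dx b = one_form_of q (\<lambda>e. of_real (e \<bullet> b))" for b
  have dx: "kform ?T 1 (dx b)" for b
    unfolding dx_def
    by (rule one_form_of_kform) (auto intro!: linearI simp: inner_add_left scaleR_conv_of_real)
  have K: "kform ?T (Suc k) (\<Sum>b\<in>Basis. wedge1 (dx b) (\<beta> b))"
    by (intro kform_sum kform_wedge1 dx \<beta>)
  have "ext_deriv A \<alpha> q = (\<Sum>b\<in>Basis. wedge1 (dx b) (\<beta> b))"
  proof
    fix xs
    show "ext_deriv A \<alpha> q xs = (\<Sum>b\<in>Basis. wedge1 (dx b) (\<beta> b)) xs"
    proof (cases "set xs \<subseteq> ?T")
      case False
      then show ?thesis using kformD(6)[OF K False] by (simp add: ext_deriv_def)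
    next
      case True
      have "ext_deriv A \<alpha> q xs = (\<Sum>i<length xs. (-1) ^ i * D (omit i xs) ((xs ! i) c))"
        unfolding ext_deriv_sum[OF True] D_def g_def c_def ..
      also have "\<dots> = (\<Sum>i<length xs. \<Sum>b\<in>Basis. (-1) ^ i * (dx b [xs ! i] * \<beta> b (omit i xs)))"
      proof (rule sum.cong)
        fix i assume "i \<in> {..<length xs}"
        then have xi: "xs ! i \<in> ?T" using True by auto
        have "set (omit i xs) \<subseteq> set xs"
          by (simp add: set_take_subset set_drop_subset)
        then have r: "set (omit i xs) \<subseteq> ?T" using True by blast
        show "(-1) ^ i * D (omit i xs) ((xs ! i) c)
            = (\<Sum>b\<in>Basis. (-1) ^ i * (dx b [xs ! i] * \<beta> b (omit i xs)))"
          unfolding \<beta>_def if_P[OF r] dx_def one_form_of_apply[OF xi] c_def[symmetric]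
            frechet_derivative_Basis_sum[OF gD, of "omit i xs" "(xs ! i) c"]
          by (simp add: sum_distrib_left scaleR_conv_of_real)
      qed simp
      also have "\<dots> = (\<Sum>b\<in>Basis. wedge1 (dx b) (\<beta> b)) xs"
        unfolding sum_fun_apply wedge1_sum by (rule sum.swap)
      finally show ?thesis .
    qed
  qed
  then show ?thesis using K by simp
qed

section \<open>Differential and \<partial>-bar of functions\<close>

definition dform :: "('a \<Rightarrow> complex) \<Rightarrow> 'a \<Rightarrow> ('a, 'e) ctensor" where
  "dform f q = one_form_of q (chart_diff (some_chart q) f q)"

lemma dform_kform: "smooth_fun f \<Longrightarrow> kform (F.T q) 1 (dform f q)"
  unfolding dform_def
  using has_derivative_linear[OF chart_diff_has_derivative[OF _ some_chart]] by (rule one_form_of_kform)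

lemma dform_apply:
  assumes "smooth_fun f" "c \<in> charts_at A q" "\<xi> \<in> F.T q"
  shows "dform f q [\<xi>] = chart_diff c f q (\<xi> c)"
  using one_form_of_apply[OF assms(3)] chart_diff_transition[OF assms(1) some_chart assms(2,3)]
  by (simp add: dform_def)

lemma ext_deriv_scale:
  assumes f: "smooth_fun f" and sm: "smooth_tensor A \<alpha>" and k: "\<And>q. kform (F.T q) k (\<alpha> q)"
  shows "ext_deriv A (\<lambda>q. cscale (f q) (\<alpha> q)) q = wedge1 (dform f q) (\<alpha> q) + cscale (f q) (ext_deriv A \<alpha> q)"
proof
  fix xs
  show "ext_deriv A (\<lambda>q. cscale (f q) (\<alpha> q)) q xs = (wedge1 (dform f q) (\<alpha> q) + cscale (f q) (ext_deriv A \<alpha> q)) xs"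
  proof (cases "set xs \<subseteq> F.T q")
    case False
    then show ?thesis
      using kformD(6)[OF kform_wedge1[OF dform_kform[OF f] k] False] by (simp add: ext_deriv_def cscale_def)
  next
    case True
    define c where "c = some_chart q"
    have c: "c \<in> charts_at A q" "chart_inv c (snd c q) = q" using some_chart[of q] by (auto simp: c_def charts_at_iff)
    define g where "g es = (\<lambda>x. \<alpha> (chart_inv c x) (map (chart_vec A c (chart_inv c x)) es))" for es
    have "((\<lambda>x. f (chart_inv c x) * g es x) has_derivative
        (\<lambda>e. f q * FD (g es) (snd c q) e + chart_diff c f q e * g es (snd c q))) (at (snd c q))" for es
      using has_derivative_mult[OF chart_diff_has_derivative[OF f c(1)]
          smooth_tensor_has_derivative[OF sm c(1), of es, folded g_def]] c(2) by simp
    from fun_cong[OF frechet_derivative_at[OF this]]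
    have D: "FD (\<lambda>x. f (chart_inv c x) * g es x) (snd c q) e =
        f q * FD (g es) (snd c q) e + chart_diff c f q e * g es (snd c q)" for es e
      by metis
    have "ext_deriv A (\<lambda>q. cscale (f q) (\<alpha> q)) q xs =
        (\<Sum>i<length xs. (-1) ^ i * FD (\<lambda>x. f (chart_inv c x) *
          g (map (\<lambda>\<eta>. \<eta> c) (omit i xs)) x) (snd c q) ((xs ! i) c))"
      unfolding ext_deriv_sum[OF True] c_def[symmetric] g_def cscale_def ..
    also have "\<dots> = (\<Sum>i<length xs. (-1) ^ i * (dform f q [xs ! i] * \<alpha> q (omit i xs)) +
        f q * ((-1) ^ i * FD (g (map (\<lambda>\<eta>. \<eta> c) (omit i xs))) (snd c q) ((xs ! i) c)))"
    proof (rule sum.cong)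
      fix i assume "i \<in> {..<length xs}"
      then have xi: "xs ! i \<in> F.T q" using True by auto
      have "set (omit i xs) \<subseteq> set xs"
        by (simp add: set_take_subset set_drop_subset)
      then have r: "set (omit i xs) \<subseteq> F.T q" using True by blast
      have "g (map (\<lambda>\<eta>. \<eta> c) (omit i xs)) (snd c q) = \<alpha> q (omit i xs)"
        unfolding g_def c(2) map_chart_vec[OF c(1) r] ..
      then show "(-1) ^ i * FD (\<lambda>x. f (chart_inv c x) *
          g (map (\<lambda>\<eta>. \<eta> c) (omit i xs)) x) (snd c q) ((xs ! i) c) =
          (-1) ^ i * (dform f q [xs ! i] * \<alpha> q (omit i xs)) +
          f q * ((-1) ^ i * FD (g (map (\<lambda>\<eta>. \<eta> c) (omit i xs))) (snd c q) ((xs ! i) c))"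
        unfolding D dform_apply[OF f c(1) xi] by (simp add: distrib_left mult.left_commute)
    qed simp
    also have "\<dots> = (wedge1 (dform f q) (\<alpha> q) + cscale (f q) (ext_deriv A \<alpha> q)) xs"
      unfolding sum.distrib plus_fun_apply wedge1_sum cscale_def ext_deriv_sum[OF True] c_def[symmetric] g_def
        sum_distrib_left[symmetric] ..
    finally show ?thesis .
  qed
qed

definition dbar :: "('a \<Rightarrow> complex) \<Rightarrow> 'a \<Rightarrow> ('a, 'e) tvec \<Rightarrow> complex" where
  "dbar f q \<xi> = F.dbar_part q (dform f q) [\<xi>]"

lemma dbar_apply:
  assumes "smooth_fun f" "c \<in> charts_at A q" "\<xi> \<in> F.T q"
  shows "dbar f q \<xi> = (chart_diff c f q (\<xi> c) + \<i> * chart_diff c f q (J q \<xi> c)) / 2"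
  using assms(3) dform_apply[OF assms] dform_apply[OF assms(1,2) F.J_T[OF assms(3)]]
  by (simp add: dbar_def F.dbar_part_def)

lemma dbar_outside: "\<xi> \<notin> F.T q \<Longrightarrow> dbar f q \<xi> = 0"
  by (simp add: dbar_def F.dbar_part_def)

lemma dbar_const: "dbar (\<lambda>q. k) q \<xi> = 0"
  using dbar_apply[OF smooth_fun_const some_chart] dbar_outside
  by (cases "\<xi> \<in> F.T q") (simp_all add: chart_diff_const)

lemma dbar_mult:
  assumes "smooth_fun f" "smooth_fun g"
  shows "dbar (\<lambda>q. f q * g q) q \<xi> = f q * dbar g q \<xi> + dbar f q \<xi> * g q"
proof (cases "\<xi> \<in> F.T q")
  case True
  show ?thesis
    unfolding dbar_apply[OF smooth_fun_mult[OF assms] some_chart True] dbar_apply[OF assms(1) some_chart True]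
      dbar_apply[OF assms(2) some_chart True] chart_diff_mult[OF assms some_chart]
    by (simp add: algebra_simps add_divide_distrib)
qed (simp add: dbar_outside)

lemma dbar_local:
  assumes "smooth_fun f" "open U" "q \<in> U" "\<And>q. q \<in> U \<Longrightarrow> f q = g q"
  shows "dbar f q = dbar g q"
  by (rule ext) (simp only: dbar_def dform_def chart_diff_local[OF assms(1) some_chart assms(2-4)])

end

locale framed_acs_dbar_closed = framed_acs A J n v w v' w'
  for A :: "('a::{t2_space,second_countable_topology}, 'e::euclidean_space) chart set" and J n v w v' w' +
  assumes dbar_psi: "\<And>q. dbar_form A J n 0 psi q = 0"
begin

text \<open>In d(f \<psi>) = df \<and> \<psi> + f d\<psi> the second summand has no (n,1)-part, and
  that of the first comes from the (0,1)-part of df.\<close>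

lemma dbar_canonical_scale:
  assumes "smooth_fun f"
  shows "dbar_canonical A J n (\<lambda>q. cscale (f q) (psi q)) q (\<xi> # zs) = cscale (dbar f q \<xi>) (psi q) zs"
proof -
  have "dbar_canonical A J n (\<lambda>q. cscale (f q) (psi q)) q = tprod 1 (F.dbar_part q (dform f q)) (psi q)"
    by (rule F.dbar_canonical_eq[OF ext_deriv_scale[OF assms psi_smooth F.psi_kform] dform_kform[OF assms]
          ext_deriv_kform[OF psi_smooth F.psi_kform] dbar_psi])
  then show ?thesis by (simp add: tprod_def cscale_def dbar_def)
qed

end

section \<open>Pluricanonical sections\<close>

lemma tprods_scale:
  "tprods k (map (\<lambda>c. cscale c \<psi>) cs) = cscale (prod_list cs) (tprods k (replicate (length cs) \<psi>))"
proof (induction cs)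
  case (Cons c cs)
  then show ?case by (simp add: tprod_def cscale_def fun_eq_iff)
qed (simp add: cscale_def)

lemma tprods_concat:
  "length l = k \<Longrightarrow> tprods k (replicate m \<psi>) (concat (replicate m l)) = \<psi> l ^ m"
  by (induction m) (simp_all add: tprod_def)

lemma tprods_single:
  assumes "kform T k \<psi>"
  shows "tprods k [\<psi>] = \<psi>"
proof
  fix xs
  show "tprods k [\<psi>] xs = \<psi> xs"
    using kformD(5)[OF assms, of xs] by (cases "length xs \<le> k") (simp_all add: tprod_def)
qed

context framed_acs
begin

abbreviation psi_pow :: "nat \<Rightarrow> 'a \<Rightarrow> ('a, 'e) ctensor" where
  "psi_pow m q \<equiv> tprods n (replicate m (psi q))"

abbreviation frame_lists :: "nat \<Rightarrow> 'a \<Rightarrow> ('a, 'e) tvec list" where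
  "frame_lists m q \<equiv> concat (replicate m (frame_list q))"

text \<open>Evaluation at \<open>frame_lists\<close> reads off the coefficient of any multiple of
  the power, and shows that the power vanishes nowhere.\<close>

lemma psi_pow_frame: "psi_pow m q (frame_lists m q) = 1"
  using tprods_concat[of "frame_list q" n m "psi q"] F.psi_vs by simp

lemma psi_pow_smooth: "smooth_tensor A (psi_pow m)"
  unfolding smooth_tensor_def smooth_on_def
proof (intro ballI allI)
  fix c k and es :: "'e list" assume c: "c \<in> A"
  note S = chart_image_open[OF c]
  let ?X = "\<lambda>x. chart_vec A c (chart_inv c x)"
  show "Ck_on k (snd c ` fst c) (\<lambda>x. psi_pow m (chart_inv c x) (map (?X x) es))"
  proof (induction m arbitrary: es)
    case 0
    have "Ck_on k (snd c ` fst c) (\<lambda>x. if es = [] then 1 else 0 :: complex)" by (rule Ck_on_const[OF S])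
    then show ?case by (rule Ck_on_cong[OF S]) simp
  next
    case (Suc m)
    have "Ck_on k (snd c ` fst c) (\<lambda>x. psi (chart_inv c x) (map (?X x) (take n es)))"
      using psi_smooth c unfolding smooth_tensor_def smooth_on_def by blast
    from Ck_on_mult[OF S this Suc.IH[of "drop n es"]] show ?case
      by (rule Ck_on_cong[OF S]) (simp add: tprod_def take_map drop_map)
  qed
qed

lemma smooth_tensor_scale:
  assumes "smooth_fun f" "smooth_tensor A \<alpha>"
  shows "smooth_tensor A (\<lambda>q. cscale (f q) (\<alpha> q))"
  using assms unfolding smooth_tensor_def smooth_on_def smooth_fun_def cscale_def
  by (intro ballI allI Ck_on_mult chart_image_open) blast+

lemma fibre_eq:
  assumes s: "s \<in> pluricanonical_fibre A J n m q"
  shows "s = cscale (s (frame_lists m q)) (psi_pow m q)"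
proof -
  let ?R = "range (\<lambda>c. cscale c (psi_pow m q))"
  have "cfun.subspace ?R"
    unfolding cfun.subspace_def
  proof (intro conjI ballI allI)
    show "0 \<in> ?R" by (rule image_eqI[of _ _ 0]) simp_all
    show "x + y \<in> ?R" if xy: "x \<in> ?R" "y \<in> ?R" for x y
    proof -
      obtain a b where "x = cscale a (psi_pow m q)" "y = cscale b (psi_pow m q)" using xy by blast
      then show ?thesis by (intro image_eqI[of _ _ "a + b"]) (simp_all only: cfun.scale_left_distrib UNIV_I)
    qed
    show "cscale c x \<in> ?R" if x: "x \<in> ?R" for c x
    proof -
      obtain a where "x = cscale a (psi_pow m q)" using x by blast
      then show ?thesis by (intro image_eqI[of _ _ "c * a"]) (simp_all only: cfun.scale_scale UNIV_I)
    qed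
  qed
  moreover have "tprods n \<alpha>s \<in> ?R" if \<alpha>: "length \<alpha>s = m" "set \<alpha>s \<subseteq> Lambda A J n 0 q" for \<alpha>s
  proof -
    have "\<alpha>s = map (\<lambda>\<alpha>. cscale (\<alpha> (frame_list q)) (psi q)) \<alpha>s"
      by (rule map_idI[symmetric]) (use F.Lambda_n0_eq \<alpha>(2) in auto)
    then have "\<alpha>s = map (\<lambda>c. cscale c (psi q)) (map (\<lambda>\<alpha>. \<alpha> (frame_list q)) \<alpha>s)"
      by (simp only: map_map o_def)
    from arg_cong[OF this, of "tprods n"] show ?thesis
      unfolding tprods_scale length_map \<alpha>(1) by (rule image_eqI) (rule UNIV_I)
  qed
  ultimately have "pluricanonical_fibre A J n m q \<subseteq> ?R"
    unfolding pluricanonical_fibre_def by (intro cfun.span_minimal) blast+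
  then obtain c where c: "s = cscale c (psi_pow m q)" using s by blast
  then have "s (frame_lists m q) = c"
    using psi_pow_frame by (simp add: cscale_def)
  then show ?thesis using c by simp
qed

lemma psi_pow_fibre: "psi_pow m q \<in> pluricanonical_fibre A J n m q"
  unfolding pluricanonical_fibre_def
  using F.psi_Lambda[of q] by (intro cfun.span_base CollectI exI[of _ "replicate m (psi q)"]) auto

lemma coefficient_smooth:
  assumes sm: "smooth_tensor A s" and s: "\<And>q. s q = cscale (f q) (psi_pow m q)"
  shows "smooth_fun f"
  unfolding smooth_fun_def
proof (intro ballI allI, rule Ck_on_local)
  fix c k x0 assume c: "c \<in> A" and x0: "x0 \<in> snd c ` fst c"
  note S = chart_image_open[OF c]
  let ?S = "snd c ` fst c"
  let ?X = "\<lambda>x. chart_vec A c (chart_inv c x)"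
  define q where "q = chart_inv c x0"
  have cq: "c \<in> charts_at A q" unfolding q_def by (rule charts_at_chart_inv[OF c x0])
  define es where "es = map (\<lambda>\<eta>. \<eta> c) (frame_list q)"
  define g where "g x = psi (chart_inv c x) (map (?X x) es)" for x
  have g: "Ck_on k ?S g" for k
    unfolding g_def using psi_smooth c unfolding smooth_tensor_def smooth_on_def by blast
  have fT: "set (frame_list q) \<subseteq> F.T q" using frame_tangent by auto
  have g0: "g x0 = 1"
    unfolding g_def es_def q_def[symmetric] map_chart_vec[OF cq fT] by (rule F.psi_vs)
  define U where "U = ?S \<inter> g -` (- {0})"
  have U: "open U" unfolding U_def
    by (rule continuous_open_preimage[OF Ck_on_imp_continuous_on[OF g[of 0]] S]) auto
  have "Ck_on k ?S (\<lambda>x. s (chart_inv c x) (map (?X x) (concat (replicate m es))))"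
    using sm c unfolding smooth_tensor_def smooth_on_def by blast
  then have 1: "Ck_on k U (\<lambda>x. s (chart_inv c x) (map (?X x) (concat (replicate m es))))"
    by (rule Ck_on_subset) (auto simp: U_def)
  have 2: "Ck_on k U (\<lambda>x. inverse (g x ^ m))"
    by (rule Ck_on_inverse[OF U Ck_on_power[OF U Ck_on_subset[OF g]]]) (auto simp: U_def)
  have "Ck_on k U (\<lambda>x. f (chart_inv c x))"
  proof (rule Ck_on_cong[OF U Ck_on_mult[OF U 1 2]])
    fix x assume x: "x \<in> U"
    have "map (?X x) (concat (replicate m es)) = concat (replicate m (map (?X x) es))"
      by (simp add: map_concat)
    moreover have "length (map (?X x) es) = n" by (simp add: es_def)
    ultimately have "s (chart_inv c x) (map (?X x) (concat (replicate m es))) = f (chart_inv c x) * g x ^ m"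
      unfolding s cscale_def g_def using tprods_concat by metis
    then show "s (chart_inv c x) (map (?X x) (concat (replicate m es))) * inverse (g x ^ m) = f (chart_inv c x)"
      using x by (simp add: U_def)
  qed
  then show "\<exists>U. open U \<and> x0 \<in> U \<and> Ck_on k U (\<lambda>x. f (chart_inv c x))"
    using U x0 g0 by (intro exI[of _ U]) (simp add: U_def)
qed

lemma canonical_section_scale:
  assumes "smooth_fun f"
  shows "(\<lambda>q. cscale (f q) (psi q)) \<in> canonical_sections A J n"
  unfolding canonical_sections_def
  using smooth_tensor_scale[OF assms psi_smooth] cfun.subspace_scale[OF F.Lambda_subspace F.psi_Lambda] by blast

lemma canonical_section_eq:
  assumes "\<sigma> \<in> canonical_sections A J n"
  obtains f where "smooth_fun f" "\<sigma> = (\<lambda>q. cscale (f q) (psi q))"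
proof -
  define f where "f q = \<sigma> q (frame_list q)" for q
  have sm: "smooth_tensor A \<sigma>" and \<sigma>: "\<sigma> q = cscale (f q) (psi q)" for q
    using assms F.Lambda_n0_eq[of "\<sigma> q" q] by (auto simp: canonical_sections_def f_def)
  have "psi_pow 1 q = psi q" for q
    using tprods_single[OF F.psi_kform[of q]] by simp
  then have "smooth_fun f"
    using coefficient_smooth[OF sm, of f 1] \<sigma> by simp
  with that \<sigma> show thesis by blast
qed

lemma canonical_sections_list:
  assumes "set ss \<subseteq> canonical_sections A J n"
  shows "\<exists>fs. (\<forall>f\<in>set fs. smooth_fun f) \<and> ss = map (\<lambda>f q. cscale (f q) (psi q)) fs"
  using assms
proof (induction ss)
  case (Cons \<sigma> ss)
  then obtain fs where fs: "\<forall>f\<in>set fs. smooth_fun f" "ss = map (\<lambda>f q. cscale (f q) (psi q)) fs" by auto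
  obtain f where f: "smooth_fun f" "\<sigma> = (\<lambda>q. cscale (f q) (psi q))"
    using canonical_section_eq[of \<sigma>] Cons.prems by auto
  show ?case using fs f by (intro exI[of _ "f # fs"]) simp
qed simp

lemma smooth_fun_prod_list:
  "\<forall>f\<in>set fs. smooth_fun f \<Longrightarrow> smooth_fun (\<lambda>q. prod_list (map (\<lambda>f. f q) fs))"
proof (induction fs)
  case Nil
  then show ?case by (simp add: smooth_fun_const)
next
  case (Cons f fs)
  have "smooth_fun (\<lambda>q. f q * prod_list (map (\<lambda>f. f q) fs))"
    by (rule smooth_fun_mult) (use Cons in auto)
  then show ?case by simp
qed

text \<open>Written with list updates so as to match \<open>dbar_leibniz\<close> term by
  term.\<close>

lemma dbar_prod_list:
  "\<forall>f\<in>set fs. smooth_fun f \<Longrightarrow> dbar (\<lambda>q. prod_list (map (\<lambda>f. f q) fs)) q \<xi> =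
    (\<Sum>i<length fs. prod_list ((map (\<lambda>f. f q) fs)[i := dbar (fs ! i) q \<xi>]))"
proof (induction fs)
  case Nil
  then show ?case by (simp add: dbar_const)
next
  case (Cons f fs)
  have "dbar (\<lambda>q. f q * prod_list (map (\<lambda>f. f q) fs)) q \<xi> =
      f q * dbar (\<lambda>q. prod_list (map (\<lambda>f. f q) fs)) q \<xi> + dbar f q \<xi> * prod_list (map (\<lambda>f. f q) fs)"
    by (rule dbar_mult) (use Cons.prems smooth_fun_prod_list in auto)
  also have "dbar (\<lambda>q. prod_list (map (\<lambda>f. f q) fs)) q \<xi> =
      (\<Sum>i<length fs. prod_list ((map (\<lambda>f. f q) fs)[i := dbar (fs ! i) q \<xi>]))"
    using Cons by simp
  finally show ?case
    by (simp add: sum.lessThan_Suc_shift sum_distrib_left del: sum.lessThan_Suc)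
qed

end

context framed_acs_dbar_closed
begin

definition dbar_tensor :: "nat \<Rightarrow> ('a \<Rightarrow> complex) \<Rightarrow> 'a \<Rightarrow> ('a, 'e) ctensor" where
  "dbar_tensor m f q = (\<lambda>xs. case xs of [] \<Rightarrow> 0 | \<xi> # ys \<Rightarrow> dbar f q \<xi> * psi_pow m q ys)"

text \<open>The factors enter only through their product; hence the Leibniz rule does not depend on
  the factorisation.\<close>

lemma dbar_leibniz_eq:
  assumes fs: "\<forall>f\<in>set fs. smooth_fun f"
  shows "dbar_leibniz A J n (map (\<lambda>f q. cscale (f q) (psi q)) fs) q =
    dbar_tensor (length fs) (\<lambda>q. prod_list (map (\<lambda>f. f q) fs)) q"
proof
  fix xs
  let ?ss = "map (\<lambda>f q. cscale (f q) (psi q)) fs"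
  show "dbar_leibniz A J n ?ss q xs = dbar_tensor (length fs) (\<lambda>q. prod_list (map (\<lambda>f. f q) fs)) q xs"
  proof (cases xs)
    case (Cons \<xi> ys)
    have "tprods n ((map (\<lambda>s. s q) ?ss)[i := (\<lambda>zs. dbar_canonical A J n (?ss ! i) q (\<xi> # zs))]) ys =
        prod_list ((map (\<lambda>f. f q) fs)[i := dbar (fs ! i) q \<xi>]) * psi_pow (length fs) q ys" if i: "i < length fs" for i
    proof -
      have "(\<lambda>zs. dbar_canonical A J n (?ss ! i) q (\<xi> # zs)) = cscale (dbar (fs ! i) q \<xi>) (psi q)"
        using dbar_canonical_scale[of "fs ! i" q \<xi>] fs i by (simp add: fun_eq_iff)
      moreover have "map (\<lambda>s. s q) ?ss = map (\<lambda>c. cscale c (psi q)) (map (\<lambda>f. f q) fs)"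
        by (simp add: o_def)
      ultimately have upd: "(map (\<lambda>s. s q) ?ss)[i := (\<lambda>zs. dbar_canonical A J n (?ss ! i) q (\<xi> # zs))]
          = map (\<lambda>c. cscale c (psi q)) ((map (\<lambda>f. f q) fs)[i := dbar (fs ! i) q \<xi>])"
        by (simp only: map_update)
      show ?thesis
        unfolding upd tprods_scale length_list_update length_map by (simp add: cscale_def)
    qed
    then show ?thesis
      unfolding dbar_leibniz_def dbar_tensor_def Cons dbar_prod_list[OF fs]
      by (simp add: sum_distrib_right)
  qed (simp add: dbar_leibniz_def dbar_tensor_def)
qed

text \<open>Evaluates the definite description. Any other local factorisation has product f on its
  neighbourhood of p, and \<partial>-bar of a function is local.\<close>

lemma dbar_pluri_eq:
  assumes f: "smooth_fun f" and m: "m \<ge> 1"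
  shows "dbar_pluri A J n m (\<lambda>q. cscale (f q) (psi_pow m q)) p = dbar_tensor m f p"
  unfolding dbar_pluri_def
proof (rule the_equality)
  \<comment> \<open>The global factorisation f, 1, ..., 1; m \<ge> 1 leaves a place for f.\<close>
  define fs where "fs = f # replicate (m - 1) (\<lambda>q. 1)"
  have len: "length fs = m" using m by (simp add: fs_def)
  have fs: "\<forall>f\<in>set fs. smooth_fun f" using f smooth_fun_const by (auto simp: fs_def)
  have prod: "(\<lambda>q. prod_list (map (\<lambda>f. f q) fs)) = f" by (simp add: fs_def)
  let ?ss = "map (\<lambda>f q. cscale (f q) (psi q)) fs"
  have "tprods n (map (\<lambda>\<sigma>. \<sigma> q) ?ss) = cscale (f q) (psi_pow m q)" for q
    using tprods_scale[of n "psi q" "map (\<lambda>f. f q) fs"] fun_cong[OF prod, of q] len by (simp add: o_def)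
  moreover have "set ?ss \<subseteq> canonical_sections A J n"
    using fs canonical_section_scale by auto
  moreover have "dbar_tensor m f p = dbar_leibniz A J n ?ss p"
    unfolding dbar_leibniz_eq[OF fs] prod len ..
  ultimately show "\<exists>U ss. open U \<and> p \<in> U \<and> length ss = m \<and> set ss \<subseteq> canonical_sections A J n \<and>
      (\<forall>q\<in>U. cscale (f q) (psi_pow m q) = tprods n (map (\<lambda>\<sigma>. \<sigma> q) ss)) \<and>
      dbar_tensor m f p = dbar_leibniz A J n ss p"
    using len by (intro exI[of _ UNIV] exI[of _ ?ss]) simp
next
  fix t assume "\<exists>U ss. open U \<and> p \<in> U \<and> length ss = m \<and> set ss \<subseteq> canonical_sections A J n \<and>
      (\<forall>q\<in>U. cscale (f q) (psi_pow m q) = tprods n (map (\<lambda>\<sigma>. \<sigma> q) ss)) \<and> t = dbar_leibniz A J n ss p"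
  then obtain U ss where U: "open U" "p \<in> U" and ss: "length ss = m" "set ss \<subseteq> canonical_sections A J n"
    and eq: "\<And>q. q \<in> U \<Longrightarrow> cscale (f q) (psi_pow m q) = tprods n (map (\<lambda>\<sigma>. \<sigma> q) ss)"
    and t: "t = dbar_leibniz A J n ss p" by blast
  obtain fs where fs: "\<forall>f\<in>set fs. smooth_fun f" and ss_eq: "ss = map (\<lambda>f q. cscale (f q) (psi q)) fs"
    using canonical_sections_list[OF ss(2)] by blast
  have len: "length fs = m" using ss ss_eq by simp
  have "f q = prod_list (map (\<lambda>f. f q) fs)" if "q \<in> U" for q
  proof -
    have "cscale (f q) (psi_pow m q) = cscale (prod_list (map (\<lambda>f. f q) fs)) (psi_pow m q)"
      unfolding eq[OF that] ss_eq using tprods_scale[of n "psi q" "map (\<lambda>f. f q) fs"] len by (simp add: o_def)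
    from fun_cong[OF this, of "frame_lists m q"] show ?thesis
      using psi_pow_frame[of m q] by (simp add: cscale_def)
  qed
  from dbar_local[OF f U this] show "t = dbar_tensor m f p"
    unfolding t ss_eq dbar_leibniz_eq[OF fs] len dbar_tensor_def by simp
qed

lemma H0_eq:
  assumes m: "m \<ge> 1"
  shows "H0 A J n m = {\<lambda>q. cscale (f q) (psi_pow m q) | f. smooth_fun f \<and> (\<forall>q \<xi>. dbar f q \<xi> = 0)}"
proof -
  have vanish: "dbar_tensor m f q = 0 \<longleftrightarrow> (\<forall>\<xi>. dbar f q \<xi> = 0)" for f q
  proof
    assume 0: "dbar_tensor m f q = 0"
    show "\<forall>\<xi>. dbar f q \<xi> = 0"
    proof
      fix \<xi> show "dbar f q \<xi> = 0"
        using fun_cong[OF 0, of "\<xi> # frame_lists m q"] psi_pow_frame[of m q] by (simp add: dbar_tensor_def)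
    qed
  next
    assume "\<forall>\<xi>. dbar f q \<xi> = 0"
    then show "dbar_tensor m f q = 0"
      by (auto simp: dbar_tensor_def fun_eq_iff split: list.split)
  qed
  show ?thesis
  proof (intro equalityI subsetI)
    fix s assume "s \<in> H0 A J n m"
    then have fib: "\<And>q. s q \<in> pluricanonical_fibre A J n m q" and sm: "smooth_tensor A s"
      and 0: "\<And>q. dbar_pluri A J n m s q = 0"
      by (auto simp: H0_def pluricanonical_sections_def)
    define f where "f q = s q (frame_lists m q)" for q
    have s: "s q = cscale (f q) (psi_pow m q)" for q
      unfolding f_def by (rule fibre_eq[OF fib])
    have f: "smooth_fun f" by (rule coefficient_smooth[OF sm s])
    have s': "s = (\<lambda>q. cscale (f q) (psi_pow m q))" using s by blast
    have "dbar_tensor m f q = 0" for q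
      using 0[of q] unfolding s' dbar_pluri_eq[OF f m] .
    then show "s \<in> {\<lambda>q. cscale (f q) (psi_pow m q) | f. smooth_fun f \<and> (\<forall>q \<xi>. dbar f q \<xi> = 0)}"
      using f s' vanish by blast
  next
    fix s assume "s \<in> {\<lambda>q. cscale (f q) (psi_pow m q) | f. smooth_fun f \<and> (\<forall>q \<xi>. dbar f q \<xi> = 0)}"
    then obtain f where f: "smooth_fun f" "\<And>q \<xi>. dbar f q \<xi> = 0" and s: "s = (\<lambda>q. cscale (f q) (psi_pow m q))"
      by blast
    have "cscale (f q) (psi_pow m q) \<in> pluricanonical_fibre A J n m q" for q
      using psi_pow_fibre[of m q] unfolding pluricanonical_fibre_def by (rule cfun.span_scale)
    moreover have "dbar_pluri A J n m s q = 0" for q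
      unfolding s dbar_pluri_eq[OF f(1) m] vanish using f(2) by simp
    ultimately show "s \<in> H0 A J n m"
      using smooth_tensor_scale[OF f(1) psi_pow_smooth] unfolding H0_def pluricanonical_sections_def s by blast
  qed
qed

end

section \<open>Pseudoholomorphic functions on compact manifolds\<close>

context framed_acs
begin

definition chart_J :: "('a, 'e) chart \<Rightarrow> 'e \<Rightarrow> 'e \<Rightarrow> 'e" where
  "chart_J c x e = J (chart_inv c x) (chart_vec A c (chart_inv c x) e) c"

lemma chart_J_lin:
  assumes c: "c \<in> A" and x: "x \<in> snd c ` fst c"
  shows "linear (chart_J c x)"
proof -
  note cx = charts_at_chart_inv[OF c x]
  have "chart_J c x (a *\<^sub>R e + b *\<^sub>R f) = a *\<^sub>R chart_J c x e + b *\<^sub>R chart_J c x f" for a b e f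
    unfolding chart_J_def chart_vec_lin[OF cx] F.J_lin[OF chart_vec_tangent[OF cx] chart_vec_tangent[OF cx]]
    by (simp add: rscale_def)
  from this[of 1 _ 1] this[of _ _ 0] show ?thesis
    by (intro linearI) simp_all
qed

lemma chart_J_continuous:
  assumes c: "c \<in> A" and Y: "continuous_on (snd c ` fst c) Y"
  shows "continuous_on (snd c ` fst c) (\<lambda>x. chart_J c x (Y x))"
proof -
  have J: "continuous_on (snd c ` fst c) (\<lambda>x. chart_J c x e)" for e
    using acs c unfolding almost_complex_structure_def smooth_on_def chart_J_def
    by (metis (no_types, lifting) Ck_on.simps(1))
  have "continuous_on (snd c ` fst c) (\<lambda>x. \<Sum>b\<in>Basis. (Y x \<bullet> b) *\<^sub>R chart_J c x b)"
    by (intro continuous_intros Y J)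
  moreover have "(\<Sum>b\<in>Basis. (Y x \<bullet> b) *\<^sub>R chart_J c x b) = chart_J c x (Y x)" if "x \<in> snd c ` fst c" for x
  proof -
    have "chart_J c x (Y x) = chart_J c x (\<Sum>b\<in>Basis. (Y x \<bullet> b) *\<^sub>R b)"
      by (simp add: euclidean_representation)
    then show ?thesis
      using chart_J_lin[OF c that] by (simp add: linear_sum linear_scale)
  qed
  ultimately show ?thesis by (simp cong: continuous_on_cong)
qed

text \<open>The strong maximum principle in one chart. The equation of
  \<open>pseudoholomorphic_hess\<close> has real coefficients, Z being a real field, so real parts
  of solutions are solutions.\<close>

lemma pseudoholomorphic_max_open:
  assumes f: "smooth_fun f" and dbar0: "\<And>q \<xi>. dbar f q \<xi> = 0"
    and U: "open U" "p \<in> U" and max: "\<And>q. q \<in> U \<Longrightarrow> Re (f q) \<le> Re (f p)"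
  obtains N where "open N" "p \<in> N" "N \<subseteq> U" "\<And>q. q \<in> N \<Longrightarrow> Re (f q) = Re (f p)"
proof -
  obtain c where cp: "c \<in> charts_at A p" by (rule charts_at_nonempty)
  then have c: "c \<in> A" "p \<in> fst c" by (auto simp: charts_at_iff)
  let ?T = "snd c ` fst c"
  note ST = chart_image_open[OF c(1)]
  define S where "S = snd c ` (fst c \<inter> U)"
  have S: "open S" "snd c p \<in> S" and SU: "\<And>x. x \<in> S \<Longrightarrow> chart_inv c x \<in> U"
    using eventually_chart[OF cp U] unfolding S_def by auto
  have S_T: "S \<subseteq> ?T" by (auto simp: S_def)
  define h where "h x = f (chart_inv c x)" for x
  have h: "Ck_on k ?T h" for k
    using f c unfolding smooth_fun_def h_def by blast
  define V where "V i x = v i (chart_inv c x) c" for i x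
  define W where "W i x = w i (chart_inv c x) c" for i x
  have VW: "Ck_on k ?T (V i)" "Ck_on k ?T (W i)" if "i \<in> {1..n}" for i k
    unfolding V_def W_def using frame_component_smooth[OF that c(1)] by auto
  define DV where "DV i x = FD (V i) x" for i x
  define DW where "DW i x = FD (W i) x" for i x
  define Z where "Z i x = chart_J c x (DW i x (V i x) - DV i x (W i x)) + DV i x (V i x) + DW i x (W i x)" for i x
  have hol: "FD h x (chart_J c x e) = \<i> * FD h x e" if x: "x \<in> ?T" for x e
  proof -
    let ?q = "chart_inv c x"
    note cx = charts_at_chart_inv[OF c(1) x]
    have sx: "snd c ?q = x" using c x by simp
    have "dbar f ?q (chart_vec A c ?q e) = (chart_diff c f ?q e + \<i> * chart_diff c f ?q (chart_J c x e)) / 2"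
      using dbar_apply[OF f cx chart_vec_tangent[OF cx, of e]] unfolding chart_vec_chart[OF cx] chart_J_def .
    then have "chart_diff c f ?q e + \<i> * chart_diff c f ?q (chart_J c x e) = 0"
      using dbar0 by simp
    \<comment> \<open>Multiplication by \<i> turns \<partial>-bar f = 0 into df(J e) = \<i>
      df(e).\<close>
    then have "\<i> * (chart_diff c f ?q e + \<i> * chart_diff c f ?q (chart_J c x e)) = 0" by simp
    then show ?thesis
      unfolding chart_diff_def sx h_def[symmetric] by (simp add: distrib_left mult.assoc[symmetric])
  qed
  have WJ: "W i x = chart_J c x (V i x)" if "i \<in> {1..n}" "x \<in> ?T" for i x
    unfolding W_def V_def chart_J_def
      chart_vec_of_tangent[OF charts_at_chart_inv[OF c(1) that(2)] frame_tangent(1)[OF that(1)]] J_v[OF that(1)] ..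
  define u where "u x = Re (h x)" for x
  have u: "Ck_on k ?T u" for k
    unfolding u_def by (rule Ck_on_bounded_linear[OF bounded_linear_Re ST h])
  have cont_D: "continuous_on ?T (\<lambda>x. FD X x (Y x))"
    if X: "Ck_on (Suc 0) ?T X" and Y: "continuous_on ?T Y" for X Y :: "'e \<Rightarrow> 'e"
  proof -
    have "continuous_on ?T (\<lambda>x. \<Sum>b\<in>Basis. (Y x \<bullet> b) *\<^sub>R FD X x b)"
      using X by (intro continuous_intros Y) simp
    then show ?thesis
      using frechet_derivative_Basis_sum[OF Ck_on_Suc_has_derivative[OF X]] by (simp cong: continuous_on_cong)
  qed
  have VWc: "continuous_on ?T (V i)" "continuous_on ?T (W i)" if "i \<in> {1..n}" for i
    using VW[OF that, of 0] by simp_all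
  obtain r where r: "r > 0" "ball (snd c p) r \<subseteq> S" "\<And>x. x \<in> ball (snd c p) r \<Longrightarrow> u x = u (snd c p)"
  proof (rule strong_maximum_principle[of S u "{1..n}" V W Z "u (snd c p)" "snd c p"])
    show "Ck_on (Suc (Suc 0)) S u" by (rule Ck_on_subset[OF u S_T])
    show "continuous_on S (V i)" "continuous_on S (W i)" if "i \<in> {1..n}" for i
      using VWc[OF that] S_T by (auto intro: continuous_on_subset)
    show "continuous_on S (Z i)" if i: "i \<in> {1..n}" for i
    proof (rule continuous_on_subset[OF _ S_T])
      show "continuous_on ?T (Z i)"
        unfolding Z_def DV_def DW_def
        by (intro continuous_on_add chart_J_continuous[OF c(1)] continuous_on_diff cont_D VW VWc i)
    qed
    show "hess u x (V i x) (V i x) + hess u x (W i x) (W i x) = - FD u x (Z i x)"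
      if i: "i \<in> {1..n}" and "x \<in> S" for i x
    proof -
      have x: "x \<in> ?T" using that S_T by blast
      have "hess h x (V i x) (V i x) + hess h x (W i x) (W i x) = - FD h x (Z i x)"
        unfolding Z_def DV_def DW_def
        by (rule pseudoholomorphic_hess[OF ST x h VW(1)[OF i] VW(2)[OF i] WJ[OF i] hol])
      from arg_cong[OF this, of Re] show ?thesis
        unfolding u_def hess_bounded_linear[OF bounded_linear_Re ST x h]
          frechet_derivative_bounded_linear[OF bounded_linear_Re h x] by simp
    qed
    show "e = 0" if "x \<in> S" and orth: "\<And>i. i \<in> {1..n} \<Longrightarrow> e \<bullet> V i x = 0 \<and> e \<bullet> W i x = 0" for x e
    proof -
      have x: "x \<in> ?T" using that S_T by blast
      \<comment> \<open>The sum is the frame expansion of e itself, so e is orthogonal to e.\<close>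
      have "e \<bullet> (\<Sum>j\<in>UNIV \<times> {1..n}. coframe_field c j x e *\<^sub>R frame_field c j x) = 0"
        unfolding inner_sum_right
        by (rule sum.neutral) (use orth in \<open>auto simp: frame_field_def V_def W_def\<close>)
      then show ?thesis
        unfolding dual_frames.complete[OF dual_frames_chart[OF c(1)] x] by simp
    qed
    show "u x \<le> u (snd c p)" if "x \<in> S" for x
      using max[OF SU[OF that]] c by (simp add: u_def h_def)
    fix r assume "r > 0" "ball (snd c p) r \<subseteq> S" "\<And>x. x \<in> ball (snd c p) r \<Longrightarrow> u x = u (snd c p)"
    then show thesis by (rule that)
  qed (rule S refl)+
  define N where "N = fst c \<inter> snd c -` ball (snd c p) r"
  have cont: "continuous_on (fst c) (snd c)"
    using chart_homeo[OF c(1)] by (simp add: homeomorphism_def)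
  show thesis
  proof (rule that)
    show "open N"
      unfolding N_def by (rule continuous_open_preimage[OF cont chart_open[OF c(1)] open_ball])
    show "p \<in> N" using c r(1) by (simp add: N_def)
    show "N \<subseteq> U"
    proof
      fix q assume q: "q \<in> N"
      then have "snd c q \<in> S" using r(2) by (auto simp: N_def)
      from SU[OF this] show "q \<in> U" using q c by (simp add: N_def)
    qed
    show "Re (f q) = Re (f p)" if "q \<in> N" for q
      using r(3)[of "snd c q"] that c by (simp add: N_def u_def h_def)
  qed
qed

section \<open>Connected components of the manifold\<close>

lemma component_open: "open (connected_component_set UNIV (p :: 'a))"
proof (subst open_subopen, intro ballI)
  fix q assume q: "q \<in> connected_component_set UNIV p"
  obtain c where cq: "c \<in> charts_at A q" by (rule charts_at_nonempty)
  then have c: "c \<in> A" "q \<in> fst c" by (auto simp: charts_at_iff)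
  obtain r where r: "r > 0" "ball (snd c q) r \<subseteq> snd c ` fst c"
    using chart_image_open[OF c(1)] c(2) openE by blast
  define N where "N = fst c \<inter> snd c -` ball (snd c q) r"
  have cont: "continuous_on (fst c) (snd c)" "continuous_on (snd c ` fst c) (chart_inv c)"
    using chart_homeo[OF c(1)] by (simp_all add: homeomorphism_def)
  \<comment> \<open>N is open as a preimage of the ball and connected as an image of it.\<close>
  have "N = chart_inv c ` ball (snd c q) r"
  proof (intro equalityI subsetI)
    fix y assume "y \<in> N"
    then show "y \<in> chart_inv c ` ball (snd c q) r"
      using c by (intro image_eqI[of _ _ "snd c y"]) (auto simp: N_def)
  next
    fix y assume "y \<in> chart_inv c ` ball (snd c q) r"
    then obtain x where x: "x \<in> ball (snd c q) r" "y = chart_inv c x" by blast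
    then show "y \<in> N" using r(2) c chart_inv_in[OF c(1)] by (auto simp: N_def subset_iff)
  qed
  then have "connected N"
    using connected_continuous_image[OF continuous_on_subset[OF cont(2) r(2)]] by simp
  moreover have "q \<in> N" using c r by (simp add: N_def)
  ultimately have "N \<subseteq> connected_component_set UNIV q"
    by (intro connected_component_maximal) auto
  also have "\<dots> = connected_component_set UNIV p"
    using q connected_component_eq by blast
  finally have "N \<subseteq> connected_component_set UNIV p" .
  moreover have "open N"
    unfolding N_def by (rule continuous_open_preimage[OF cont(1) chart_open[OF c(1)] open_ball])
  ultimately show "\<exists>T. open T \<and> q \<in> T \<and> T \<subseteq> connected_component_set UNIV p"
    using \<open>q \<in> N\<close> by blast
qed

lemma smooth_fun_continuous:
  assumes "smooth_fun f"
  shows "continuous_on UNIV f"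
proof (rule continuous_at_imp_continuous_on, intro ballI)
  fix q
  obtain c where cq: "c \<in> charts_at A q" by (rule charts_at_nonempty)
  then have c: "c \<in> A" "q \<in> fst c" by (auto simp: charts_at_iff)
  have 1: "continuous_on (snd c ` fst c) (\<lambda>x. f (chart_inv c x))"
    using assms c unfolding smooth_fun_def by (metis Ck_on_imp_continuous_on)
  have 2: "continuous_on (fst c) (snd c)"
    using chart_homeo[OF c(1)] by (simp add: homeomorphism_def)
  have "continuous_on (fst c) (\<lambda>q. f (chart_inv c (snd c q)))"
    by (rule continuous_on_compose2[OF 1 2]) auto
  then have "continuous_on (fst c) f"
    using c by (simp cong: continuous_on_cong)
  then show "isCont f q"
    using chart_open[OF c(1)] c(2) by (simp add: continuous_on_eq_continuous_at)
qed

text \<open>The compact component attains its maximum; the set M of maximum points is open by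
  \<open>pseudoholomorphic_max_open\<close>, applied with the component as the open set, and
  relatively closed by continuity.\<close>

lemma pseudoholomorphic_Re_constant:
  assumes compact: "compact (UNIV :: 'a set)" and f: "smooth_fun f" and dbar0: "\<And>q \<xi>. dbar f q \<xi> = 0"
    and q: "q \<in> connected_component_set UNIV p"
  shows "Re (f q) = Re (f p)"
proof -
  let ?C = "connected_component_set UNIV p"
  have cont: "continuous_on UNIV (\<lambda>q. Re (f q))"
    using smooth_fun_continuous[OF f] by (intro continuous_intros)
  have "closed ?C" by (rule closed_connected_component) simp
  then have "compact ?C"
    using compact compact_Int_closed[of UNIV ?C] by simp
  then obtain p0 where p0: "p0 \<in> ?C" "\<And>y. y \<in> ?C \<Longrightarrow> Re (f y) \<le> Re (f p0)"
    using continuous_attains_sup[of ?C "\<lambda>q. Re (f q)"] q continuous_on_subset[OF cont] by blast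
  define M where "M = {y \<in> ?C. Re (f y) = Re (f p0)}"
  have "open M"
  proof (subst open_subopen, intro ballI)
    fix y assume y: "y \<in> M"
    then have yC: "y \<in> ?C" and fy: "Re (f y) = Re (f p0)" by (auto simp: M_def)
    have "\<And>z. z \<in> ?C \<Longrightarrow> Re (f z) \<le> Re (f y)" using p0 fy by simp
    from pseudoholomorphic_max_open[OF f dbar0 component_open yC this]
    obtain N where "open N" "y \<in> N" "N \<subseteq> ?C" "\<And>z. z \<in> N \<Longrightarrow> Re (f z) = Re (f y)" by blast
    then show "\<exists>T. open T \<and> y \<in> T \<and> T \<subseteq> M"
      using fy by (intro exI[of _ N]) (auto simp: M_def)
  qed
  moreover have "open (?C - M)"
  proof -
    have "?C - M = ?C \<inter> (\<lambda>y. Re (f y)) -` (- {Re (f p0)})" by (auto simp: M_def)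
    then show ?thesis
      using continuous_open_preimage[OF continuous_on_subset[OF cont subset_UNIV] component_open, of "- {Re (f p0)}" p]
      by (simp add: open_Compl)
  qed
  moreover have "connected ?C" by simp
  ultimately have "M \<inter> ?C = {} \<or> (?C - M) \<inter> ?C = {}"
    by (intro connectedD[of ?C M "?C - M"]) auto
  then have "?C \<subseteq> M" using p0 by (auto simp: M_def)
  moreover have "p \<in> ?C" by simp
  ultimately have "q \<in> M" "p \<in> M" using q by blast+
  then show ?thesis by (simp add: M_def)
qed

text \<open>Im f is the real part of - \<i> f, which is again annihilated by \<partial>-bar.\<close>

lemma pseudoholomorphic_constant:
  assumes compact: "compact (UNIV :: 'a set)" and f: "smooth_fun f" and dbar0: "\<And>q \<xi>. dbar f q \<xi> = 0"
    and q: "q \<in> connected_component_set UNIV p"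
  shows "f q = f p"
proof (rule complex_eqI)
  show "Re (f q) = Re (f p)" by (rule pseudoholomorphic_Re_constant[OF assms])
  have g: "smooth_fun (\<lambda>q. - \<i> * f q)" by (rule smooth_fun_mult[OF smooth_fun_const f])
  have "dbar (\<lambda>q. - \<i> * f q) q \<xi> = 0" for q \<xi>
    unfolding dbar_mult[OF smooth_fun_const f] dbar_const dbar0 by simp
  from pseudoholomorphic_Re_constant[OF compact g this q] show "Im (f q) = Im (f p)" by simp
qed

text \<open>The components are an open partition, so a finite subcover omits none of them.\<close>

lemma finite_components:
  assumes "compact (UNIV :: 'a set)"
  shows "finite (components (UNIV :: 'a set))"
proof -
  have o: "open C" if "C \<in> components (UNIV :: 'a set)" for C
    using that component_open by (auto simp: components_iff)
  have cover: "UNIV \<subseteq> \<Union> (components (UNIV :: 'a set))"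
    using Union_components[of "UNIV :: 'a set"] by simp
  obtain D where D: "D \<subseteq> components (UNIV :: 'a set)" "finite D" "UNIV \<subseteq> \<Union> D"
    by (rule compactE[OF assms cover o])
  have "components (UNIV :: 'a set) \<subseteq> D"
  proof
    fix C assume C: "C \<in> components (UNIV :: 'a set)"
    then obtain x where "x \<in> C" using in_components_nonempty by blast
    then obtain C' where "C' \<in> D" "x \<in> C'" using D by blast
    then show "C \<in> D" using components_eq[OF C, of C'] D(1) \<open>x \<in> C\<close> by blast
  qed
  then show ?thesis using D(2) finite_subset by blast
qed

end

section \<open>The Kodaira dimension\<close>

text \<open>In general \<open>dim\<close> is also 0 for an infinite basis, as \<open>card\<close>
  is; the finite spanning set excludes this.\<close>

lemma (in vector_space) dim_eq_0_finite:
  assumes "finite B" "V \<subseteq> span B" "dim V = 0"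
  shows "V \<subseteq> {0}"
proof -
  obtain C where C: "C \<subseteq> V" "independent C" "V \<subseteq> span C" "card C = dim V"
    using basis_exists[of V] by blast
  have "finite C"
    using independent_span_bound[OF assms(1) C(2)] C(1) assms(2) by blast
  then have "C = {}" using C(4) assms(3) by simp
  then show ?thesis using C(3) by simp
qed

lemma limsup_log_quotient:
  fixes a :: "nat \<Rightarrow> ereal"
  assumes "\<And>m. m \<ge> 1 \<Longrightarrow> 0 \<le> a m \<and> a m \<le> ereal K"
  shows "limsup (\<lambda>m. a m / ereal (ln (real m))) = 0"
proof -
  have "filterlim (\<lambda>m. ln (real m)) at_top sequentially"
    using filterlim_compose[OF ln_at_top filterlim_real_sequentially] .
  then have "((\<lambda>m. K / ln (real m)) \<longlongrightarrow> 0) sequentially"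
    by (intro tendsto_divide_0[OF tendsto_const]) (rule filterlim_at_top_imp_at_infinity)
  then have lim: "((\<lambda>m. ereal (K / ln (real m))) \<longlongrightarrow> 0) sequentially"
    using tendsto_ereal[of _ 0] by (simp add: zero_ereal_def)
  have ev: "eventually (\<lambda>m. 0 \<le> a m / ereal (ln (real m)) \<and> a m / ereal (ln (real m)) \<le> ereal (K / ln (real m))) sequentially"
    \<comment> \<open>The logarithm is positive only from m = 2 on.\<close>
    using eventually_ge_at_top[of 2]
  proof eventually_elim
    case (elim m)
    then have ln: "ln (real m) > 0" by simp
    obtain r where r: "a m = ereal r" "0 \<le> r" "r \<le> K"
      using assms[of m] elim by (cases "a m") auto
    then show ?case using ln by (simp add: divide_right_mono)
  qed
  have "((\<lambda>m. a m / ereal (ln (real m))) \<longlongrightarrow> 0) sequentially"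
    by (rule tendsto_sandwich[OF _ _ tendsto_const lim]) (use ev in \<open>auto elim: eventually_mono\<close>)
  then show ?thesis
    by (intro lim_imp_Limsup) auto
qed

context framed_acs_dbar_closed
begin

text \<open>Gives the lower bound 1 for the dimension and excludes the value -\<infinity>. The
  factor \<open>cscale 1\<close> keeps the shape of \<open>H0_eq\<close>.\<close>

lemma psi_pow_in_H0:
  assumes "m \<ge> 1"
  shows "(\<lambda>q. cscale 1 (psi_pow m q)) \<in> H0 A J n m" and "(\<lambda>q. cscale 1 (psi_pow m q)) \<noteq> 0"
proof -
  show "(\<lambda>q. cscale 1 (psi_pow m q)) \<in> H0 A J n m"
    unfolding H0_eq[OF assms] using smooth_fun_const[of 1] dbar_const[of 1]
    by (intro CollectI exI[of _ "\<lambda>_. 1"]) simp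
  show "(\<lambda>q. cscale 1 (psi_pow m q)) \<noteq> 0"
  proof
    assume "(\<lambda>q. cscale 1 (psi_pow m q)) = 0"
    then have "cscale 1 (psi_pow m undefined) (frame_lists m undefined) = 0"
      by (simp add: fun_eq_iff)
    then show False using psi_pow_frame by (simp add: cscale_def)
  qed
qed

lemma H0_span:
  assumes compact: "compact (UNIV :: 'a set)" and m: "m \<ge> 1"
  obtains B where "finite B" "card B \<le> card (components (UNIV :: 'a set))" "H0 A J n m \<subseteq> csect.span B"
proof
  let ?C = "components (UNIV :: 'a set)"
  \<comment> \<open>The power of \<psi> on the component C, extended by 0 to the other
    components.\<close>
  define b where "b C q = cscale (if q \<in> C then 1 else 0) (psi_pow m q)" for C q
  have fin: "finite ?C" by (rule finite_components[OF compact])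
  then show "finite (b ` ?C)" "card (b ` ?C) \<le> card ?C" by (simp_all add: card_image_le)
  show "H0 A J n m \<subseteq> csect.span (b ` ?C)"
  proof
    fix s assume "s \<in> H0 A J n m"
    then obtain f where f: "smooth_fun f" "\<And>q \<xi>. dbar f q \<xi> = 0" and s: "s = (\<lambda>q. cscale (f q) (psi_pow m q))"
      unfolding H0_eq[OF m] by blast
    \<comment> \<open>By \<open>pseudoholomorphic_constant\<close> the value of f on C may be taken
      at any of its points.\<close>
    define r where "r C = f (SOME p. p \<in> C)" for C
    have "s = (\<Sum>C\<in>?C. cscale_sect (r C) (b C))"
    proof
      fix q :: 'a
      let ?Q = "connected_component_set UNIV q"
      have Q: "?Q \<in> ?C" "q \<in> ?Q" by (auto simp: components_iff)
      have "q \<in> C \<longleftrightarrow> C = ?Q" if C: "C \<in> ?C" for C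
        using components_eq[OF C Q(1)] Q(2) by blast
      then have "(\<Sum>C\<in>?C. cscale_sect (r C) (b C) q) = (\<Sum>C\<in>?C. if C = ?Q then cscale (r ?Q) (psi_pow m q) else 0)"
        by (intro sum.cong) (auto simp: cscale_sect_def b_def cscale_def fun_eq_iff)
      also have "\<dots> = cscale (r ?Q) (psi_pow m q)" using fin Q(1) by simp
      also have "r ?Q = f q"
      proof -
        have "(SOME p. p \<in> ?Q) \<in> ?Q" by (rule someI[of "\<lambda>p. p \<in> ?Q", OF Q(2)])
        from pseudoholomorphic_constant[OF compact f this] show ?thesis unfolding r_def .
      qed
      finally show "s q = (\<Sum>C\<in>?C. cscale_sect (r C) (b C)) q"
        unfolding s sum_fun_apply by simp
    qed
    then show "s \<in> csect.span (b ` ?C)"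
      by (simp only:) (intro csect.span_sum csect.span_scale csect.span_base imageI)
  qed
qed

lemma kodaira_dim_0:
  assumes compact: "compact (UNIV :: 'a set)"
  shows "kodaira_dim A J n = 0"
proof -
  define K where "K = card (components (UNIV :: 'a set))"
  have bounds: "0 \<le> log_dim (H0 A J n m) \<and> log_dim (H0 A J n m) \<le> ereal (ln (real K))" if m: "m \<ge> 1" for m
  proof -
    obtain B where B: "finite B" "card B \<le> K" "H0 A J n m \<subseteq> csect.span B"
      using H0_span[OF compact m] unfolding K_def by blast
    \<comment> \<open>With a finite spanning set and nonzero dimension, \<open>log_dim\<close> takes
      its finite branch, the logarithm of a number between 1 and K.\<close>
    have "csect.dim (H0 A J n m) \<noteq> 0"
      using csect.dim_eq_0_finite[OF B(1,3)] psi_pow_in_H0[OF m] by blast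
    moreover have "csect.dim (H0 A J n m) \<le> K"
      using csect.dim_le_card[OF B(3,1)] B(2) by simp
    ultimately show ?thesis
      using B(1,3) unfolding log_dim_def by auto
  qed
  have "\<not> (\<forall>m\<ge>1. H0 A J n m = {0})"
    using psi_pow_in_H0[of 1] by auto
  then show ?thesis
    unfolding kodaira_dim_def using limsup_log_quotient[OF bounds] by simp
qed

end

theorem proposition3p6:
  fixes A :: "('a::{t2_space,second_countable_topology}, 'e::euclidean_space) chart set"
    and J :: "'a \<Rightarrow> ('a, 'e) tvec \<Rightarrow> ('a, 'e) tvec"
    and n :: nat
    and v w :: "nat \<Rightarrow> 'a \<Rightarrow> ('a, 'e) tvec"
    and v' w' :: "nat \<Rightarrow> 'a \<Rightarrow> ('a, 'e) tvec \<Rightarrow> real"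
    and \<phi> :: "nat \<Rightarrow> 'a \<Rightarrow> ('a, 'e) ctensor"
    and \<psi> :: "'a \<Rightarrow> ('a, 'e) ctensor"
  assumes "DIM('e) = 2 * n"
    and "smooth_atlas A"
    and "compact (UNIV :: 'a set)"
    and "almost_complex_structure A J"
    and "global_frame A n v w"
    and "\<And>i p. i \<in> {1..n} \<Longrightarrow> J p (v i p) = w i p"
    and "\<And>i p. i \<in> {1..n} \<Longrightarrow> J p (w i p) = - v i p"
    and "dual_coframe A n v w v' w'"
    and "\<And>i. \<phi> i = complex_one_form A (v' i) (w' i)"
    and "\<psi> = (\<lambda>p. wedges (map (\<lambda>i. \<phi> i p) [1..<Suc n]))"
    and "\<And>p. dbar_form A J n 0 \<psi> p = 0"
  shows "kodaira_dim A J n = 0"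
proof -
  interpret framed_acs A J n v w v' w'
    using assms(2,4-8) by unfold_locales
  \<comment> \<open>\<open>F.phi\<close> is formed with families constant in the point;
    \<open>complex_one_form\<close> only evaluates its families at p, so the two agree.\<close>
  have "psi p = \<psi> p" for p
    unfolding F.psi_def F.phi_def assms(9,10) complex_one_form_def ..
  then have "\<psi> = psi" by (simp add: fun_eq_iff)
  then interpret framed_acs_dbar_closed A J n v w v' w'
    using assms(11) by unfold_locales simp
  show ?thesis by (rule kodaira_dim_0[OF assms(3)])
qed

end
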